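(* Let $\mu=(\mu_1\ge\dots\ge\mu_n\ge0)$ be a partition, let $(w,T)\in\overline{\mathcal F}(\mu)$ (type $C_n$), and put $\sigma=f(w,T)$ and $\tau=\mathrm{ord}(\sigma)$. Then \[\mathrm{level}(w,T)=\frac12\sum_{c\in\mathrm{Des}(\sigma)}\mathrm{arm}(c)=\mathrm{charge}(\mathrm{cw}_2(\tau)).\]
   Context: Let $[\overline{n}]=\{1<\dots<n<\overline{n}<\dots<\overline{1}\}$, $\overline{\overline{\imath}}=i$. $B_n$ is the group of signed permutations $w$ of $[\overline{n}]$ ($w(\overline{\imath})=\overline{w(i)}$), $w[1,k]=w(1)\dots w(k)$, $\ell(w)=\#\{(k,l)\in[n]\times[\overline{n}]:k\le|l|,\ w(k)>w(l)\}$, $<$ = Bruhat order. Roots/reflections: $(i,j)$ ($i<j\le n$) = $\varepsilon_i-\varepsilon_j$, reflection $t_{ij}t_{\overline{\jmath}\,\overline{\imath}}$; $(i,\overline{\jmath})$ ($i<j$) = $\varepsilon_i+\varepsilon_j$, reflection $t_{i\overline{\jmath}}t_{j\overline{\imath}}$; $(i,\overline{\imath})=2\varepsilon_i$, reflection $t_{i\overline{\imath}}$; right multiplication by $t_{ab}$ swaps the entries in positions $a,b$. $\langle\rho,(i,j)^\vee\rangle=j-i$, $\langle\rho,(i,\overline{\jmath})^\vee\rangle=2n+2-i-j$, $\langle\rho,(i,\overline{\imath})^\vee\rangle=n+1-i$. $\Gamma_i=((1,\overline{\imath}),\dots,(i-1,\overline{\imath}))$; $\Gamma_{ki}=((1,\overline{\imath}),\dots,(i-1,\overline{\imath}),(i,\overline{k+1}),\dots,(i,\overline{n}),(i,\overline{\imath}),(i,n),(i,n-1),\dots,(i,k+1))$;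 $\Gamma_r(k)=\Gamma_2\cdots\Gamma_k$, $\Gamma_l(k)=\Gamma_{k1}\cdots\Gamma_{kk}$. $\Gamma=\Gamma^{\mu_1}\cdots\Gamma^1=(\beta_1,\dots,\beta_m)$, $\Gamma^j=\Gamma^j_r\Gamma^j_l$ with $\Gamma^j_r=\Gamma_r(\mu'_j)$, $\Gamma^j_l=\Gamma_l(\mu'_j)$. Affine level $l_i=\#\{j\le i:\beta_j=\beta_i\}$. Folding pair $(w,J)$, $J=\{j_1<\dots<j_s\}$, $w_i=w\beta_{j_1}\cdots\beta_{j_i}$, $\mathrm{end}(w,J)=w_s$, $j_i$ negative folding iff $w_{i-1}<w_i$, $J^-$ the negative foldings, $\mathrm{level}(w,J)=\sum_{j\in J^-}l_j$. $\overline{\mathcal F}(\mu)$: folding pairs with $\frac12(\ell(w)+\ell(\mathrm{end}(w,J))-\#J)+\sum_{j\in J^-}\langle\rho,\beta_j^\vee\rangle=0$. $J$ is identified with the subsequence $T=T^{\mu_1}\cdots T^1$, $T^j=T^j_rT^j_l$, of $\Gamma$. With $\pi^j_r=wT^{\mu_1}\cdots T^{j+1}$, $\pi^j_l=\pi^j_rT^j_r$, $f(w,T)=C^{\mu_1}_rC^{\mu_1}_l\cdots C^1_rC^1_l$ (columns displayed left to right in this order, top-justified, shape $2\mu$), $C^j_r=\pi^j_r[1,\mu'_j]$, $C^j_l=\pi^j_l[1,\mu'_j]$. $\mathrm{ord}$ sorts each column increasingly in $[\overline{n}]$. A cell in row $i$ of a column $X$ of $\sigma$ is a descent if the column $Y$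 immediately to the left of $X$ has a row $i$ and $X(i)>Y(i)$ in $[\overline{n}]$; $\mathrm{Des}(\sigma)$ is the set of descents; $\mathrm{arm}(c)$ is the number of cells to the left of $c$ in its row. Charge word: label the columns of $\tau$ (displayed as $\sigma$) by $C^j_l\mapsto j$ and $C^j_r\mapsto j'$, on the alphabet $1<1'<2<2'<\cdots$. $\mathrm{cw}(\tau)$ has a biletter $\binom{k}{j}$ for each entry $k$ in column labeled $j$, ordered by decreasing $k$ (in $[\overline{n}]$), and for equal $k$ by decreasing label; $\mathrm{cw}_2(\tau)$ is the word of lower letters. Charge of a word $v$ over $1,1',2,2',\dots$ with as many $j$ as $j'$ and at least as many $j$ as $j+1$: scan from the right end selecting $1,1',2,2',\dots$ in this order as long as the next letter is available: select the rightmost $1$; after selecting a letter, select the first (nearest) unselected copy of the next letter to its left, and if there is none select the rightmost copy. If the letters selected in this iteration are $1,1',\dots,k,k'$, the iteration contributes $k-j$ for each $j$ such that the selected $j+1$ lies to the right of the previously selected $j'$. Remove the selected letters and repeat until empty; $\mathrm{charge}(v)$ is the sum of all contributions. *)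

theory Defs
  imports Complex_Main "HOL-Combinatorics.Permutations" "HOL-Library.Product_Lexorder"
begin

text \<open>The letter \<open>i\<close> is \<open>Plain i\<close> and the barred letter is \<open>Barred i\<close>;
  the order is \<open>1 < 2 < \<dots>\<close> on plain letters, every plain letter is below every barred one,
  and the order is reversed on barred letters.\<close>

datatype letter = Plain nat | Barred nat

instantiation letter :: linorder
begin

fun less_eq_letter :: "letter \<Rightarrow> letter \<Rightarrow> bool" where
  "Plain i \<le> Plain j \<longleftrightarrow> i \<le> j"
| "Plain i \<le> Barred j \<longleftrightarrow> True"
| "Barred i \<le> Plain j \<longleftrightarrow> False"
| "Barred i \<le> Barred j \<longleftrightarrow> j \<le> i"

definition less_letter :: "letter \<Rightarrow> letter \<Rightarrow> bool" where
  "x < y \<longleftrightarrow> x \<le> y \<and> \<not> y \<le> (x :: letter)"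

instance
proof
  fix x y z :: letter
  show "x < y \<longleftrightarrow> x \<le> y \<and> \<not> y \<le> x" by (rule less_letter_def)
  show "x \<le> x" by (cases x) auto
  show "x \<le> z" if "x \<le> y" "y \<le> z" using that by (cases x; cases y; cases z) auto
  show "x = y" if "x \<le> y" "y \<le> x" using that by (cases x; cases y) auto
  show "x \<le> y \<or> y \<le> x" by (cases x; cases y) auto
qed

end

fun bar :: "letter \<Rightarrow> letter" where
  "bar (Plain i) = Barred i"
| "bar (Barred i) = Plain i"

fun absval :: "letter \<Rightarrow> nat" where
  "absval (Plain i) = i"
| "absval (Barred i) = i"

definition letters :: "nat \<Rightarrow> letter set" where
  "letters n = Plain ` {1..n} \<union> Barred ` {1..n}"

definition signed_perms :: "nat \<Rightarrow> (letter \<Rightarrow> letter) set" where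
  "signed_perms n = {w. w permutes letters n \<and> (\<forall>x. w (bar x) = bar (w x))}"

definition coxeter_length :: "nat \<Rightarrow> (letter \<Rightarrow> letter) \<Rightarrow> nat" where
  "coxeter_length n w =
     card {(k, l). k \<in> {1..n} \<and> l \<in> letters n \<and> k \<le> absval l \<and> w (Plain k) > w l}"

text \<open>\<open>(Plain i, Plain j)\<close> and \<open>(Plain i, Barred j)\<close> with \<open>i < j\<close> stand for
  \<open>\<epsilon>\<^sub>i - \<epsilon>\<^sub>j\<close> and \<open>\<epsilon>\<^sub>i + \<epsilon>\<^sub>j\<close>; \<open>(Plain i, Barred i)\<close> stands for \<open>2\<epsilon>\<^sub>i\<close>.\<close>

type_synonym root = "letter \<times> letter"

definition positive_roots :: "nat \<Rightarrow> root set" where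
  "positive_roots n =
     {(Plain i, Plain j) | i j. 1 \<le> i \<and> i < j \<and> j \<le> n} \<union>
     {(Plain i, Barred j) | i j. 1 \<le> i \<and> i < j \<and> j \<le> n} \<union>
     {(Plain i, Barred i) | i. 1 \<le> i \<and> i \<le> n}"

definition reflection :: "root \<Rightarrow> letter \<Rightarrow> letter" where
  "reflection \<beta> = (case \<beta> of (a, b) \<Rightarrow>
     if b = bar a then transpose a b
     else transpose a b \<circ> transpose (bar b) (bar a))"

text \<open>The pairing of \<open>\<rho>\<close> with the coroot of a positive root.\<close>

fun rho_coroot :: "nat \<Rightarrow> root \<Rightarrow> int" where
  "rho_coroot n (Plain i, Plain j) = int j - int i"
| "rho_coroot n (Plain i, Barred j) =
     (if i = j then int n + 1 - int i else 2 * int n + 2 - int i - int j)"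

definition bruhat_less :: "nat \<Rightarrow> (letter \<Rightarrow> letter) \<Rightarrow> (letter \<Rightarrow> letter) \<Rightarrow> bool" where
  "bruhat_less n =
     (\<lambda>u v. \<exists>\<beta>\<in>positive_roots n. v = u \<circ> reflection \<beta> \<and>
        coxeter_length n u < coxeter_length n v)\<^sup>+\<^sup>+"

text \<open>A partition is the weakly decreasing list of its \<open>n\<close> parts, zeros included.\<close>

definition conj_part :: "nat list \<Rightarrow> nat \<Rightarrow> nat" where
  "conj_part \<mu> j = length (filter (\<lambda>x. j \<le> x) \<mu>)"

definition Gamma_single :: "nat \<Rightarrow> root list" where
  "Gamma_single i = map (\<lambda>l. (Plain l, Barred i)) [1..<i]"

definition Gamma_pair :: "nat \<Rightarrow> nat \<Rightarrow> nat \<Rightarrow> root list" where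
  "Gamma_pair n k i =
     map (\<lambda>l. (Plain l, Barred i)) [1..<i] @
     map (\<lambda>l. (Plain i, Barred l)) [Suc k..<Suc n] @
     [(Plain i, Barred i)] @
     map (\<lambda>l. (Plain i, Plain l)) (rev [Suc k..<Suc n])"

definition Gamma_r :: "nat \<Rightarrow> root list" where
  "Gamma_r k = concat (map Gamma_single [2..<Suc k])"

definition Gamma_l :: "nat \<Rightarrow> nat \<Rightarrow> root list" where
  "Gamma_l n k = concat (map (Gamma_pair n k) [1..<Suc k])"

text \<open>\<open>Gamma_above n \<mu> j\<close> is the initial part \<open>\<Gamma>\<^sup>a \<dots> \<Gamma>\<^sup>j\<^sup>+\<^sup>1\<close> of the chain, with \<open>a\<close> the largest
  part of \<open>\<mu>\<close>.\<close>

definition Gamma_above :: "nat \<Rightarrow> nat list \<Rightarrow> nat \<Rightarrow> root list" where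
  "Gamma_above n \<mu> j =
     concat (map (\<lambda>i. Gamma_r (conj_part \<mu> i) @ Gamma_l n (conj_part \<mu> i))
       (rev [Suc j..<Suc (hd \<mu>)]))"

definition Gamma_chain :: "nat \<Rightarrow> nat list \<Rightarrow> root list" where
  "Gamma_chain n \<mu> = Gamma_above n \<mu> 0"

text \<open>Positions in a chain are counted from \<open>0\<close>, so folding sets are subsets of \<open>{..<m}\<close>.
  For a prefix \<open>G\<close> of the chain, \<open>nths G J\<close> is the part of the subsequence \<open>T\<close> indexed by \<open>J\<close>
  that lies in that prefix.\<close>

definition act :: "(letter \<Rightarrow> letter) \<Rightarrow> root list \<Rightarrow> (letter \<Rightarrow> letter)" where
  "act w T = foldl (\<lambda>u \<beta>. u \<circ> reflection \<beta>) w T"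

definition fold_end :: "root list \<Rightarrow> (letter \<Rightarrow> letter) \<Rightarrow> nat set \<Rightarrow> (letter \<Rightarrow> letter)" where
  "fold_end G w J = act w (nths G J)"

text \<open>For \<open>p = j\<^sub>i\<close> in \<open>J\<close>, the prefix products below are \<open>w\<^sub>i\<^sub>-\<^sub>1\<close> and \<open>w\<^sub>i\<close>.\<close>

definition negative_foldings :: "nat \<Rightarrow> root list \<Rightarrow> (letter \<Rightarrow> letter) \<Rightarrow> nat set \<Rightarrow> nat set" where
  "negative_foldings n G w J =
     {p \<in> J. bruhat_less n (act w (nths (take p G) J)) (act w (nths (take (Suc p) G) J))}"

definition affine_level :: "root list \<Rightarrow> nat \<Rightarrow> nat" where
  "affine_level G p = card {q. q \<le> p \<and> G ! q = G ! p}"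

definition level :: "nat \<Rightarrow> nat list \<Rightarrow> (letter \<Rightarrow> letter) \<Rightarrow> nat set \<Rightarrow> nat" where
  "level n \<mu> w J =
     (\<Sum>p\<in>negative_foldings n (Gamma_chain n \<mu>) w J. affine_level (Gamma_chain n \<mu>) p)"

definition folding_pairs :: "nat \<Rightarrow> nat list \<Rightarrow> ((letter \<Rightarrow> letter) \<times> nat set) set" where
  "folding_pairs n \<mu> = signed_perms n \<times> Pow {..<length (Gamma_chain n \<mu>)}"

definition folding_pairs_bar :: "nat \<Rightarrow> nat list \<Rightarrow> ((letter \<Rightarrow> letter) \<times> nat set) set" where
  "folding_pairs_bar n \<mu> = {(w, J) \<in> folding_pairs n \<mu>.
     1 / 2 * (real (coxeter_length n w)
              + real (coxeter_length n (fold_end (Gamma_chain n \<mu>) w J)) - real (card J))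
     + (\<Sum>p\<in>negative_foldings n (Gamma_chain n \<mu>) w J.
          real_of_int (rho_coroot n (Gamma_chain n \<mu> ! p))) = 0}"

text \<open>A filling is the list of its columns from left to right, each read from top to bottom.
  Columns are top-justified, so row \<open>i\<close> (counted from \<open>0\<close>) meets exactly the columns of
  length greater than \<open>i\<close>; a cell is a pair (row, column).\<close>

type_synonym filling = "letter list list"

definition word_prefix :: "(letter \<Rightarrow> letter) \<Rightarrow> nat \<Rightarrow> letter list" where
  "word_prefix w k = map (\<lambda>i. w (Plain i)) [1..<Suc k]"

definition column_r :: "nat \<Rightarrow> nat list \<Rightarrow> (letter \<Rightarrow> letter) \<Rightarrow> nat set \<Rightarrow> nat \<Rightarrow> letter list" where
  "column_r n \<mu> w J j =
     word_prefix (act w (nths (Gamma_above n \<mu> j) J)) (conj_part \<mu> j)"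

definition column_l :: "nat \<Rightarrow> nat list \<Rightarrow> (letter \<Rightarrow> letter) \<Rightarrow> nat set \<Rightarrow> nat \<Rightarrow> letter list" where
  "column_l n \<mu> w J j =
     word_prefix (act w (nths (Gamma_above n \<mu> j @ Gamma_r (conj_part \<mu> j)) J)) (conj_part \<mu> j)"

definition filling_map :: "nat \<Rightarrow> nat list \<Rightarrow> (letter \<Rightarrow> letter) \<Rightarrow> nat set \<Rightarrow> filling" where
  "filling_map n \<mu> w J =
     concat (map (\<lambda>j. [column_r n \<mu> w J j, column_l n \<mu> w J j]) (rev [1..<Suc (hd \<mu>)]))"

definition ord_filling :: "filling \<Rightarrow> filling" where
  "ord_filling \<sigma> = map sort \<sigma>"

definition Des :: "filling \<Rightarrow> (nat \<times> nat) set" where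
  "Des \<sigma> = {(i, c). 0 < c \<and> c < length \<sigma> \<and> i < length (\<sigma> ! c) \<and>
              i < length (\<sigma> ! (c - 1)) \<and> \<sigma> ! c ! i > \<sigma> ! (c - 1) ! i}"

definition arm :: "filling \<Rightarrow> nat \<times> nat \<Rightarrow> nat" where
  "arm \<sigma> = (\<lambda>(i, c). card {d. d < c \<and> i < length (\<sigma> ! d)})"

text \<open>The alphabet \<open>1 < 1' < 2 < 2' < \<dots>\<close> is encoded, in this order, as \<open>1 < 2 < 3 < 4 < \<dots>\<close>,
  so the next letter is always the successor.\<close>

definition unprimed :: "nat \<Rightarrow> nat" where
  "unprimed j = 2 * j - 1"

definition primed :: "nat \<Rightarrow> nat" where
  "primed j = 2 * j"

text \<open>A filling displayed as \<open>filling_map\<close> has columns labeled \<open>\<dots>, 2', 2, 1', 1\<close> from left to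
  right, so the code of a column's label is the position of the column counted from the right.\<close>

definition column_label :: "filling \<Rightarrow> nat \<Rightarrow> nat" where
  "column_label \<tau> c = length \<tau> - c"

text \<open>Biletters are pairs (entry, label), listed in decreasing lexicographic order.\<close>

definition charge_word :: "filling \<Rightarrow> (letter \<times> nat) list" where
  "charge_word \<tau> =
     rev (sort (concat (map (\<lambda>c. map (\<lambda>k. (k, column_label \<tau> c)) (\<tau> ! c)) [0..<length \<tau>])))"

definition charge_word2 :: "filling \<Rightarrow> nat list" where
  "charge_word2 \<tau> = map snd (charge_word \<tau>)"

text \<open>The position at which the letter \<open>a\<close> is selected, if the previously selected letter is at
  position \<open>p\<close>.\<close>

definition next_position :: "nat list \<Rightarrow> nat \<Rightarrow> nat \<Rightarrow> nat" where
  "next_position v p a =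
     (if \<exists>q<p. q < length v \<and> v ! q = a then Max {q. q < p \<and> q < length v \<and> v ! q = a}
      else Max {q. q < length v \<and> v ! q = a})"

text \<open>Starting just beyond the right end makes the first selected letter the rightmost \<open>1\<close>.\<close>

fun selected_position :: "nat list \<Rightarrow> nat \<Rightarrow> nat" where
  "selected_position v 0 = length v"
| "selected_position v (Suc a) = next_position v (selected_position v a) (Suc a)"

text \<open>The code of the last letter selected: the selection stops at the first missing letter.\<close>

definition last_letter :: "nat list \<Rightarrow> nat" where
  "last_letter v = (LEAST a. Suc a \<notin> set v)"

definition selected_positions :: "nat list \<Rightarrow> nat set" where
  "selected_positions v = selected_position v ` {1..last_letter v}"

definition charge_contribution :: "nat list \<Rightarrow> nat" where
  "charge_contribution v =
     (let k = last_letter v div 2 in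
      \<Sum>j | 1 \<le> j \<and> j < k \<and>
           selected_position v (primed j) < selected_position v (unprimed (j + 1)). k - j)"

definition remove_selected :: "nat list \<Rightarrow> nat list" where
  "remove_selected v = nths v (- selected_positions v)"

lemma next_position_less:
  assumes "a \<in> set v"
  shows "next_position v p a < length v"
proof -
  let ?A = "{q. q < length v \<and> v ! q = a}" and ?B = "{q. q < p \<and> q < length v \<and> v ! q = a}"
  have A: "Max ?A \<in> ?A"
    by (rule Max_in) (use assms in \<open>auto simp: in_set_conv_nth\<close>)
  have B: "Max ?B \<in> ?B" if "\<exists>q<p. q < length v \<and> v ! q = a"
    by (rule Max_in) (use that in auto)
  show ?thesis using A B by (auto simp: next_position_def)
qed

lemma length_remove_selected:
  assumes "1 \<in> set v"
  shows "length (remove_selected v) < length v"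
proof -
  have "finite (set v)" by simp
  then obtain a where "Suc a \<notin> set v"
    by (metis Suc_n_not_le_n finite_nat_set_iff_bounded_le le_SucI)
  hence "Suc (last_letter v) \<notin> set v"
    unfolding last_letter_def by (rule LeastI)
  with assms have "0 < last_letter v"
    by (cases "last_letter v") auto
  hence "1 \<in> {1..last_letter v}" by simp
  hence sel: "selected_position v 1 \<in> selected_positions v"
    unfolding selected_positions_def by (rule imageI)
  have "selected_position v 1 < length v"
    using next_position_less[OF assms] by simp
  with sel have "{i. i < length v \<and> i \<in> - selected_positions v} \<subset> {..<length v}"
    by auto
  from psubset_card_mono[OF _ this] show ?thesis
    by (simp add: remove_selected_def length_nths)
qed

text \<open>A nonempty word with as many \<open>j\<close> as \<open>j'\<close> and at least as many \<open>j\<close> as \<open>j + 1\<close> contains the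
  letter \<open>1\<close>, and so does every nonempty word obtained from it by removing selected letters.
  For such words the recursion stops exactly at the empty word.\<close>

function charge :: "nat list \<Rightarrow> nat" where
  "charge v = (if 1 \<notin> set v then 0 else charge_contribution v + charge (remove_selected v))"
  by auto
termination
  by (relation "measure length") (auto simp: length_remove_selected simp del: One_nat_def)

declare charge.simps [simp del]

end

theory Submission
  imports Defs
begin

text \<open>
  Rewrite the condition defining \<open>folding_pairs_bar\<close> as the vanishing of a sum of nonnegative
  terms: the length of the end, the slack of every downward step (which lowers the length by at
  least one) and the slack of every upward step by a root \<open>\<beta>\<close> (which raises the length by at most
  \<open>2\<langle>\<rho>, \<beta>\<^sup>\<vee>\<rangle> - 1\<close>). So the chain ends at the identity and every step is extremal, which amounts to
  betweenness conditions on the entries of the signed permutation. Roots \<open>\<epsilon>\<^sub>i + \<epsilon>\<^sub>j\<close> with \<open>i < j\<close>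
  never go up.

  Followed through one segment \<open>\<Gamma>\<^sub>r\<close> or \<open>\<Gamma>\<^sub>l\<close>, these conditions say that in every row \<open>l\<close> the left
  entry is the first one reached from the right entry, going up cyclically, among the left entries
  in rows \<open>\<ge> l\<close>, and that the row contains one upward step if this wraps around and none otherwise.
  This is the selection rule of the charge statistic, so one iteration of it selects exactly one row
  of \<open>\<sigma>\<close>, and its contributions come from the descents of that row. The affine level of an upward
  step in row \<open>l\<close> counts the segments \<open>\<Gamma>\<^sub>l\<close> so far whose columns reach row \<open>l\<close>, which is half the arm
  of the descent.\<close>

text \<open>Entries are carried into the reals so that barring becomes negation; a reflection then
  acts on a real sequence, and extremality of a step becomes a list of intervals that must be empty.
  A segment \<Gamma>_l is read in stages \<open>Gamma_pair n k i\<close>, and stage \<open>i\<close>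
  settles row \<open>i\<close>. The obstacle is that the roots \<open>(Plain l, Barred i)\<close>
  with \<open>l < i\<close> let a later stage lower row \<open>l\<close> again, at a time when rows
  between \<open>l\<close> and \<open>i\<close> may have lost their entries, whereas the selection
  rule speaks of the entries of the left column. The notion \<open>blocked\<close> records that an
  obstructing value may wander but cannot disappear, so a late step never passes an original entry
  below row \<open>l\<close>. A segment \<Gamma>_r is a subsequence of \<Gamma>_l for the same
  column height, so only \<Gamma>_l needs analysis. As \<Gamma>_r never goes up, descents occur only
  between labels \<open>j + 1\<close> and \<open>j'\<close>, which is where charge looks for them.
  Both columns of a pair count in the arm, whence the factor one half. Charge starts at the smallest
  entry labeled \<open>1\<close>; this is the top remaining row because the chain ends at the
  identity.\<close>

subsection \<open>Lengths of signed permutations\<close>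

text \<open>An order embedding that turns the bar into negation.\<close>

fun val :: "letter \<Rightarrow> real" where
  "val (Plain i) = - 1 / (real i + 1)"
| "val (Barred i) = 1 / (real i + 1)"

lemma val_le_iff: "val x \<le> val y \<longleftrightarrow> x \<le> y"
proof (cases x; cases y)
  fix i j assume "x = Plain i" "y = Barred j"
  moreover have "- 1 / (real i + 1) \<le> 0" "(0::real) \<le> 1 / (real j + 1)"
    by (auto simp: divide_nonpos_pos)
  ultimately show ?thesis by (metis less_eq_letter.simps(2) order_trans val.simps)
next
  fix i j assume "x = Barred i" "y = Plain j"
  moreover have "- 1 / (real j + 1) < 0" "(0::real) < 1 / (real i + 1)"
    by (auto simp: divide_neg_pos)
  ultimately show ?thesis by (metis less_eq_letter.simps(3) not_le order_less_trans val.simps)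
qed (auto simp: field_simps)

lemma val_less_iff: "val x < val y \<longleftrightarrow> x < y"
  using val_le_iff[of y x] by (meson not_le)

lemma val_eq_iff: "val x = val y \<longleftrightarrow> x = y"
  by (metis val_le_iff order_antisym order_refl)

lemma val_bar: "val (bar x) = - val x"
  by (cases x) auto

lemma val_ne_0: "val x \<noteq> 0"
  by (cases x) (auto simp: add_eq_0_iff)

definition win :: "(letter \<Rightarrow> letter) \<Rightarrow> nat \<Rightarrow> real" where
  "win u i = val (u (Plain i))"

text \<open>Right multiplication by a reflection, seen on windows. The second clause also covers
  \<open>i = j\<close>: both updates then write \<open>- c i\<close>, the sign change. The last
  clause only makes the function total.\<close>

fun cact :: "(nat \<Rightarrow> real) \<Rightarrow> root \<Rightarrow> (nat \<Rightarrow> real)" where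
  "cact c (Plain i, Plain j) = c(i := c j, j := c i)"
| "cact c (Plain i, Barred j) = c(i := - c j, j := - c i)"
| "cact c \<beta> = c"

text \<open>What remains of being a signed permutation: the absolute values are nonzero and pairwise
  distinct. This makes inequalities between entries, or their negatives, at different positions
  strict.\<close>

definition signed_seq :: "nat \<Rightarrow> (nat \<Rightarrow> real) \<Rightarrow> bool" where
  "signed_seq n c \<longleftrightarrow> (\<forall>p\<in>{1..n}. c p \<noteq> 0) \<and>
     (\<forall>p\<in>{1..n}. \<forall>q\<in>{1..n}. p \<noteq> q \<longrightarrow> c p \<noteq> c q \<and> c p \<noteq> - c q)"

lemma signed_seq_ne_0: "signed_seq n c \<Longrightarrow> 1 \<le> p \<Longrightarrow> p \<le> n \<Longrightarrow> c p \<noteq> 0"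
  by (auto simp: signed_seq_def)

lemma signed_seq_ne:
  "signed_seq n c \<Longrightarrow> 1 \<le> p \<Longrightarrow> p \<le> n \<Longrightarrow> 1 \<le> q \<Longrightarrow> q \<le> n \<Longrightarrow> p \<noteq> q \<Longrightarrow> c p \<noteq> c q"
  "signed_seq n c \<Longrightarrow> 1 \<le> p \<Longrightarrow> p \<le> n \<Longrightarrow> 1 \<le> q \<Longrightarrow> q \<le> n \<Longrightarrow> p \<noteq> q \<Longrightarrow> c p \<noteq> - c q"
  by (auto simp: signed_seq_def)

lemma positive_rootsE:
  assumes "\<beta> \<in> positive_roots n"
  obtains (diff) i j where "\<beta> = (Plain i, Plain j)" "1 \<le> i" "i < j" "j \<le> n"
  | (sum) i j where "\<beta> = (Plain i, Barred j)" "1 \<le> i" "i < j" "j \<le> n"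
  | (single) i where "\<beta> = (Plain i, Barred i)" "1 \<le> i" "i \<le> n"
  using assms by (auto simp: positive_roots_def)

lemma signed_seq_cact:
  assumes "signed_seq n c" "\<beta> \<in> positive_roots n"
  shows "signed_seq n (cact c \<beta>)"
  using assms(2)
proof (cases rule: positive_rootsE)
  case (diff i j)
  then show ?thesis using assms(1) by (auto simp: signed_seq_def)
next
  case (sum i j)
  have e: "- x = y \<longleftrightarrow> x = - y" for x y :: real by auto
  from sum show ?thesis using assms(1)
    by (auto simp: signed_seq_def e)
next
  case (single i)
  have e: "- x = y \<longleftrightarrow> x = - y" for x y :: real by auto
  from single show ?thesis using assms(1)
    by (auto simp: signed_seq_def e)
qed

lemma win_reflection:
  assumes "\<And>x. u (bar x) = bar (u x)" and "\<beta> \<in> positive_roots n"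
  shows "win (u \<circ> reflection \<beta>) = cact (win u) \<beta>"
proof -
  have b: "u (Barred i) = bar (u (Plain i))" for i
    using assms(1)[of "Plain i"] by simp
  show ?thesis using assms(2)
  proof (cases rule: positive_rootsE)
    case (diff i j)
    have "win (u \<circ> reflection \<beta>) p = cact (win u) \<beta> p" for p
      unfolding diff by (simp add: win_def reflection_def transpose_def)
    then show ?thesis by blast
  next
    case (sum i j)
    have "win (u \<circ> reflection \<beta>) p = cact (win u) \<beta> p" for p
      using sum(3) unfolding sum by (simp add: win_def reflection_def transpose_def b val_bar)
    then show ?thesis by blast
  next
    case (single i)
    have "win (u \<circ> reflection \<beta>) p = cact (win u) \<beta> p" for p
      unfolding single by (simp add: win_def reflection_def transpose_def b val_bar)
    then show ?thesis by blast
  qed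
qed

text \<open>\<open>coxeter_length\<close> on windows: for \<open>k < l\<close> the pairs
  \<open>(k, Plain l)\<close> and \<open>(k, Barred l)\<close> give the two conditions, and
  \<open>(k, Barred k)\<close> gives the last sum. Integers are used because differences of lengths
  are taken.\<close>

definition len :: "nat \<Rightarrow> (nat \<Rightarrow> real) \<Rightarrow> int" where
  "len n c = (\<Sum>k\<in>{1..n}. \<Sum>l\<in>{1..n}.
      if k < l then of_bool (c l < c k) + of_bool (0 < c k + c l) else 0)
    + (\<Sum>k\<in>{1..n}. of_bool (0 < c k))"

section \<open>Change of the length under a reflection\<close>

lemma sum_remove_pair:
  fixes g :: "nat \<Rightarrow> int"
  assumes "finite A" "i \<in> A" "j \<in> A" "i < j"
  shows "sum g A = sum g (A - {i,j}) + g i + g j"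
proof -
  have "A - {i, j} = A - {i} - {j}" by auto
  then show ?thesis
    using sum.remove[of A i g] sum.remove[of "A - {i}" j g] assms by simp
qed

lemma sum_split_pair:
  fixes f :: "nat \<Rightarrow> nat \<Rightarrow> int"
  assumes "finite A" "i \<in> A" "j \<in> A" "i \<noteq> j" "f i i = 0" "f j j = 0"
  shows "(\<Sum>k\<in>A. \<Sum>l\<in>A. f k l) = (\<Sum>k\<in>A-{i,j}. \<Sum>l\<in>A-{i,j}. f k l)
    + (\<Sum>p\<in>A-{i,j}. f i p + f p i + f j p + f p j) + f i j + f j i"
proof -
  have s: "(\<Sum>k\<in>A. g k) = (\<Sum>k\<in>A-{i,j}. g k) + g i + g j" for g :: "nat \<Rightarrow> int"
  proof -
    have "A - {i, j} = A - {i} - {j}" by auto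
    then show ?thesis
      using sum.remove[of A i g] sum.remove[of "A - {i}" j g] assms by simp
  qed
  show ?thesis
    unfolding s by (simp add: sum.distrib assms)
qed

lemma sum_split_single:
  fixes f :: "nat \<Rightarrow> nat \<Rightarrow> int"
  assumes "finite A" "i \<in> A" "f i i = 0"
  shows "(\<Sum>k\<in>A. \<Sum>l\<in>A. f k l) = (\<Sum>k\<in>A-{i}. \<Sum>l\<in>A-{i}. f k l)
    + (\<Sum>p\<in>A-{i}. f i p + f p i)"
proof -
  have s: "(\<Sum>k\<in>A. g k) = (\<Sum>k\<in>A-{i}. g k) + g i" for g :: "nat \<Rightarrow> int"
    using sum.remove[of A i g] assms by simp
  show ?thesis
    unfolding s by (simp add: sum.distrib assms)
qed

text \<open>Pairs of positions avoiding \<open>i\<close> and \<open>j\<close> cancel. The remaining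
  change is grouped by the third position \<open>p\<close>, so that a reflection needs only a case
  distinction on the value at one position.\<close>

lemma len_pair:
  fixes c c' :: "nat \<Rightarrow> real"
  assumes "i \<in> {1..n}" "j \<in> {1..n}" "i < j" "\<And>p. p \<noteq> i \<Longrightarrow> p \<noteq> j \<Longrightarrow> c' p = c p"
  defines "g \<equiv> \<lambda>c k l. if k < l then of_bool (c l < c k) + of_bool (0 < c k + c l) else (0::int)"
  shows "len n c' = len n c
    + (\<Sum>p\<in>{1..n}-{i,j}. (g c' i p + g c' p i + g c' j p + g c' p j)
                      - (g c i p + g c p i + g c j p + g c p j))
    + ((g c' i j - g c i j) + (of_bool (0 < c' i) + of_bool (0 < c' j) - of_bool (0 < c i) - of_bool (0 < c j)))"
proof -
  let ?B = "{1..n}-{i,j}"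
  have 1: "(\<Sum>k\<in>?B. \<Sum>l\<in>?B. g c' k l) = (\<Sum>k\<in>?B. \<Sum>l\<in>?B. g c k l)"
    by (intro sum.cong refl) (simp add: g_def assms(4))
  have h: "(\<Sum>k\<in>{1..n}. of_bool (0 < d k)) = (\<Sum>k\<in>?B. of_bool (0 < d k)) + of_bool (0 < d i) + (of_bool (0 < d j) :: int)"
    for d :: "nat \<Rightarrow> real"
    using sum_remove_pair[of "{1..n}" i j "\<lambda>k. of_bool (0 < d k) :: int"] assms(1-3) by blast
  have 2: "(\<Sum>k\<in>?B. of_bool (0 < c' k)) = (\<Sum>k\<in>?B. of_bool (0 < c k) :: int)"
    by (intro sum.cong refl) (simp add: assms(4))
  have l: "len n d = (\<Sum>k\<in>?B. \<Sum>l\<in>?B. g d k l)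
    + (\<Sum>p\<in>?B. g d i p + g d p i + g d j p + g d p j) + g d i j + (\<Sum>k\<in>?B. of_bool (0 < d k)) + of_bool (0 < d i) + of_bool (0 < d j)" for d
  proof -
    have 0: "len n d = (\<Sum>k\<in>{1..n}. \<Sum>l\<in>{1..n}. g d k l) + (\<Sum>k\<in>{1..n}. of_bool (0 < d k))"
      by (simp only: len_def g_def)
    have 3: "(\<Sum>k\<in>{1..n}. \<Sum>l\<in>{1..n}. g d k l) = (\<Sum>k\<in>?B. \<Sum>l\<in>?B. g d k l)
      + (\<Sum>p\<in>?B. g d i p + g d p i + g d j p + g d p j) + g d i j + g d j i"
      by (rule sum_split_pair) (use assms(1-3) in \<open>simp_all add: g_def\<close>)
    have 4: "g d j i = 0" using assms(3) by (simp add: g_def)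
    show ?thesis unfolding 0 3 h[of d] 4 by linarith
  qed
  show ?thesis unfolding l[of c'] l[of c] sum_subtractf 1 2 by simp
qed

lemma len_single:
  fixes c c' :: "nat \<Rightarrow> real"
  assumes "i \<in> {1..n}" "\<And>p. p \<noteq> i \<Longrightarrow> c' p = c p"
  defines "g \<equiv> \<lambda>c k l. if k < l then of_bool (c l < c k) + of_bool (0 < c k + c l) else (0::int)"
  shows "len n c' = len n c
    + (\<Sum>p\<in>{1..n}-{i}. (g c' i p + g c' p i) - (g c i p + g c p i))
    + (of_bool (0 < c' i) - of_bool (0 < c i))"
proof -
  let ?B = "{1..n}-{i}"
  have 1: "(\<Sum>k\<in>?B. \<Sum>l\<in>?B. g c' k l) = (\<Sum>k\<in>?B. \<Sum>l\<in>?B. g c k l)"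
    by (intro sum.cong refl) (simp add: g_def assms(2))
  have h: "(\<Sum>k\<in>{1..n}. of_bool (0 < d k)) = (\<Sum>k\<in>?B. of_bool (0 < d k)) + (of_bool (0 < d i) :: int)"
    for d :: "nat \<Rightarrow> real"
    using sum.remove[of "{1..n}" i "\<lambda>k. of_bool (0 < d k) :: int"] assms(1) by (metis add.commute finite_atLeastAtMost)
  have 2: "(\<Sum>k\<in>?B. of_bool (0 < c' k)) = (\<Sum>k\<in>?B. of_bool (0 < c k) :: int)"
    by (intro sum.cong refl) (simp add: assms(2))
  have l: "len n d = (\<Sum>k\<in>?B. \<Sum>l\<in>?B. g d k l)
    + (\<Sum>p\<in>?B. g d i p + g d p i) + (\<Sum>k\<in>?B. of_bool (0 < d k)) + of_bool (0 < d i)" for d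
  proof -
    have 0: "len n d = (\<Sum>k\<in>{1..n}. \<Sum>l\<in>{1..n}. g d k l) + (\<Sum>k\<in>{1..n}. of_bool (0 < d k))"
      by (simp only: len_def g_def)
    have 3: "(\<Sum>k\<in>{1..n}. \<Sum>l\<in>{1..n}. g d k l) = (\<Sum>k\<in>?B. \<Sum>l\<in>?B. g d k l)
      + (\<Sum>p\<in>?B. g d i p + g d p i)"
      by (rule sum_split_single) (use assms(1) in \<open>simp_all add: g_def\<close>)
    show ?thesis unfolding 0 3 h[of d] by linarith
  qed
  show ?thesis unfolding l[of c'] l[of c] sum_subtractf 1 2 by simp
qed

lemma sum_of_bool_card:
  "finite A \<Longrightarrow> (\<Sum>p\<in>A. 2 * of_bool (P p)) = 2 * int (card {p\<in>A. P p})"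
  by (simp add: sum_distrib_left[symmetric] of_bool_def sum.If_cases Int_def)

text \<open>A position outside the range from \<open>i\<close> to \<open>j\<close> sees the same two
  values before and after, and the sums \<open>c p + c i\<close> and \<open>c p + c j\<close> merely
  exchange their roles. So only inner positions with an inner value matter, and each counts
  twice.\<close>

lemma len_diff:
  assumes "signed_seq n c" "1 \<le> i" "i < j" "j \<le> n" "c i < c j"
  shows "len n (cact c (Plain i, Plain j)) = len n c + 1
     + 2 * int (card {p. i < p \<and> p < j \<and> c i < c p \<and> c p < c j})"
proof -
  let ?c = "cact c (Plain i, Plain j)"
  let ?g = "\<lambda>c k l. if k < l then of_bool (c l < c k) + of_bool (0 < c k + c l) else (0::int)"
  have S: "(?g ?c i p + ?g ?c p i + ?g ?c j p + ?g ?c p j)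
        - (?g c i p + ?g c p i + ?g c j p + ?g c p j) = 2 * of_bool (i < p \<and> p < j \<and> c i < c p \<and> c p < c j)"
    if "p \<in> {1..n} - {i,j}" for p
  proof -
    have "c p \<noteq> c i" "c p \<noteq> c j" using that signed_seq_ne[OF assms(1)] assms by auto
    then have d: "c p < c i \<or> c i < c p" "c p < c j \<or> c j < c p" by auto
    have pi: "p \<noteq> i" "p \<noteq> j" using that by auto
    from d assms(3,5) pi show ?thesis by (elim disjE) (simp_all add: add.commute)
  qed
  have e: "{p\<in>{1..n} - {i,j}. i < p \<and> p < j \<and> c i < c p \<and> c p < c j} = {p. i < p \<and> p < j \<and> c i < c p \<and> c p < c j}"
    using assms by auto
  have cs: "(\<Sum>p\<in>{1..n} - {i,j}. (?g ?c i p + ?g ?c p i + ?g ?c j p + ?g ?c p j)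
        - (?g c i p + ?g c p i + ?g c j p + ?g c p j)) = 2 * int (card {p. i < p \<and> p < j \<and> c i < c p \<and> c p < c j})"
    by (subst sum.cong[OF refl S], assumption)
      (simp only: sum_of_bool_card e finite_Diff finite_atLeastAtMost)
  have r: "(?g ?c i j - ?g c i j) + (of_bool (0 < ?c i) + of_bool (0 < ?c j) - of_bool (0 < c i) - of_bool (0 < c j)) = 1"
    using assms by (auto simp: add.commute)
  have m: "i \<in> {1..n}" "j \<in> {1..n}" "\<And>p. p \<noteq> i \<Longrightarrow> p \<noteq> j \<Longrightarrow> ?c p = c p"
    using assms by auto
  show ?thesis using len_pair[of i n j ?c c, OF m(1,2) assms(3) m(3), unfolded cs r] by simp
qed

lemma len_single_up:
  assumes "signed_seq n c" "1 \<le> i" "i \<le> n" "c i < 0"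
  shows "len n (cact c (Plain i, Barred i)) = len n c + 1
     + 2 * int (card {p. i < p \<and> p \<le> n \<and> \<bar>c p\<bar> < - c i})"
proof -
  let ?c = "cact c (Plain i, Barred i)"
  let ?g = "\<lambda>c k l. if k < l then of_bool (c l < c k) + of_bool (0 < c k + c l) else (0::int)"
  have S: "(?g ?c i p + ?g ?c p i) - (?g c i p + ?g c p i) = 2 * of_bool (i < p \<and> p \<le> n \<and> \<bar>c p\<bar> < - c i)"
    if "p \<in> {1..n} - {i}" for p
  proof -
    have "c p \<noteq> c i" "c p \<noteq> - c i" using that signed_seq_ne[OF assms(1)] assms by auto
    then have d: "c p < c i \<or> c i < c p" "c p < - c i \<or> - c i < c p" by auto
    have pi: "p \<noteq> i" "p \<le> n" using that by auto
    from d assms(4) pi show ?thesis by (elim disjE; simp; linarith?)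
  qed
  have e: "{p\<in>{1..n} - {i}. i < p \<and> p \<le> n \<and> \<bar>c p\<bar> < - c i} = {p. i < p \<and> p \<le> n \<and> \<bar>c p\<bar> < - c i}"
    using assms by auto
  have cs: "(\<Sum>p\<in>{1..n} - {i}. (?g ?c i p + ?g ?c p i) - (?g c i p + ?g c p i))
      = 2 * int (card {p. i < p \<and> p \<le> n \<and> \<bar>c p\<bar> < - c i})"
    by (subst sum.cong[OF refl S], assumption)
      (simp only: sum_of_bool_card e finite_Diff finite_atLeastAtMost)
  have r: "of_bool (0 < ?c i) - of_bool (0 < c i) = (1::int)"
    using assms by auto
  have m: "i \<in> {1..n}" "\<And>p. p \<noteq> i \<Longrightarrow> ?c p = c p"
    using assms by auto
  show ?thesis using len_single[of i n ?c c, OF m, unfolded cs r] by simp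
qed

text \<open>Of the constant part, \<open>1\<close> comes from the pair \<open>(i, j)\<close>, whose
  sum becomes positive, and \<open>2\<close> more if both entries are negative, as both become
  positive. A position between \<open>i\<close> and \<open>j\<close> can count only through
  \<open>c p\<close>, one beyond \<open>j\<close> through \<open>c p\<close> and through
  \<open>- c p\<close>.\<close>

lemma len_sum_up:
  assumes "signed_seq n c" "1 \<le> i" "i < j" "j \<le> n" "c i < - c j"
  shows "len n (cact c (Plain i, Barred j)) = len n c + 1 + 2 * of_bool (c i < 0 \<and> c j < 0)
     + 2 * int (card {p. i < p \<and> p \<le> n \<and> p \<noteq> j \<and> c i < c p \<and> c p < - c j})
     + 2 * int (card {p. j < p \<and> p \<le> n \<and> c i < - c p \<and> - c p < - c j})"
proof -
  let ?c = "cact c (Plain i, Barred j)"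
  let ?g = "\<lambda>c k l. if k < l then of_bool (c l < c k) + of_bool (0 < c k + c l) else (0::int)"
  let ?P = "\<lambda>p. i < p \<and> p \<le> n \<and> p \<noteq> j \<and> c i < c p \<and> c p < - c j"
  let ?Q = "\<lambda>p. j < p \<and> p \<le> n \<and> c i < - c p \<and> - c p < - c j"
  have S: "(?g ?c i p + ?g ?c p i + ?g ?c j p + ?g ?c p j)
        - (?g c i p + ?g c p i + ?g c j p + ?g c p j) = 2 * of_bool (?P p) + 2 * of_bool (?Q p)"
    if "p \<in> {1..n} - {i,j}" for p
  proof -
    have "c p \<noteq> c i" "c p \<noteq> c j" "c p \<noteq> - c i" "c p \<noteq> - c j"
      using that signed_seq_ne[OF assms(1)] assms by auto
    then have d: "c p < c i \<or> c i < c p" "c p < - c j \<or> - c j < c p" "c p < c j \<or> c j < c p"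
      "c p < - c i \<or> - c i < c p" by auto
    have pi: "p \<noteq> i" "p \<noteq> j" "p \<le> n" using that by auto
    consider "p < i" | "i < p" "p < j" | "j < p" using pi by linarith
    then show ?thesis
    proof cases
      case 1 with assms(3) show ?thesis by (simp add: add.commute)
    next
      case 2 with d(1,2) assms(3,5) pi show ?thesis by (elim disjE; simp; linarith?)
    next
      case 3 with d assms(3,5) pi show ?thesis by (elim disjE; simp; linarith?)
    qed
  qed
  have e: "{p\<in>{1..n} - {i,j}. ?P p} = {p. ?P p}" "{p\<in>{1..n} - {i,j}. ?Q p} = {p. ?Q p}"
    using assms by auto
  have cs: "(\<Sum>p\<in>{1..n} - {i,j}. (?g ?c i p + ?g ?c p i + ?g ?c j p + ?g ?c p j)
        - (?g c i p + ?g c p i + ?g c j p + ?g c p j)) = 2 * int (card {p. ?P p}) + 2 * int (card {p. ?Q p})"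
    by (subst sum.cong[OF refl S], assumption)
      (simp only: sum.distrib sum_of_bool_card e finite_Diff finite_atLeastAtMost)
  have ne: "c i \<noteq> 0" "c j \<noteq> 0" using signed_seq_ne_0[OF assms(1)] assms by auto
  have r: "(?g ?c i j - ?g c i j) + (of_bool (0 < ?c i) + of_bool (0 < ?c j) - of_bool (0 < c i) - of_bool (0 < c j))
     = 1 + 2 * of_bool (c i < 0 \<and> c j < 0)"
    using assms ne by auto
  have m: "i \<in> {1..n}" "j \<in> {1..n}" "\<And>p. p \<noteq> i \<Longrightarrow> p \<noteq> j \<Longrightarrow> ?c p = c p"
    using assms by auto
  show ?thesis using len_pair[of i n j ?c c, OF m(1,2) assms(3) m(3), unfolded cs r] by simp
qed

subsection \<open>Extremal steps\<close>

text \<open>Edges of the quantum Bruhat graph read backwards: \<open>down_ok\<close> describes the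
  covers, where the length drops by exactly one, and \<open>up_ok\<close> the quantum edges, where
  it rises by \<open>2 * rho_coroot n \<beta> - 1\<close>.\<close>

fun down_ok :: "nat \<Rightarrow> (nat \<Rightarrow> real) \<Rightarrow> root \<Rightarrow> bool" where
  "down_ok n c (Plain i, Plain j) \<longleftrightarrow> c j < c i \<and> (\<forall>p. i < p \<and> p < j \<longrightarrow> \<not> (c j < c p \<and> c p < c i))"
| "down_ok n c (Plain i, Barred j) \<longleftrightarrow>
     (if i = j then 0 < c i \<and> (\<forall>p. i < p \<and> p \<le> n \<longrightarrow> c i < \<bar>c p\<bar>)
      else - c j < c i \<and> (0 < c i \<longleftrightarrow> c j < 0) \<and>
        (\<forall>p. i < p \<and> p \<le> n \<and> p \<noteq> j \<longrightarrow> \<not> (- c j < c p \<and> c p < c i)) \<and>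
        (\<forall>p. j < p \<and> p \<le> n \<longrightarrow> \<not> (- c j < - c p \<and> - c p < c i)))"
| "down_ok n c \<beta> \<longleftrightarrow> False"

fun up_ok :: "nat \<Rightarrow> (nat \<Rightarrow> real) \<Rightarrow> root \<Rightarrow> bool" where
  "up_ok n c (Plain i, Plain j) \<longleftrightarrow> c i < c j \<and> (\<forall>p. i < p \<and> p < j \<longrightarrow> c i < c p \<and> c p < c j)"
| "up_ok n c (Plain i, Barred j) \<longleftrightarrow>
     i = j \<and> c i < 0 \<and> (\<forall>p. i < p \<and> p \<le> n \<longrightarrow> \<bar>c p\<bar> < - c i)"
| "up_ok n c \<beta> \<longleftrightarrow> False"

lemma sum_letters: "(\<Sum>l\<in>letters n. f l) = (\<Sum>l\<in>{1..n}. f (Plain l) + f (Barred l))"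
  for f :: "letter \<Rightarrow> int"
proof -
  have "(\<Sum>l\<in>letters n. f l) = (\<Sum>l\<in>Plain ` {1..n}. f l) + (\<Sum>l\<in>Barred ` {1..n}. f l)"
    unfolding letters_def by (rule sum.union_disjoint) auto
  then show ?thesis
    by (simp add: sum.reindex inj_on_def sum.distrib)
qed

lemma coxeter_length_len:
  assumes "\<And>x. u (bar x) = bar (u x)"
  shows "int (coxeter_length n u) = len n (win u)"
proof -
  have b: "u (Barred i) = bar (u (Plain i))" for i
    using assms[of "Plain i"] by simp
  have L: "finite (letters n)" by (simp add: letters_def)
  let ?Q = "\<lambda>k l. k \<le> absval l \<and> u l < u (Plain k)"
  have "{(k, l). k \<in> {1..n} \<and> l \<in> letters n \<and> k \<le> absval l \<and> u (Plain k) > u l}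
      = Sigma {1..n} (\<lambda>k. {l\<in>letters n. ?Q k l})"
    by auto
  then have "int (coxeter_length n u) = (\<Sum>k\<in>{1..n}. int (card {l\<in>letters n. ?Q k l}))"
    using L by (simp add: coxeter_length_def)
  also have "\<dots> = (\<Sum>k\<in>{1..n}. \<Sum>l\<in>letters n. of_bool (?Q k l))"
    by (rule sum.cong) (use L in \<open>simp_all add: of_bool_def sum.If_cases Int_def\<close>)
  also have "\<dots> = (\<Sum>k\<in>{1..n}. \<Sum>l\<in>{1..n}. of_bool (?Q k (Plain l)) + of_bool (?Q k (Barred l)))"
    by (simp only: sum_letters)
  also have "\<dots> = (\<Sum>k\<in>{1..n}. \<Sum>l\<in>{1..n}.
      (if k < l then of_bool (win u l < win u k) + of_bool (0 < win u k + win u l) else 0)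
      + (if l = k then of_bool (0 < win u k) else 0))"
  proof (intro sum.cong refl)
    fix k l assume "k \<in> {1..n}" "l \<in> {1..n}"
    show "of_bool (?Q k (Plain l)) + of_bool (?Q k (Barred l)) =
      (if k < l then of_bool (win u l < win u k) + of_bool (0 < win u k + win u l) else 0)
      + (if l = k then of_bool (0 < win u k) else (0::int))"
      by (cases "k < l"; cases "k = l") (simp_all add: val_less_iff[symmetric] b val_bar win_def; auto)+
  qed
  also have "\<dots> = len n (win u)"
    by (simp add: len_def sum.distrib)
  finally show ?thesis .
qed

text \<open>A step up reaches the bound only if all \<open>j - i - 1\<close> inner positions count.
  A step down is a step up read backwards, as the reflection is an involution:
  \<open>len_diff\<close> is applied to \<open>cact c \<beta>\<close>, and a drop by one means that
  nothing is counted there.\<close>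

lemma step_diff:
  assumes c: "signed_seq n c" and ij: "1 \<le> i" "i < j" "j \<le> n"
  defines "\<beta> \<equiv> (Plain i, Plain j)"
  shows "len n c < len n (cact c \<beta>) \<and> len n (cact c \<beta>) \<le> len n c + 2 * rho_coroot n \<beta> - 1
      \<and> (len n (cact c \<beta>) = len n c + 2 * rho_coroot n \<beta> - 1 \<longrightarrow> up_ok n c \<beta>)
    \<or> len n (cact c \<beta>) < len n c \<and> (len n (cact c \<beta>) = len n c - 1 \<longrightarrow> down_ok n c \<beta>)"
proof -
  have ne: "c i \<noteq> c j" using signed_seq_ne[OF c] ij by auto
  show ?thesis
  proof (cases "c i < c j")
    case True
    let ?S = "{p. i < p \<and> p < j \<and> c i < c p \<and> c p < c j}"
    have sub: "?S \<subseteq> {i<..<j}" by auto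
    have le: "card ?S \<le> j - i - 1"
      using card_mono[OF _ sub] by simp
    have eq: "?S = {i<..<j}" if "card ?S = j - i - 1"
      using card_subset_eq[OF _ sub] that by simp
    have l: "len n (cact c \<beta>) = len n c + 1 + 2 * int (card ?S)"
      unfolding \<beta>_def by (rule len_diff[OF c ij True])
    have rho: "rho_coroot n \<beta> = int j - int i" by (simp add: \<beta>_def)
    have "up_ok n c \<beta>" if "len n (cact c \<beta>) = len n c + 2 * rho_coroot n \<beta> - 1"
    proof -
      have "card ?S = j - i - 1" using that ij unfolding l rho by arith
      then have "?S = {i<..<j}" by (rule eq)
      then show ?thesis using True by (auto simp: \<beta>_def set_eq_iff)
    qed
    moreover have "len n c < len n (cact c \<beta>)" "len n (cact c \<beta>) \<le> len n c + 2 * rho_coroot n \<beta> - 1"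
      using le ij unfolding l rho by arith+
    ultimately show ?thesis by blast
  next
    case False
    then have less: "c j < c i" using ne by simp
    let ?c = "cact c \<beta>"
    let ?S = "{p. i < p \<and> p < j \<and> ?c i < ?c p \<and> ?c p < ?c j}"
    have c': "signed_seq n ?c" by (rule signed_seq_cact[OF c]) (use ij in \<open>auto simp: \<beta>_def positive_roots_def\<close>)
    have inv: "cact ?c (Plain i, Plain j) = c" by (auto simp: \<beta>_def)
    have l: "len n c = len n ?c + 1 + 2 * int (card ?S)"
      using len_diff[OF c' ij] less ij unfolding inv by (simp add: \<beta>_def)
    have "down_ok n c \<beta>" if "len n ?c = len n c - 1"
    proof -
      have "?S = {}" using l that by simp
      moreover have "finite ?S" by simp
      ultimately show ?thesis using less by (auto simp: \<beta>_def)
    qed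
    then show ?thesis using l by simp
  qed
qed

lemma step_single:
  assumes c: "signed_seq n c" and i: "1 \<le> i" "i \<le> n"
  defines "\<beta> \<equiv> (Plain i, Barred i)"
  shows "len n c < len n (cact c \<beta>) \<and> len n (cact c \<beta>) \<le> len n c + 2 * rho_coroot n \<beta> - 1
      \<and> (len n (cact c \<beta>) = len n c + 2 * rho_coroot n \<beta> - 1 \<longrightarrow> up_ok n c \<beta>)
    \<or> len n (cact c \<beta>) < len n c \<and> (len n (cact c \<beta>) = len n c - 1 \<longrightarrow> down_ok n c \<beta>)"
proof -
  have ne: "c i \<noteq> 0" using signed_seq_ne_0[OF c] i by auto
  show ?thesis
  proof (cases "c i < 0")
    case True
    let ?S = "{p. i < p \<and> p \<le> n \<and> \<bar>c p\<bar> < - c i}"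
    have sub: "?S \<subseteq> {i<..n}" by auto
    have le: "card ?S \<le> n - i"
      using card_mono[OF _ sub] by simp
    have eq: "?S = {i<..n}" if "card ?S = n - i"
      using card_subset_eq[OF _ sub] that by simp
    have l: "len n (cact c \<beta>) = len n c + 1 + 2 * int (card ?S)"
      unfolding \<beta>_def by (rule len_single_up[OF c i True])
    have rho: "rho_coroot n \<beta> = int n + 1 - int i" by (simp add: \<beta>_def)
    have "up_ok n c \<beta>" if "len n (cact c \<beta>) = len n c + 2 * rho_coroot n \<beta> - 1"
    proof -
      have "card ?S = n - i" using that i unfolding l rho by arith
      then have "?S = {i<..n}" by (rule eq)
      then show ?thesis using True unfolding \<beta>_def set_eq_iff up_ok.simps by (simp add: Ball_def) blast
    qed
    moreover have "len n c < len n (cact c \<beta>)" "len n (cact c \<beta>) \<le> len n c + 2 * rho_coroot n \<beta> - 1"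
      using le i unfolding l rho by arith+
    ultimately show ?thesis by blast
  next
    case False
    then have less: "0 < c i" using ne by simp
    let ?c = "cact c \<beta>"
    let ?S = "{p. i < p \<and> p \<le> n \<and> \<bar>?c p\<bar> < - ?c i}"
    have c': "signed_seq n ?c" by (rule signed_seq_cact[OF c]) (use i in \<open>auto simp: \<beta>_def positive_roots_def\<close>)
    have inv: "cact ?c (Plain i, Barred i) = c" by (auto simp: \<beta>_def)
    have l: "len n c = len n ?c + 1 + 2 * int (card ?S)"
      using len_single_up[OF c' i] less unfolding inv by (simp add: \<beta>_def)
    have "down_ok n c \<beta>" if "len n ?c = len n c - 1"
    proof -
      have "card ?S = 0" using l that by simp
      moreover have "finite ?S" by simp
      ultimately have e: "?S = {}" by simp
      have "c i < \<bar>c p\<bar>" if p: "i < p" "p \<le> n" for p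
      proof -
        have "\<not> \<bar>?c p\<bar> < - ?c i" using e p by blast
        then have "c i \<le> \<bar>c p\<bar>" using p by (simp add: \<beta>_def)
        moreover have "c p \<noteq> c i" "c p \<noteq> - c i" using signed_seq_ne[OF c] p i by auto
        ultimately show ?thesis by (auto simp: abs_if split: if_splits)
      qed
      then show ?thesis using less by (simp add: \<beta>_def)
    qed
    then show ?thesis using l by simp
  qed
qed

text \<open>Here the bound is strict: at most \<open>n - i - 1\<close> and \<open>n - j\<close>
  positions count, so the length rises by at most \<open>4 * n + 1 - 2 * i - 2 * j\<close>, two
  short of \<open>2 * rho_coroot n \<beta> - 1\<close>.\<close>

lemma step_sum:
  assumes c: "signed_seq n c" and ij: "1 \<le> i" "i < j" "j \<le> n"
  defines "\<beta> \<equiv> (Plain i, Barred j)"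
  shows "len n c < len n (cact c \<beta>) \<and> len n (cact c \<beta>) < len n c + 2 * rho_coroot n \<beta> - 1
    \<or> len n (cact c \<beta>) < len n c \<and> (len n (cact c \<beta>) = len n c - 1 \<longrightarrow> down_ok n c \<beta>)"
proof -
  have ne: "c i \<noteq> - c j" "c i \<noteq> 0" "c j \<noteq> 0" using signed_seq_ne[OF c] signed_seq_ne_0[OF c] ij by auto
  show ?thesis
  proof (cases "c i < - c j")
    case True
    let ?S = "{p. i < p \<and> p \<le> n \<and> p \<noteq> j \<and> c i < c p \<and> c p < - c j}"
    let ?R = "{p. j < p \<and> p \<le> n \<and> c i < - c p \<and> - c p < - c j}"
    have "card ?S \<le> card ({i<..n} - {j})" by (rule card_mono) auto
    then have 1: "card ?S + 1 + i \<le> n" using ij by simp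
    have "card ?R \<le> card {j<..n}" by (rule card_mono) auto
    then have 2: "card ?R + j \<le> n" using ij by simp
    have "len n (cact c \<beta>) = len n c + 1 + 2 * of_bool (c i < 0 \<and> c j < 0) + 2 * int (card ?S) + 2 * int (card ?R)"
      unfolding \<beta>_def by (rule len_sum_up[OF c ij True])
    moreover have "rho_coroot n \<beta> = 2 * int n + 2 - int i - int j" using ij by (simp add: \<beta>_def)
    moreover have "of_bool (c i < 0 \<and> c j < 0) \<le> (1::int)" "of_bool (c i < 0 \<and> c j < 0) \<ge> (0::int)" by simp_all
    ultimately show ?thesis using 1 2 ij by linarith
  next
    case False
    then have less: "- c j < c i" using ne by simp
    let ?c = "cact c \<beta>"
    let ?S = "{p. i < p \<and> p \<le> n \<and> p \<noteq> j \<and> ?c i < ?c p \<and> ?c p < - ?c j}"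
    let ?R = "{p. j < p \<and> p \<le> n \<and> ?c i < - ?c p \<and> - ?c p < - ?c j}"
    have c': "signed_seq n ?c" by (rule signed_seq_cact[OF c]) (use ij in \<open>auto simp: \<beta>_def positive_roots_def\<close>)
    have inv: "cact ?c (Plain i, Barred j) = c" using ij by (auto simp: \<beta>_def)
    have l: "len n c = len n ?c + 1 + 2 * of_bool (?c i < 0 \<and> ?c j < 0) + 2 * int (card ?S) + 2 * int (card ?R)"
      by (rule len_sum_up[OF c' ij, unfolded inv]) (use less ij in \<open>simp add: \<beta>_def\<close>)
    have "down_ok n c \<beta>" if "len n ?c = len n c - 1"
    proof -
      have ob: "of_bool (?c i < 0 \<and> ?c j < 0) \<ge> (0::int)" by simp
      have "of_bool (?c i < 0 \<and> ?c j < 0) = (0::int)" using l that ob by linarith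
      then have nn: "\<not> (?c i < 0 \<and> ?c j < 0)" by (metis of_bool_eq(2) zero_neq_one)
      have "card ?S = 0" "card ?R = 0" using l that ob by linarith+
      moreover have "finite ?S" "finite ?R" by simp_all
      ultimately have e: "?S = {}" "?R = {}" by simp_all
      have "\<not> (- c j < c p \<and> c p < c i)" if p: "i < p" "p \<le> n" "p \<noteq> j" for p
      proof -
        have "\<not> (?c i < ?c p \<and> ?c p < - ?c j)" using e(1) p by blast
        then show ?thesis using p ij by (simp add: \<beta>_def)
      qed
      moreover have "\<not> (- c j < - c p \<and> - c p < c i)" if p: "j < p" "p \<le> n" for p
      proof -
        have "\<not> (?c i < - ?c p \<and> - ?c p < - ?c j)" using e(2) p by blast
        then show ?thesis using p ij by (simp add: \<beta>_def)
      qed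
      moreover have "0 < c i \<longleftrightarrow> c j < 0"
        using nn ne less ij by (auto simp: \<beta>_def)
      ultimately show ?thesis using less ij by (auto simp: \<beta>_def)
    qed
    then show ?thesis using l by simp
  qed
qed

lemma step_length:
  assumes "signed_seq n c" "\<beta> \<in> positive_roots n"
  shows "len n c < len n (cact c \<beta>) \<and> len n (cact c \<beta>) \<le> len n c + 2 * rho_coroot n \<beta> - 1
      \<and> (len n (cact c \<beta>) = len n c + 2 * rho_coroot n \<beta> - 1 \<longrightarrow> up_ok n c \<beta>)
    \<or> len n (cact c \<beta>) < len n c \<and> (len n (cact c \<beta>) = len n c - 1 \<longrightarrow> down_ok n c \<beta>)"
  using assms(2)
proof (cases rule: positive_rootsE)
  case (diff i j) then show ?thesis using step_diff[OF assms(1)] by blast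
next
  case (sum i j) then show ?thesis using step_sum[OF assms(1), of i j] by fastforce
next
  case (single i) then show ?thesis using step_single[OF assms(1)] by blast
qed

section \<open>From the folding condition to extremal steps\<close>

lemma signed_perms_bar: "u \<in> signed_perms n \<Longrightarrow> u (bar x) = bar (u x)"
  by (simp add: signed_perms_def)

lemma signed_perms_letters: "u \<in> signed_perms n \<Longrightarrow> x \<in> letters n \<Longrightarrow> u x \<in> letters n"
  by (simp add: signed_perms_def permutes_in_image)

lemma reflection_bar:
  assumes "\<beta> \<in> positive_roots n"
  shows "reflection \<beta> (bar x) = bar (reflection \<beta> x)"
  using assms
  by (cases rule: positive_rootsE; cases x) (auto simp: reflection_def transpose_def)

lemma reflection_permutes:
  assumes "\<beta> \<in> positive_roots n"
  shows "reflection \<beta> permutes letters n"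
  using assms
proof (cases rule: positive_rootsE)
  case (diff i j)
  then show ?thesis by (auto simp: reflection_def letters_def intro!: permutes_compose permutes_swap_id)
next
  case (sum i j)
  then show ?thesis by (auto simp: reflection_def letters_def intro!: permutes_compose permutes_swap_id)
next
  case (single i)
  then show ?thesis by (auto simp: reflection_def letters_def intro!: permutes_swap_id)
qed

lemma signed_perms_reflection:
  assumes "u \<in> signed_perms n" "\<beta> \<in> positive_roots n"
  shows "u \<circ> reflection \<beta> \<in> signed_perms n"
  using assms by (auto simp: signed_perms_def reflection_bar intro: permutes_compose reflection_permutes)

lemma signed_perms_act:
  assumes "u \<in> signed_perms n" "set T \<subseteq> positive_roots n"
  shows "act u T \<in> signed_perms n"
  using assms by (induction T arbitrary: u) (auto simp: act_def signed_perms_reflection)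

lemma signed_seq_win:
  assumes "u \<in> signed_perms n"
  shows "signed_seq n (win u)"
proof -
  have inj: "inj u" using assms by (auto simp: signed_perms_def permutes_inj)
  have "- win u q = val (u (Barred q))" for q
    using signed_perms_bar[OF assms, of "Plain q"] by (simp add: win_def val_bar)
  then show ?thesis
    using inj by (auto simp: signed_seq_def val_ne_0) (auto simp: win_def val_eq_iff val_ne_0 inj_eq)
qed

lemma bruhat_less_length: "bruhat_less n u v \<Longrightarrow> coxeter_length n u < coxeter_length n v"
  unfolding bruhat_less_def by (induction rule: tranclp_induct) auto

lemma bruhat_less_reflection:
  assumes "\<beta> \<in> positive_roots n" "v = u \<circ> reflection \<beta>"
  shows "bruhat_less n u v \<longleftrightarrow> coxeter_length n u < coxeter_length n v"
proof
  assume "bruhat_less n u v"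
  then show "coxeter_length n u < coxeter_length n v" by (rule bruhat_less_length)
next
  assume "coxeter_length n u < coxeter_length n v"
  then show "bruhat_less n u v"
    unfolding bruhat_less_def using assms by (intro tranclp.r_into_trancl) blast
qed

lemma nths_take_Suc:
  assumes "p < length G"
  shows "nths (take (Suc p) G) J = nths (take p G) J @ (if p \<in> J then [G ! p] else [])"
  using assms by (simp add: take_Suc_conv_app_nth nths_append)

lemma act_append: "act u (S @ T) = act (act u S) T"
  by (simp add: act_def)

lemma extremal_folding:
  assumes w: "w \<in> signed_perms n" and G: "set G \<subseteq> positive_roots n" and J: "J \<subseteq> {..<length G}"
    and eq: "1 / 2 * (real (coxeter_length n w) + real (coxeter_length n (fold_end G w J)) - real (card J))
     + (\<Sum>p\<in>negative_foldings n G w J. real_of_int (rho_coroot n (G ! p))) = 0"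
  defines "c \<equiv> \<lambda>p. win (act w (nths (take p G) J))"
  shows "len n (win (fold_end G w J)) = 0"
    and "p \<in> J \<Longrightarrow> p \<in> negative_foldings n G w J \<and> up_ok n (c p) (G ! p)
           \<or> p \<notin> negative_foldings n G w J \<and> down_ok n (c p) (G ! p)"
proof -
  define u where "u = (\<lambda>p. act w (nths (take p G) J))"
  define \<delta> where "\<delta> = (\<lambda>p. len n (c (Suc p)) - len n (c p))"
  define N where "N = negative_foldings n G w J"
  have u: "u p \<in> signed_perms n" for p
    unfolding u_def
    by (rule signed_perms_act[OF w]) (meson G order_trans set_nths_subset set_take_subset)
  have cu: "c p = win (u p)" for p by (simp add: c_def u_def)
  have lc: "int (coxeter_length n (u p)) = len n (c p)" for p
    unfolding cu by (rule coxeter_length_len) (rule signed_perms_bar[OF u])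
  have sc: "signed_seq n (c p)" for p unfolding cu by (rule signed_seq_win[OF u])
  have r: "G ! p \<in> positive_roots n" if "p < length G" for p using that G by auto
  have us: "u (Suc p) = (if p \<in> J then u p \<circ> reflection (G ! p) else u p)" if "p < length G" for p
    unfolding u_def nths_take_Suc[OF that] by (simp add: act_append) (simp add: act_def)
  have cs: "c (Suc p) = cact (c p) (G ! p)" if "p \<in> J" for p
  proof -
    have p: "p < length G" using that J by auto
    have "win (u p \<circ> reflection (G ! p)) = cact (win (u p)) (G ! p)"
      by (rule win_reflection[OF _ r[OF p]]) (rule signed_perms_bar[OF u])
    then show ?thesis unfolding cu us[OF p] using that by simp
  qed
  have neg: "p \<in> N \<longleftrightarrow> 0 < \<delta> p" if "p \<in> J" for p
  proof -
    have p: "p < length G" using that J by auto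
    have "p \<in> N \<longleftrightarrow> bruhat_less n (u p) (u (Suc p))"
      using that by (simp add: N_def negative_foldings_def u_def)
    also have "\<dots> \<longleftrightarrow> coxeter_length n (u p) < coxeter_length n (u (Suc p))"
      by (rule bruhat_less_reflection[OF r[OF p]]) (use us[OF p] that in simp)
    also have "\<dots> \<longleftrightarrow> 0 < \<delta> p"
      unfolding \<delta>_def lc[symmetric] by simp
    finally show ?thesis .
  qed
  have step: "0 < \<delta> p \<and> \<delta> p \<le> 2 * rho_coroot n (G ! p) - 1
        \<and> (\<delta> p = 2 * rho_coroot n (G ! p) - 1 \<longrightarrow> up_ok n (c p) (G ! p))
      \<or> \<delta> p < 0 \<and> (\<delta> p = - 1 \<longrightarrow> down_ok n (c p) (G ! p))" if "p \<in> J" for p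
  proof -
    have p: "p < length G" using that J by auto
    show ?thesis using step_length[OF sc r[OF p], of p] unfolding \<delta>_def cs[OF that] by auto
  qed
  \<comment> \<open>The slack of step \<open>p\<close>: the distance to the largest possible rise
    for a negative folding, and to a drop by one otherwise.\<close>
  define f where "f = (\<lambda>p. (if p \<in> N then 2 * rho_coroot n (G ! p) else 0) - \<delta> p - 1)"
  have f0: "0 \<le> f p" if "p \<in> J" for p
    using step[OF that] neg[OF that] by (auto simp: f_def)
  have finJ: "finite J" using J finite_subset by blast
  have NJ: "N \<subseteq> J" by (auto simp: N_def negative_foldings_def)
  have e: "c (length G) = win (fold_end G w J)" by (simp add: c_def fold_end_def)
  have c0: "c 0 = win w" by (simp add: c_def act_def)
  have "len n (c m) - len n (c 0) = sum \<delta> {..<m}" for m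
    by (induction m) (auto simp: \<delta>_def)
  then have "len n (c (length G)) - len n (c 0) = sum \<delta> {..<length G}" .
  also have "\<dots> = sum \<delta> J"
  proof (rule sum.mono_neutral_right)
    show "\<forall>p\<in>{..<length G} - J. \<delta> p = 0" using us by (auto simp: \<delta>_def cu)
  qed (use J in auto)
  finally have d: "sum \<delta> J = len n (c (length G)) - len n (c 0)" ..
  have "sum f J = (\<Sum>p\<in>J. if p \<in> N then 2 * rho_coroot n (G ! p) else 0) - sum \<delta> J - int (card J)"
    by (simp add: f_def sum_subtractf)
  also have "(\<Sum>p\<in>J. if p \<in> N then 2 * rho_coroot n (G ! p) else 0) = 2 * (\<Sum>p\<in>N. rho_coroot n (G ! p))"
    using NJ finJ by (simp add: sum.If_cases Int_absorb1 sum_distrib_left)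
  finally have sf: "sum f J = 2 * (\<Sum>p\<in>N. rho_coroot n (G ! p)) - sum \<delta> J - int (card J)" .
  have "1 / 2 * (real_of_int (len n (c 0)) + real_of_int (len n (c (length G))) - real (card J))
     + real_of_int (\<Sum>p\<in>N. rho_coroot n (G ! p)) = 0"
    using eq unfolding lc[symmetric] N_def by (simp add: u_def fold_end_def act_def)
  then have "real_of_int (len n (c 0) + len n (c (length G)) - int (card J)
      + 2 * (\<Sum>p\<in>N. rho_coroot n (G ! p))) = 0"
    by (simp add: field_simps)
  then have "len n (c 0) + len n (c (length G)) - int (card J)
      + 2 * (\<Sum>p\<in>N. rho_coroot n (G ! p)) = 0"
    using of_int_eq_0_iff by blast
  \<comment> \<open>Telescoping replaces the length at the start by the length at the end minus
    \<open>sum \<delta> J\<close>; this is why the end counts twice.\<close>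
  then have z: "sum f J + 2 * len n (c (length G)) = 0" using sf d by simp
  have "sum f J \<ge> 0" by (rule sum_nonneg) (rule f0)
  moreover have "len n (c (length G)) \<ge> 0" unfolding lc[symmetric] by simp
  ultimately have zz: "sum f J = 0" "len n (c (length G)) = 0" using z by linarith+
  show "len n (win (fold_end G w J)) = 0" using zz e by simp
  have f: "f p = 0" if "p \<in> J" for p
    using zz(1) f0 finJ that by (simp add: sum_nonneg_eq_0_iff)
  show "p \<in> N \<and> up_ok n (c p) (G ! p) \<or> p \<notin> N \<and> down_ok n (c p) (G ! p)" if "p \<in> J"
    using f[OF that] step[OF that] neg[OF that] by (auto simp: f_def)
qed

lemma strict_mono_below_diag:
  fixes f :: "nat \<Rightarrow> nat"
  assumes "\<And>k l. 1 \<le> k \<Longrightarrow> k < l \<Longrightarrow> l \<le> n \<Longrightarrow> f k < f l" "\<And>k. 1 \<le> k \<Longrightarrow> k \<le> n \<Longrightarrow> 1 \<le> f k \<and> f k \<le> n"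
  shows "1 \<le> k \<Longrightarrow> k \<le> n \<Longrightarrow> f k = k"
proof -
  assume k: "1 \<le> k" "k \<le> n"
  have 1: "k \<le> f k" if "1 \<le> k" "k \<le> n" for k
    using that by (induction k rule: nat_induct_at_least)
      (use assms in \<open>force, meson Suc_leI le_trans less_le_trans lessI not_less_eq_eq order_less_le_trans nat_le_linear\<close>)
  have 2: "f k + d \<le> f (k + d)" if "k + d \<le> n" for d
    using that
  proof (induction d)
    case (Suc d)
    then have "f (k + d) < f (k + Suc d)" using assms(1)[of "k+d" "k + Suc d"] k by simp
    with Suc show ?case by simp
  qed simp
  have "f k + (n - k) \<le> f (k + (n - k))" by (rule 2) (use k in simp)
  then have "f k + (n - k) \<le> n" using assms(2)[of n] k by simp
  then show ?thesis using 1[OF k] k by arith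
qed

text \<open>All summands of \<open>len\<close> vanish, so the entries are negative, that is plain,
  and they increase; an increasing self-map of \<open>{1..n}\<close> is the identity.\<close>

lemma len_0_identity:
  assumes u: "u \<in> signed_perms n" and 0: "len n (win u) = 0" and k: "1 \<le> k" "k \<le> n"
  shows "win u k = val (Plain k)"
proof -
  let ?c = "win u"
  have a: "(\<Sum>k\<in>{1..n}. \<Sum>l\<in>{1..n}.
      if k < l then of_bool (?c l < ?c k) + of_bool (0 < ?c k + ?c l) else (0::int)) \<ge> 0"
    by (intro sum_nonneg) auto
  have b: "(\<Sum>k\<in>{1..n}. of_bool (0 < ?c k) :: int) \<ge> 0"
    by (intro sum_nonneg) auto
  have a0: "(\<Sum>k\<in>{1..n}. \<Sum>l\<in>{1..n}.
      if k < l then of_bool (?c l < ?c k) + of_bool (0 < ?c k + ?c l) else (0::int)) = 0"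
    and b0: "(\<Sum>k\<in>{1..n}. of_bool (0 < ?c k) :: int) = 0"
    using a b 0 unfolding len_def by linarith+
  have neg: "?c k < 0" if "1 \<le> k" "k \<le> n" for k
  proof -
    have "\<forall>k\<in>{1..n}. (of_bool (0 < ?c k) :: int) = 0"
      using b0 by (subst (asm) sum_nonneg_eq_0_iff) auto
    then have "\<not> 0 < ?c k" using that by auto
    then show ?thesis using signed_seq_ne_0[OF signed_seq_win[OF u] that] by linarith
  qed
  have less: "?c k < ?c l" if "1 \<le> k" "k < l" "l \<le> n" for k l
  proof -
    have "\<forall>k\<in>{1..n}. (\<Sum>l\<in>{1..n}.
      if k < l then of_bool (?c l < ?c k) + of_bool (0 < ?c k + ?c l) else (0::int)) = 0"
      using a0 by (subst (asm) sum_nonneg_eq_0_iff) (auto intro!: sum_nonneg)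
    then have "(\<Sum>l\<in>{1..n}. if k < l then of_bool (?c l < ?c k) + of_bool (0 < ?c k + ?c l) else (0::int)) = 0"
      using that by auto
    moreover have "0 \<le> (if k < l then of_bool (?c l < ?c k) + of_bool (0 < ?c k + ?c l) else (0::int))" for l
      by simp
    ultimately have "\<forall>l\<in>{1..n}. (if k < l then of_bool (?c l < ?c k) + of_bool (0 < ?c k + ?c l) else (0::int)) = 0"
      by (simp only: sum_nonneg_eq_0_iff finite_atLeastAtMost)
    then have "(if k < l then of_bool (?c l < ?c k) + of_bool (0 < ?c k + ?c l) else (0::int)) = 0"
      by (rule bspec) (use that in simp)
    then have "\<not> ?c l < ?c k" using that by (auto simp: of_bool_def split: if_splits)
    then show ?thesis using signed_seq_ne(1)[OF signed_seq_win[OF u], of k l] that by auto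
  qed
  have f: "u (Plain k) = Plain (absval (u (Plain k))) \<and> 1 \<le> absval (u (Plain k)) \<and> absval (u (Plain k)) \<le> n"
    if "1 \<le> k" "k \<le> n" for k
  proof -
    have "u (Plain k) \<in> letters n" using signed_perms_letters[OF u] that by (simp add: letters_def)
    moreover have "u (Plain k) \<noteq> Barred i" for i
      using neg[OF that] by (auto simp: win_def)
    ultimately show ?thesis by (auto simp: letters_def)
  qed
  have "absval (u (Plain k)) = k"
  proof (rule strict_mono_below_diag[of n])
    fix k l assume kl: "1 \<le> k" "k < l" "l \<le> n"
    then have "u (Plain k) < u (Plain l)" using less by (simp add: win_def val_less_iff)
    then have "Plain (absval (u (Plain k))) < Plain (absval (u (Plain l)))"
      using f[of k] f[of l] kl by simp
    then show "absval (u (Plain k)) < absval (u (Plain l))" by (simp add: less_letter_def)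
  qed (use f k in auto)
  then show ?thesis using f[OF k] by (simp add: win_def)
qed

subsection \<open>One segment of the chain\<close>

text \<open>The skipped roots are those outside the folding set; \<open>U\<close> lists the negative foldings.\<close>

inductive path :: "nat \<Rightarrow> root list \<Rightarrow> (nat \<Rightarrow> real) \<Rightarrow> root list \<Rightarrow> (nat \<Rightarrow> real) \<Rightarrow> bool" for n where
  Nil: "path n [] c [] c"
| skip: "path n G c U c' \<Longrightarrow> path n (\<beta> # G) c U c'"
| down: "down_ok n c \<beta> \<Longrightarrow> path n G (cact c \<beta>) U c' \<Longrightarrow> path n (\<beta> # G) c U c'"
| up: "up_ok n c \<beta> \<Longrightarrow> path n G (cact c \<beta>) U c' \<Longrightarrow> path n (\<beta> # G) c (\<beta> # U) c'"

inductive_cases path_NilE: "path n [] c U c'"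

lemma path_appendI:
  "path n G c U c' \<Longrightarrow> path n H c' V c'' \<Longrightarrow> path n (G @ H) c (U @ V) c''"
  by (induction rule: path.induct) (auto intro: path.intros)

lemma path_appendE:
  assumes "path n (G @ H) c U c''"
  obtains c' V W where "path n G c V c'" "path n H c' W c''" "U = V @ W"
proof -
  have "\<exists>c' V W. path n G c V c' \<and> path n H c' W c'' \<and> U = V @ W"
    using assms
  proof (induction "G @ H" c U c'' arbitrary: G rule: path.induct)
    case (Nil c)
    then show ?case by (auto intro: path.Nil)
  next
    case (skip G' c U c' \<beta>)
    show ?case
    proof (cases G)
      case Nil
      then show ?thesis using skip by (metis append_Nil path.Nil path.skip)
    next
      case (Cons \<gamma> G1)
      with skip(2)[of G1] skip(3) show ?thesis by (auto intro: path.skip)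
    qed
  next
    case (down c \<beta> G' U c')
    show ?case
    proof (cases G)
      case Nil
      then show ?thesis using down by (metis append_Nil path.Nil path.down)
    next
      case (Cons \<gamma> G1)
      with down(3)[of G1] down(1,4) show ?thesis by (auto intro: path.down)
    qed
  next
    case (up c \<beta> G' U c')
    show ?case
    proof (cases G)
      case Nil
      then show ?thesis using up by (metis append_Nil path.Nil path.up)
    next
      case (Cons \<gamma> G1)
      with up(3)[of G1] up(1,4) show ?thesis by (metis append_Cons list.inject path.up)
    qed
  qed
  then show thesis using that by blast
qed

lemma path_refl: "path n G c [] c"
  by (induction G) (auto intro: path.intros)

lemma path_signed_seq:
  assumes "path n G c U c'" "signed_seq n c" "set G \<subseteq> positive_roots n"
  shows "signed_seq n c'"
  using assms by (induction rule: path.induct) (auto simp: signed_seq_cact)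

text \<open>An invariant rule in the style of Hoare logic: \<open>Q t c V\<close> describes the
  situation after \<open>t\<close> roots, with window \<open>c\<close> and upward steps
  \<open>V\<close> so far. The counter lets an invariant depend on the roots already passed, as in
  \<open>diff_block\<close>.\<close>

lemma path_invariant:
  assumes "path n G c U c'" "signed_seq n c" "set G \<subseteq> positive_roots n" "Q 0 c []"
    and "\<And>t c V. t < length G \<Longrightarrow> signed_seq n c \<Longrightarrow> Q t c V \<Longrightarrow> Q (Suc t) c V"
    and "\<And>t c V. t < length G \<Longrightarrow> signed_seq n c \<Longrightarrow> Q t c V \<Longrightarrow> down_ok n c (G ! t) \<Longrightarrow>
      Q (Suc t) (cact c (G ! t)) V"
    and "\<And>t c V. t < length G \<Longrightarrow> signed_seq n c \<Longrightarrow> Q t c V \<Longrightarrow> up_ok n c (G ! t) \<Longrightarrow>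
      Q (Suc t) (cact c (G ! t)) (V @ [G ! t])"
  shows "Q (length G) c' U"
  using assms
proof (induction arbitrary: Q rule: path.induct)
  case (Nil c)
  then show ?case by simp
next
  case (skip G c U c' \<beta>)
  have "Q (Suc (length G)) c' U"
  proof (rule skip.IH[of "\<lambda>t. Q (Suc t)"])
    show "Q (Suc 0) c []" using skip.prems(4)[of 0] skip.prems(1,3) by simp
  qed (use skip.prems(1,2) skip.prems(4-6)[of "Suc _"] in auto)
  then show ?case by simp
next
  case (down c \<beta> G U c')
  have "Q (Suc (length G)) c' U"
  proof (rule down.IH[of "\<lambda>t. Q (Suc t)"])
    show "Q (Suc 0) (cact c \<beta>) []" using down.prems(5)[of 0] down.prems(1,3) down.hyps(1) by simp
    show "signed_seq n (cact c \<beta>)" using down.prems(1,2) signed_seq_cact by auto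
  qed (use down.prems(1,2) down.prems(4-6)[of "Suc _"] in auto)
  then show ?case by simp
next
  case (up c \<beta> G U c')
  have "Q (Suc (length G)) c' (\<beta> # U)"
  proof (rule up.IH[of "\<lambda>t c V. Q (Suc t) c (\<beta> # V)"])
    show "Q (Suc 0) (cact c \<beta>) [\<beta>]" using up.prems(6)[of 0] up.prems(1,3) up.hyps(1) by fastforce
    show "signed_seq n (cact c \<beta>)" using up.prems(1,2) signed_seq_cact by auto
    show "Q (Suc (Suc t)) (cact c (G ! t)) (\<beta> # V @ [G ! t])"
      if "t < length G" "signed_seq n c" "Q (Suc t) c (\<beta> # V)" "up_ok n c (G ! t)" for t c V
      using up.prems(6)[of "Suc t" c "\<beta> # V"] that by simp
  qed (use up.prems(1,2) up.prems(4-5)[of "Suc _"] in auto)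
  then show ?case by simp
qed

lemma path_ups:
  assumes "path n G c U c'" "\<beta> \<in> set U"
  shows "\<beta> \<in> set G" "\<exists>c. up_ok n c \<beta>"
  using assms by (induction rule: path.induct) auto

text \<open>Going up cyclically from \<open>x\<close>, no element of \<open>D\<close> is met before \<open>x\<^sub>0\<close>; \<open>e\<close> tells whether the
  way wraps around.\<close>

definition greedy :: "real \<Rightarrow> real \<Rightarrow> real set \<Rightarrow> nat \<Rightarrow> bool" where
  "greedy x\<^sub>0 x D e \<longleftrightarrow> e = 0 \<and> x \<le> x\<^sub>0 \<and> (\<forall>y\<in>D. \<not> (x \<le> y \<and> y \<le> x\<^sub>0))
     \<or> e = 1 \<and> x\<^sub>0 < x \<and> (\<forall>y\<in>D. x\<^sub>0 < y \<and> y < x)"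

text \<open>The entry \<open>x\<close> is exchanged with \<open>y\<close>, which thereby leaves the
  competitors. None of the others lies between \<open>y\<close> and \<open>x\<close>, so starting
  lower at \<open>y\<close> meets nothing new.\<close>

lemma greedy_down:
  assumes "greedy x\<^sub>0 x (insert y D) e" "y < x" "\<forall>z\<in>D. z < y \<or> x < z"
  shows "greedy x\<^sub>0 y D e"
  using assms(1) unfolding greedy_def
proof (elim disjE conjE)
  assume "e = 0" "x \<le> x\<^sub>0" "\<forall>z\<in>insert y D. \<not> (x \<le> z \<and> z \<le> x\<^sub>0)"
  then show "e = 0 \<and> y \<le> x\<^sub>0 \<and> (\<forall>z\<in>D. \<not> (y \<le> z \<and> z \<le> x\<^sub>0))
      \<or> e = 1 \<and> x\<^sub>0 < y \<and> (\<forall>z\<in>D. x\<^sub>0 < z \<and> z < y)"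
    using assms(2,3) by (metis insertI2 leD less_imp_le order_trans)
next
  assume "e = 1" "x\<^sub>0 < x" "\<forall>z\<in>insert y D. x\<^sub>0 < z \<and> z < x"
  then show "e = 0 \<and> y \<le> x\<^sub>0 \<and> (\<forall>z\<in>D. \<not> (y \<le> z \<and> z \<le> x\<^sub>0))
      \<or> e = 1 \<and> x\<^sub>0 < y \<and> (\<forall>z\<in>D. x\<^sub>0 < z \<and> z < y)"
    using assms(3) by force
qed

text \<open>All competitors lie above \<open>x\<close>, so the way from \<open>x\<close> cannot have
  wrapped yet. As it met none of them before \<open>x\<^sub>0\<close>, they lie above
  \<open>x\<^sub>0\<close>; from the new entry \<open>y\<close>, which is above them all, the way
  has to wrap.\<close>

lemma greedy_up:
  assumes "greedy x\<^sub>0 x (insert y D) e" "x < y" "\<forall>z\<in>D. x < z \<and> z < y"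
  shows "greedy x\<^sub>0 y D (e + 1)"
proof -
  have "\<not> x\<^sub>0 < x" using assms(1,2) by (auto simp: greedy_def)
  then have "e = 0" "x \<le> x\<^sub>0" and D: "\<And>z. z \<in> insert y D \<Longrightarrow> \<not> (x \<le> z \<and> z \<le> x\<^sub>0)"
    using assms(1) by (auto simp: greedy_def)
  moreover have "x\<^sub>0 < y" using D[of y] assms(2) by auto
  moreover have "x\<^sub>0 < z" if "z \<in> D" for z using D[of z] assms(3) that by fastforce
  ultimately show ?thesis using assms(3) by (auto simp: greedy_def)
qed

text \<open>Serves for a late lowering of a row, which removes no competitor. Once the way wraps,
  the competitor \<open>y\<^sub>1\<close> lies above \<open>x\<^sub>0\<close> and below
  \<open>y\<close>, so the entry cannot drop past \<open>x\<^sub>0\<close>.\<close>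

lemma greedy_skip:
  assumes "greedy x\<^sub>0 x D e" "y\<^sub>1 \<in> D" "y < x" "\<forall>z\<in>D. \<not> (y \<le> z \<and> z \<le> x)"
  shows "greedy x\<^sub>0 y D e"
proof -
  have g: "z < y \<or> x < z" if "z \<in> D" for z using assms(4) that by (meson not_le)
  have "greedy x\<^sub>0 y D e \<or> e = 1 \<and> x\<^sub>0 < x"
  proof (cases "e = 0")
    case True
    then have h: "x \<le> x\<^sub>0" "\<And>z. z \<in> D \<Longrightarrow> \<not> (x \<le> z \<and> z \<le> x\<^sub>0)" using assms(1) by (auto simp: greedy_def)
    have "\<not> (y \<le> z \<and> z \<le> x\<^sub>0)" if "z \<in> D" for z using h(2)[OF that] g[OF that] by linarith
    then show ?thesis using True h(1) assms(3) by (simp add: greedy_def)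
  next
    case False
    then show ?thesis using assms(1) by (simp add: greedy_def)
  qed
  moreover have "greedy x\<^sub>0 y D e" if "e = 1" "x\<^sub>0 < x"
  proof -
    have h: "x\<^sub>0 < z \<and> z < x" if "z \<in> D" for z using assms(1) that \<open>e = 1\<close> by (simp add: greedy_def)
    have h': "x\<^sub>0 < z \<and> z < y" if "z \<in> D" for z using h[OF that] g[OF that] by linarith
    then show ?thesis using h'[OF assms(2)] \<open>e = 1\<close> by (simp add: greedy_def)
  qed
  ultimately show ?thesis by blast
qed

definition row_ups :: "nat \<Rightarrow> root list \<Rightarrow> nat" where
  "row_ups l U = length (filter (\<lambda>\<beta>. fst \<beta> = Plain l) U)"

lemma row_ups_append [simp]: "row_ups l (U @ V) = row_ups l U + row_ups l V"
  and row_ups_Nil [simp]: "row_ups l [] = 0"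
  by (simp_all add: row_ups_def)

section \<open>The four blocks of a stage and its own row\<close>

lemma Gamma_pair_split:
  "Gamma_pair n k i = map (\<lambda>l. (Plain l, Barred i)) [1..<i] @ map (\<lambda>l. (Plain i, Barred l)) [Suc k..<Suc n]
     @ [(Plain i, Barred i)] @ map (\<lambda>l. (Plain i, Plain l)) (rev [Suc k..<Suc n])"
  by (simp add: Gamma_pair_def)

lemma Gamma_pair_roots:
  assumes "1 \<le> i" "i \<le> k" "k \<le> n"
  shows "set (Gamma_pair n k i) \<subseteq> positive_roots n"
  using assms by (auto simp: Gamma_pair_def positive_roots_def)

text \<open>Each step replaces the entry at \<open>i\<close> by a smaller one and, being a cover,
  passes neither an entry nor a negated entry beyond \<open>i\<close>; at untouched positions before
  \<open>i\<close> only negated entries are excluded. The swept intervals join up to one. It is used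
  with \<open>d = i\<close> for the stage's own row, and with \<open>d = l\<close> for the roots
  preceding \<open>(Plain l, Barred i)\<close>.\<close>

lemma barred_block:
  assumes P: "path n (map (\<lambda>r. (Plain r, Barred i)) [a..<d]) c U c'" and s: "signed_seq n c"
    and i: "1 \<le> a" "a \<le> d" "d \<le> i" "i \<le> n"
  shows "U = [] \<and> c' i \<le> c i \<and> (0 < c' i \<longleftrightarrow> 0 < c i) \<and> (\<forall>p. p \<noteq> i \<and> \<not> (a \<le> p \<and> p < d) \<longrightarrow> c' p = c p)
     \<and> (\<forall>p. i < p \<and> p \<le> n \<longrightarrow> \<not> (c' i \<le> c p \<and> c p \<le> c i) \<and> \<not> (c' i \<le> - c p \<and> - c p \<le> c i))
     \<and> (\<forall>p. d \<le> p \<and> p < i \<longrightarrow> \<not> (c' i \<le> - c p \<and> - c p \<le> c i))"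
proof -
  let ?G = "map (\<lambda>r. (Plain r, Barred i)) [a..<d]"
  define Q where "Q = (\<lambda>(t::nat) c' U. U = ([]::root list) \<and> c' i \<le> c i \<and> (0 < c' i \<longleftrightarrow> 0 < c i) \<and> (\<forall>p. p \<noteq> i \<and> \<not> (a \<le> p \<and> p < d) \<longrightarrow> c' p = c p)
     \<and> (\<forall>p. i < p \<and> p \<le> n \<longrightarrow> \<not> (c' i \<le> c p \<and> c p \<le> c i) \<and> \<not> (c' i \<le> - c p \<and> - c p \<le> c i))
     \<and> (\<forall>p. d \<le> p \<and> p < i \<longrightarrow> \<not> (c' i \<le> - c p \<and> - c p \<le> c i)))"
  have neq: "x = - y \<longleftrightarrow> - x = y" for x y :: real by auto
  have "Q (length ?G) c' U"
  proof (rule path_invariant[OF P s])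
    show "set ?G \<subseteq> positive_roots n" using i by (auto simp: positive_roots_def)
    show "Q 0 c []"
      using signed_seq_ne[OF s] i unfolding Q_def by (auto simp: order_antisym_conv) (force simp: order_antisym_conv neq)+
  next
    fix t c1 V assume t: "t < length ?G" and s1: "signed_seq n c1" and Q: "Q t c1 V" and ok: "down_ok n c1 (?G ! t)"
    define r where "r = a + t"
    have r: "a \<le> r" "r < d" and G: "?G ! t = (Plain r, Barred i)" using t by (auto simp: r_def)
    have ri: "r < i" using r i by simp
    have ok: "- c1 i < c1 r" "0 < c1 r \<longleftrightarrow> c1 i < 0"
      "\<And>p. r < p \<Longrightarrow> p \<le> n \<Longrightarrow> p \<noteq> i \<Longrightarrow> \<not> (- c1 i < c1 p \<and> c1 p < c1 r)"
      "\<And>p. i < p \<Longrightarrow> p \<le> n \<Longrightarrow> \<not> (- c1 i < - c1 p \<and> - c1 p < c1 r)"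
      using ok ri unfolding G by auto
    have ne: "c1 i \<noteq> 0" "c1 r \<noteq> 0" using signed_seq_ne_0[OF s1] i r by auto
    have n1: "c1 p \<noteq> c1 i" "c1 p \<noteq> - c1 i" if "i \<noteq> p" "1 \<le> p" "p \<le> n" for p
      using signed_seq_ne[OF s1, of p i] that i by auto
    have n2: "c1 p \<noteq> c1 r" "c1 p \<noteq> - c1 r" if "r \<noteq> p" "1 \<le> p" "p \<le> n" for p
      using signed_seq_ne[OF s1, of p r] that i r by auto
    have e: "cact c1 (?G ! t) = c1(r := - c1 i, i := - c1 r)" by (simp add: G)
    show "Q (Suc t) (cact c1 (?G ! t)) V"
      unfolding Q_def e
    proof (intro conjI allI impI; (elim conjE)?)
      show "V = []" using Q by (simp add: Q_def)
      show "(c1(r := - c1 i, i := - c1 r)) i \<le> c i" using Q ok(1) by (simp add: Q_def)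
      show "0 < (c1(r := - c1 i, i := - c1 r)) i \<longleftrightarrow> 0 < c i" using Q ok(2) ne by (auto simp: Q_def)
      show "(c1(r := - c1 i, i := - c1 r)) p = c p" if "p \<noteq> i" "\<not> (a \<le> p \<and> p < d)" for p
        using Q that r by (auto simp: Q_def)
    next
      fix p assume p: "i < p" "p \<le> n"
      then have cp: "c p = c1 p" using Q i by (auto simp: Q_def)
      show "\<not> ((c1(r := - c1 i, i := - c1 r)) i \<le> c p \<and> c p \<le> c i)"
        using Q p ok(4)[of p] n1[of p] n2[of p] ri r i unfolding Q_def cp by force
      show "\<not> ((c1(r := - c1 i, i := - c1 r)) i \<le> - c p \<and> - c p \<le> c i)"
        using Q p ok(3)[of p] n1[of p] n2[of p] ri r i unfolding Q_def cp by force
    next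
      fix p assume p: "d \<le> p" "p < i"
      then have cp: "c p = c1 p" using Q i by (auto simp: Q_def)
      show "\<not> ((c1(r := - c1 i, i := - c1 r)) i \<le> - c p \<and> - c p \<le> c i)"
        using Q p ok(3)[of p] n1[of p] n2[of p] ri r i unfolding Q_def cp by force
    qed
  next
    fix t c1 V assume t: "t < length ?G" and ok: "up_ok n c1 (?G ! t)"
    with i have False by auto
    then show "Q (Suc t) (cact c1 (?G ! t)) (V @ [?G ! t])" ..
  qed (simp add: Q_def)
  then show ?thesis unfolding Q_def .
qed

text \<open>In use, \<open>x\<^sub>0\<close> is the entry of row \<open>l\<close> at the beginning
  of the stage. The free interval refers to the current entries \<open>c'\<close>, because positions
  beyond \<open>k\<close> are themselves overwritten.\<close>

lemma sum_block:
  assumes P: "path n (map (\<lambda>q. (Plain l, Barred q)) [Suc k..<Suc n]) c U c'" and s: "signed_seq n c"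
    and l: "1 \<le> l" "l \<le> k" "k \<le> n"
    and Z: "c l \<le> x\<^sub>0" "0 < c l \<longleftrightarrow> 0 < x\<^sub>0" "x\<^sub>0 \<noteq> 0"
      "\<And>p. l < p \<Longrightarrow> p \<le> n \<Longrightarrow> \<not> (c l \<le> c p \<and> c p \<le> x\<^sub>0)"
  shows "U = [] \<and> c' l \<le> x\<^sub>0 \<and> (0 < c' l \<longleftrightarrow> 0 < x\<^sub>0) \<and> (\<forall>p. p \<noteq> l \<and> p \<le> k \<longrightarrow> c' p = c p)
     \<and> (\<forall>p. l < p \<and> p \<le> n \<longrightarrow> \<not> (c' l \<le> c' p \<and> c' p \<le> x\<^sub>0))"
proof -
  let ?G = "map (\<lambda>q. (Plain l, Barred q)) [Suc k..<Suc n]"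
  define Q where "Q = (\<lambda>(t::nat) c' U. U = ([]::root list) \<and> c' l \<le> x\<^sub>0 \<and> (0 < c' l \<longleftrightarrow> 0 < x\<^sub>0) \<and> (\<forall>p. p \<noteq> l \<and> p \<le> k \<longrightarrow> c' p = c p)
     \<and> (\<forall>p. l < p \<and> p \<le> n \<longrightarrow> \<not> (c' l \<le> c' p \<and> c' p \<le> x\<^sub>0)))"
  have "Q (length ?G) c' U"
  proof (rule path_invariant[OF P s])
    show "set ?G \<subseteq> positive_roots n" using l by (auto simp: positive_roots_def)
    show "Q 0 c []" using Z by (auto simp: Q_def)
  next
    fix t c1 V assume t: "t < length ?G" and s1: "signed_seq n c1" and Q: "Q t c1 V" and ok: "down_ok n c1 (?G ! t)"
    define q where "q = Suc k + t"
    have q: "k < q" "q \<le> n" and G: "?G ! t = (Plain l, Barred q)" using t by (auto simp: q_def simp del: upt_Suc)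
    have lq: "l < q" using q l by simp
    have ok: "- c1 q < c1 l" "0 < c1 l \<longleftrightarrow> c1 q < 0"
      "\<And>p. l < p \<Longrightarrow> p \<le> n \<Longrightarrow> p \<noteq> q \<Longrightarrow> \<not> (- c1 q < c1 p \<and> c1 p < c1 l)"
      using ok lq unfolding G by auto
    have ne: "c1 q \<noteq> 0" "c1 l \<noteq> 0" using signed_seq_ne_0[OF s1] l q by auto
    have e: "cact c1 (?G ! t) = c1(l := - c1 q, q := - c1 l)" unfolding G by simp
    show "Q (Suc t) (cact c1 (?G ! t)) V"
      unfolding Q_def e
    proof (intro conjI allI impI; (elim conjE)?)
      show "V = []" using Q by (simp add: Q_def)
      show "(c1(l := - c1 q, q := - c1 l)) l \<le> x\<^sub>0" using Q ok(1) lq by (simp add: Q_def)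
      show "0 < (c1(l := - c1 q, q := - c1 l)) l \<longleftrightarrow> 0 < x\<^sub>0" using Q ok(2) ne lq by (auto simp: Q_def)
      show "(c1(l := - c1 q, q := - c1 l)) p = c p" if "p \<noteq> l" "p \<le> k" for p
        using Q that q by (auto simp: Q_def)
    next
      fix p assume p: "l < p" "p \<le> n"
      show "\<not> ((c1(l := - c1 q, q := - c1 l)) l \<le> (c1(l := - c1 q, q := - c1 l)) p
         \<and> (c1(l := - c1 q, q := - c1 l)) p \<le> x\<^sub>0)"
      proof (cases "p = q")
        \<comment> \<open>The value deposited at \<open>q\<close> is \<open>- c1 l\<close>. Its sign
          is opposite to that of \<open>x\<^sub>0\<close> and of the new entry at \<open>l\<close>,
          so it lies outside the interval.\<close>
        case True
        then show ?thesis using lq ok(1,2) ne Q Z(3) by (auto simp: Q_def)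
      next
        case False
        have "c1 p \<noteq> - c1 q" "c1 p \<noteq> c1 l" using signed_seq_ne[OF s1] p q l False by auto
        moreover have "\<not> (c1 l \<le> c1 p \<and> c1 p \<le> x\<^sub>0)" using Q p by (auto simp: Q_def)
        ultimately show ?thesis using False p lq ok(3)[of p] by auto
      qed
    qed
  next
    fix t c1 V assume t: "t < length ?G" and ok: "up_ok n c1 (?G ! t)"
    with l have False by (auto simp del: upt_Suc)
    then show "Q (Suc t) (cact c1 (?G ! t)) (V @ [?G ! t])" ..
  qed (simp add: Q_def)
  then show ?thesis unfolding Q_def .
qed

lemma path_singleE:
  assumes "path n [\<beta>] c U c'"
  obtains "U = []" "c' = c" | "U = []" "down_ok n c \<beta>" "c' = cact c \<beta>" | "U = [\<beta>]" "up_ok n c \<beta>" "c' = cact c \<beta>"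
  using assms by (cases rule: path.cases) (auto elim: path_NilE)

text \<open>A step up needs \<open>- c l\<close> to exceed all later absolute values; these entries
  then lie between \<open>x\<^sub>0\<close> and the new entry, so the row wraps. A step down needs
  them to exceed \<open>c l\<close> in absolute value, so none lies between \<open>- c l\<close> and
  \<open>c l\<close>.\<close>

lemma single_block:
  assumes P: "path n [(Plain l, Barred l)] c U c'" and s: "signed_seq n c"
    and l: "1 \<le> l" "l \<le> n"
    and Z: "c l \<le> x\<^sub>0" "0 < c l \<longleftrightarrow> 0 < x\<^sub>0" "x\<^sub>0 \<noteq> 0"
      "\<And>p. l < p \<Longrightarrow> p \<le> n \<Longrightarrow> \<not> (c l \<le> c p \<and> c p \<le> x\<^sub>0)"
  shows "greedy x\<^sub>0 (c' l) (c' ` {l<..n}) (row_ups l U) \<and> (\<forall>p. p \<noteq> l \<longrightarrow> c' p = c p)"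
  using P
proof (cases rule: path_singleE)
  case 1
  then show ?thesis using Z by (auto simp: greedy_def)
next
  case 2
  have "\<not> (- c l \<le> c p \<and> c p \<le> x\<^sub>0)" if "l < p" "p \<le> n" for p
  proof -
    have "c l < \<bar>c p\<bar>" using 2(2) that by simp
    then show ?thesis using Z(4)[OF that] by (auto simp: abs_if split: if_splits)
  qed
  moreover have "- c l \<le> x\<^sub>0" using 2(2) Z(1) by simp
  ultimately show ?thesis using 2 by (auto simp: greedy_def)
next
  case 3
  have "x\<^sub>0 < c p \<and> c p < - c l" if "l < p" "p \<le> n" for p
  proof -
    have "\<bar>c p\<bar> < - c l" using 3(2) that by simp
    then show ?thesis using Z(4)[OF that] by (auto simp: abs_if split: if_splits)
  qed
  moreover have "x\<^sub>0 < - c l" using 3(2) Z by auto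
  ultimately show ?thesis using 3 by (auto simp: greedy_def row_ups_def)
qed

text \<open>The roots come with \<open>q\<close> falling from \<open>n\<close> to
  \<open>k + 1\<close>, and a step by \<open>(Plain l, Plain q)\<close> controls only positions
  below \<open>q\<close>. So the competitors shrink along with \<open>q\<close>: after
  \<open>t\<close> roots they are the positions up to \<open>n - t\<close>.\<close>

lemma diff_block:
  assumes P: "path n (map (\<lambda>q. (Plain l, Plain q)) (rev [Suc k..<Suc n])) c U c'" and s: "signed_seq n c"
    and l: "1 \<le> l" "l \<le> k" "k \<le> n"
    and Z: "greedy x\<^sub>0 (c l) (c ` {l<..n}) e"
  shows "greedy x\<^sub>0 (c' l) (c' ` {l<..k}) (e + row_ups l U) \<and> (\<forall>p. p \<noteq> l \<and> p \<le> k \<longrightarrow> c' p = c p)"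
proof -
  let ?G = "map (\<lambda>q. (Plain l, Plain q)) (rev [Suc k..<Suc n])"
  define Q where "Q = (\<lambda>t c' U. greedy x\<^sub>0 (c' l) (c' ` {l<..n-t}) (e + row_ups l U)
     \<and> (\<forall>p. p \<noteq> l \<and> p \<le> k \<longrightarrow> c' p = c p))"
  have len: "length ?G = n - k" by (simp del: upt_Suc)
  have nth: "?G ! t = (Plain l, Plain (n - t))" if "t < n - k" for t
    using that by (simp add: rev_nth del: upt_Suc)
  have "Q (length ?G) c' U"
  proof (rule path_invariant[OF P s])
    show "set ?G \<subseteq> positive_roots n" using l by (auto simp: positive_roots_def)
    show "Q 0 c []" using Z by (auto simp: Q_def)
  next
    fix t c1 V assume t: "t < length ?G" and Q: "Q t c1 V"
    have "{l<..n - Suc t} \<subseteq> {l<..n - t}" by auto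
    then have "greedy x\<^sub>0 (c1 l) (c1 ` {l<..n-Suc t}) (e + row_ups l V)"
      using Q by (auto simp: Q_def greedy_def)
    then show "Q (Suc t) c1 V" using Q by (simp add: Q_def)
  next
    fix t c1 V assume t: "t < length ?G" and s1: "signed_seq n c1" and Q: "Q t c1 V" and ok: "down_ok n c1 (?G ! t)"
    define q where "q = n - t"
    have q: "k < q" "q \<le> n" and G: "?G ! t = (Plain l, Plain q)" using t nth[of t] unfolding len by (auto simp: q_def)
    have e: "cact c1 (?G ! t) = c1(l := c1 q, q := c1 l)" unfolding G by simp
    have nt: "{l<..n - Suc t} = {l<..<q}" "{l<..n-t} = insert q {l<..<q}" using q l by (auto simp: q_def)
    have "greedy x\<^sub>0 (c1 q) (c1 ` {l<..<q}) (e + row_ups l V)"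
    proof -
      have ok: "c1 q < c1 l" "\<And>p. l < p \<Longrightarrow> p < q \<Longrightarrow> \<not> (c1 q < c1 p \<and> c1 p < c1 l)"
        using ok unfolding G by auto
      have "c1 p \<noteq> c1 l" "c1 p \<noteq> c1 q" if "l < p" "p < q" for p using signed_seq_ne[OF s1] that q l by auto
      with ok have "c1 p < c1 q \<or> c1 l < c1 p" if "l < p" "p < q" for p using that by (metis not_less_iff_gr_or_eq)
      then have "\<forall>z\<in>c1 ` {l<..<q}. z < c1 q \<or> c1 l < z" by auto
      then show ?thesis using greedy_down[OF _ ok(1)] Q unfolding Q_def nt image_insert by blast
    qed
    moreover have "(c1(l := c1 q, q := c1 l)) ` {l<..<q} = c1 ` {l<..<q}" by (rule image_cong) auto
    ultimately show "Q (Suc t) (cact c1 (?G ! t)) V"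
      using Q q l unfolding Q_def e nt by auto
  next
    fix t c1 V assume t: "t < length ?G" and s1: "signed_seq n c1" and Q: "Q t c1 V" and ok: "up_ok n c1 (?G ! t)"
    define q where "q = n - t"
    have q: "k < q" "q \<le> n" and G: "?G ! t = (Plain l, Plain q)" using t nth[of t] unfolding len by (auto simp: q_def)
    have e: "cact c1 (?G ! t) = c1(l := c1 q, q := c1 l)" unfolding G by simp
    have nt: "{l<..n - Suc t} = {l<..<q}" "{l<..n-t} = insert q {l<..<q}" using q l by (auto simp: q_def)
    have "greedy x\<^sub>0 (c1 q) (c1 ` {l<..<q}) (e + row_ups l V + 1)"
    proof -
      have ok: "c1 l < c1 q" "\<And>p. l < p \<Longrightarrow> p < q \<Longrightarrow> c1 l < c1 p \<and> c1 p < c1 q"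
        using ok unfolding G by auto
      then have "\<forall>z\<in>c1 ` {l<..<q}. c1 l < z \<and> z < c1 q" by auto
      then show ?thesis using greedy_up[OF _ ok(1)] Q unfolding Q_def nt image_insert by blast
    qed
    moreover have "(c1(l := c1 q, q := c1 l)) ` {l<..<q} = c1 ` {l<..<q}" by (rule image_cong) auto
    moreover have "row_ups l (V @ [?G ! t]) = row_ups l V + 1" unfolding G by (simp add: row_ups_def)
    ultimately show "Q (Suc t) (cact c1 (?G ! t)) (V @ [?G ! t])"
      using Q q l unfolding Q_def e nt by auto
  qed
  moreover have eq: "n - (n - k) = k" using l by simp
  ultimately show ?thesis unfolding Q_def len eq by blast
qed

lemma row_ups_0: "(\<And>\<beta>. \<beta> \<in> set U \<Longrightarrow> fst \<beta> \<noteq> Plain l) \<Longrightarrow> row_ups l U = 0"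
  by (simp add: row_ups_def filter_empty_conv)

text \<open>The first two blocks lower the entry within its sign, the third may change the sign, the
  fourth exchanges it with positions beyond \<open>k\<close>. Rows \<open>l + 1\<close> to
  \<open>k\<close> stay untouched, so the competitors can be read off the initial window.\<close>

lemma stage_own_row:
  assumes P: "path n (Gamma_pair n k l) c U c'" and s: "signed_seq n c" and l: "1 \<le> l" "l \<le> k" "k \<le> n"
  shows "greedy (c l) (c' l) (c ` {l<..k}) (row_ups l U)"
proof -
  let ?G1 = "map (\<lambda>r. (Plain r, Barred l)) [1..<l]"
  let ?G2 = "map (\<lambda>q. (Plain l, Barred q)) [Suc k..<Suc n]"
  let ?G3 = "[(Plain l, Barred l)]"
  let ?G4 = "map (\<lambda>q. (Plain l, Plain q)) (rev [Suc k..<Suc n])"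
  note roots = Gamma_pair_roots[OF l, unfolded Gamma_pair_split]
  from P obtain c1 c2 c3 U1 U2 U3 U4 where
    P1: "path n ?G1 c U1 c1" and P2: "path n ?G2 c1 U2 c2" and P3: "path n ?G3 c2 U3 c3"
    and P4: "path n ?G4 c3 U4 c'" and U: "U = U1 @ U2 @ U3 @ U4"
    unfolding Gamma_pair_split by (elim path_appendE) blast
  have s1: "signed_seq n c1" by (rule path_signed_seq[OF P1 s]) (use roots in auto)
  have s2: "signed_seq n c2" by (rule path_signed_seq[OF P2 s1]) (use roots in auto)
  have s3: "signed_seq n c3" by (rule path_signed_seq[OF P3 s2]) (use roots in auto)
  have ln: "l \<le> n" using l by simp
  have b: "U1 = []" "c1 l \<le> c l" "0 < c1 l \<longleftrightarrow> 0 < c l" "\<And>p. l < p \<Longrightarrow> c1 p = c p"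
    "\<And>p. l < p \<Longrightarrow> p \<le> n \<Longrightarrow> \<not> (c1 l \<le> c p \<and> c p \<le> c l)"
    using barred_block[OF P1 s order_refl l(1) order_refl ln] by auto
  have z: "c l \<noteq> 0" using signed_seq_ne_0[OF s] l by auto
  have b2: "U2 = []" "c2 l \<le> c l" "0 < c2 l \<longleftrightarrow> 0 < c l" "\<And>p. p \<noteq> l \<Longrightarrow> p \<le> k \<Longrightarrow> c2 p = c1 p"
    "\<And>p. l < p \<Longrightarrow> p \<le> n \<Longrightarrow> \<not> (c2 l \<le> c2 p \<and> c2 p \<le> c l)"
    using sum_block[OF P2 s1 l b(2,3) z] b(4,5) by auto
  have b3: "greedy (c l) (c3 l) (c3 ` {l<..n}) (row_ups l U3)" "\<And>p. p \<noteq> l \<Longrightarrow> c3 p = c2 p"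
    using single_block[OF P3 s2 l(1) ln b2(2,3) z] b2(5) by auto
  have b4: "greedy (c l) (c' l) (c' ` {l<..k}) (row_ups l U3 + row_ups l U4)" "\<And>p. p \<noteq> l \<Longrightarrow> p \<le> k \<Longrightarrow> c' p = c3 p"
    using diff_block[OF P4 s3 l b3(1)] by auto
  have "c' ` {l<..k} = c ` {l<..k}"
    by (rule image_cong) (use b(4) b2(4) b3(2) b4(2) in auto)
  then show ?thesis using b4(1) b(1) b2(1) U by simp
qed

section \<open>Effect of a stage on the other rows\<close>

lemma stage_fixes:
  assumes P: "path n (Gamma_pair n k i) c U c'" and s: "signed_seq n c" and i: "1 \<le> i" "i \<le> k" "k \<le> n"
    and p: "i < p" "p \<le> k"
  shows "c' p = c p"
proof -
  have "(\<lambda>_ c' _. c' p = c p) (length (Gamma_pair n k i)) c' U"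
  proof (rule path_invariant[OF P s Gamma_pair_roots[OF i]])
    have *: "cact c1 (Gamma_pair n k i ! t) p = c1 p" if "t < length (Gamma_pair n k i)" for t c1
    proof -
      have "Gamma_pair n k i ! t \<in> set (Gamma_pair n k i)" using that by simp
      then show ?thesis using p by (auto simp: Gamma_pair_def)
    qed
    show "cact c1 (Gamma_pair n k i ! t) p = c p" if "t < length (Gamma_pair n k i)" "c1 p = c p" for t c1
      using * that by simp
    then show "cact c1 (Gamma_pair n k i ! t) p = c p" if "t < length (Gamma_pair n k i)" "c1 p = c p" for t c1
      using that by simp
  qed auto
  then show ?thesis by simp
qed

text \<open>Roots of stage \<open>i\<close> that start in another row are
  \<open>(Plain r, Barred i)\<close> with \<open>r < i\<close>, and these never go up.\<close>

lemma stage_ups: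
  assumes P: "path n (Gamma_pair n k i) c U c'" and i: "1 \<le> i" and "l \<noteq> i"
  shows "row_ups l U = 0"
proof (rule row_ups_0)
  fix \<beta> assume "\<beta> \<in> set U"
  from path_ups[OF P this] have "\<beta> \<in> set (Gamma_pair n k i)" "\<exists>c. up_ok n c \<beta>" by auto
  then show "fst \<beta> \<noteq> Plain l" using assms by (auto simp: Gamma_pair_def)
qed

text \<open>For \<open>c l = a\<close> and \<open>c i = - b\<close>, this is the failure of the last
  two conditions of \<open>down_ok\<close> for \<open>(Plain l, Barred i)\<close>. With
  \<open>a\<close> and \<open>b\<close> as parameters it can be followed while position
  \<open>l\<close> changes.\<close>

definition blocked :: "nat \<Rightarrow> nat \<Rightarrow> nat \<Rightarrow> real \<Rightarrow> real \<Rightarrow> (nat \<Rightarrow> real) \<Rightarrow> bool" where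
  "blocked n l i b a c \<longleftrightarrow> (\<exists>r. l < r \<and> r < i \<and> b < c r \<and> c r < a)
     \<or> (\<exists>q. i < q \<and> q \<le> n \<and> (b < c q \<and> c q < a \<or> b < - c q \<and> - c q < a))"

text \<open>Only the root \<open>(Plain l, Barred i)\<close> touches row \<open>l\<close>. The roots
  before it may have lowered position \<open>i\<close> from \<open>c i\<close> to
  \<open>c1 i\<close>, but without passing a relevant value; so the free interval extends from
  \<open>- c1 i\<close> down to \<open>- c i\<close>, which is known from the start of the
  stage.\<close>

lemma stage_later_row:
  assumes P: "path n (Gamma_pair n k i) c U c'" and s: "signed_seq n c" and l: "1 \<le> l" "l < i" "i \<le> k" "k \<le> n"
  shows "c' l = c l \<or> - c i \<le> c' l \<and> c' l < c l \<and> (c l < 0 \<longleftrightarrow> 0 < c i) \<and> (0 < c' l \<longleftrightarrow> 0 < c l)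
     \<and> \<not> blocked n l i (- c i) (c l) c"
proof -
  let ?A = "map (\<lambda>r. (Plain r, Barred i)) [1..<l]"
  let ?M = "(Plain l, Barred i)"
  let ?H = "map (\<lambda>r. (Plain r, Barred i)) [Suc l..<i] @ map (\<lambda>l. (Plain i, Barred l)) [Suc k..<Suc n]
     @ [(Plain i, Barred i)] @ map (\<lambda>l. (Plain i, Plain l)) (rev [Suc k..<Suc n])"
  have i: "1 \<le> i" "i \<le> k" "k \<le> n" using l by auto
  have "[1..<i] = [1..<l] @ l # [Suc l..<i]"
    using l by (metis less_imp_le_nat upt_add_eq_append le_add_diff_inverse upt_conv_Cons)
  then have G: "Gamma_pair n k i = ?A @ [?M] @ ?H"
    unfolding Gamma_pair_split by simp
  note roots = Gamma_pair_roots[OF i, unfolded G]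
  obtain c1 U1 V where P1: "path n ?A c U1 c1" and P1': "path n ([?M] @ ?H) c1 V c'"
    by (rule path_appendE[OF P[unfolded G]])
  obtain c2 U2 U3 where P2: "path n [?M] c1 U2 c2" and P3: "path n ?H c2 U3 c'"
    by (rule path_appendE[OF P1'])
  have s1: "signed_seq n c1" by (rule path_signed_seq[OF P1 s]) (use roots in auto)
  have s2: "signed_seq n c2" by (rule path_signed_seq[OF P2 s1]) (use roots in auto)
  have "(\<lambda>_ c' _. c' l = c2 l) (length ?H) c' U3"
  proof (rule path_invariant[OF P3 s2])
    have *: "cact c1 (?H ! t) l = c1 l" if "t < length ?H" for t c1
    proof -
      have "?H ! t \<in> set ?H" using that by (rule nth_mem)
      then show ?thesis using l by auto
    qed
    show "cact c1 (?H ! t) l = c2 l" if "t < length ?H" "c1 l = c2 l" for t c1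
      using *[OF that(1), of c1] that(2) by simp
    then show "cact c1 (?H ! t) l = c2 l" if "t < length ?H" "c1 l = c2 l" for t c1
      using that by simp
    show "set ?H \<subseteq> positive_roots n" using roots by simp
  qed auto
  then have c'l: "c' l = c2 l" by simp
  have b: "c1 i \<le> c i" "0 < c1 i \<longleftrightarrow> 0 < c i" "\<And>p. p \<noteq> i \<Longrightarrow> l \<le> p \<Longrightarrow> c1 p = c p"
    "\<And>p. i < p \<Longrightarrow> p \<le> n \<Longrightarrow> \<not> (c1 i \<le> c p \<and> c p \<le> c i)"
    "\<And>p. i < p \<Longrightarrow> p \<le> n \<Longrightarrow> \<not> (c1 i \<le> - c p \<and> - c p \<le> c i)"
    "\<And>p. l \<le> p \<Longrightarrow> p < i \<Longrightarrow> \<not> (c1 i \<le> - c p \<and> - c p \<le> c i)"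
    using barred_block[OF P1 s] l by auto
  from P2 show ?thesis
  proof (cases rule: path_singleE)
    case 1
    then show ?thesis using c'l b(3)[of l] l by simp
  next
    case 3
    then show ?thesis using l by simp
  next
    case 2
    then have ok: "- c1 i < c l" "0 < c l \<longleftrightarrow> c1 i < 0"
      "\<And>p. l < p \<Longrightarrow> p \<le> n \<Longrightarrow> p \<noteq> i \<Longrightarrow> \<not> (- c1 i < c p \<and> c p < c l)"
      "\<And>p. i < p \<Longrightarrow> p \<le> n \<Longrightarrow> \<not> (- c1 i < - c p \<and> - c p < c l)"
      using l b(3) by auto
    have x: "c' l = - c1 i" using 2 l c'l by simp
    have ne: "c l \<noteq> 0" "c i \<noteq> 0" "c1 i \<noteq> 0" using signed_seq_ne_0[OF s] signed_seq_ne_0[OF s1] l by auto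
    have "\<not> (- c i < c r \<and> c r < c l)" if "l < r" "r < i" for r
    proof -
      have "c r \<noteq> - c1 i" using signed_seq_ne(2)[OF s1, of r i] b(3)[of r] that l by auto
      then show ?thesis using ok(3)[of r] b(6)[of r] that l by auto
    qed
    moreover have "\<not> (- c i < c q \<and> c q < c l) \<and> \<not> (- c i < - c q \<and> - c q < c l)" if "i < q" "q \<le> n" for q
    proof -
      have "c q \<noteq> - c1 i" "c q \<noteq> c1 i" using signed_seq_ne[OF s1, of q i] b(3)[of q] that l by auto
      then show ?thesis using ok(3)[of q] ok(4)[of q] b(4)[of q] b(5)[of q] that l by auto
    qed
    ultimately have "\<not> blocked n l i (- c i) (c l) c" unfolding blocked_def by blast
    moreover have "- c i \<le> c' l" "c' l < c l" using x b(1) ok(1) by auto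
    moreover have "(c l < 0 \<longleftrightarrow> 0 < c i) \<and> (0 < c' l \<longleftrightarrow> 0 < c l)"
      using x ok(2) b(2) ne by auto
    ultimately show ?thesis by blast
  qed
qed

text \<open>A value that forbids the later step by \<open>(Plain l, Barred i)\<close> from \<open>a\<close> to \<open>b\<close> can only be moved
  to another place where it does so by the stages between \<open>l\<close> and \<open>i\<close>, because position \<open>i\<close> holds the
  value \<open>- b\<close> meanwhile.\<close>

lemma stage_blocked:
  assumes P: "path n (Gamma_pair n k r) c U c'" and s: "signed_seq n c" and r: "1 \<le> l" "l < r" "r < i" "i \<le> k" "k \<le> n"
    and ci: "c i = - b" and ab: "0 < b \<longleftrightarrow> 0 < a" "a \<noteq> 0" and B: "blocked n l i b a c"
  shows "blocked n l i b a c'"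
proof -
  have i: "1 \<le> r" "r \<le> k" "k \<le> n" using r by auto
  have b0: "b \<noteq> 0" using signed_seq_ne_0[OF s, of i] ci r by auto
  let ?Q = "\<lambda>c. c i = - b \<and> blocked n l i b a c"
  have step: "?Q (cact c \<beta>)" if mem: "\<beta> \<in> set (Gamma_pair n k r)" and s: "signed_seq n c" and Q: "?Q c"
    and ok: "down_ok n c \<beta> \<or> up_ok n c \<beta>" for \<beta> c
  proof -
    from Q have ci: "c i = - b" and B: "blocked n l i b a c" by auto
    have ne: "c p \<noteq> - b" "c p \<noteq> b" if "1 \<le> p" "p \<le> n" "p \<noteq> i" for p
      using signed_seq_ne[OF s, of p i] that r ci by auto
    consider (A) t where "\<beta> = (Plain t, Barred r)" "1 \<le> t" "t < r" 
      | (B) q where "\<beta> = (Plain r, Barred q)" "k < q" "q \<le> n"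
      | (C) "\<beta> = (Plain r, Barred r)"
      | (D) q where "\<beta> = (Plain r, Plain q)" "k < q" "q \<le> n"
      using mem by (auto simp: Gamma_pair_def)
    then show ?thesis
    proof cases
      case (A t)
      let ?c = "c(t := - c r, r := - c t)"
      have e: "cact c \<beta> = ?c" using A by simp
      have ok: "- c r < c t" "\<And>p. t < p \<Longrightarrow> p \<le> n \<Longrightarrow> p \<noteq> r \<Longrightarrow> \<not> (- c r < c p \<and> c p < c t)"
        "\<And>p. r < p \<Longrightarrow> p \<le> n \<Longrightarrow> \<not> (- c r < - c p \<and> - c p < c t)"
        using ok A by auto
      \<comment> \<open>Position \<open>i\<close> lies beyond \<open>r\<close> and holds
        \<open>- b\<close>, so the interval passed contains neither \<open>- b\<close> nor
        \<open>b\<close>. Hence the value that replaces a moved obstruction is still above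
        \<open>b\<close>.\<close>
      have k: "\<not> (- c r < - b \<and> - b < c t)" "\<not> (- c r < b \<and> b < c t)"
        using ok(2)[of i] ok(3)[of i] A r ci by auto
      have ci': "?c i = - b" using ci A r by auto
      from B consider (1) p where "l < p" "p < i" "b < c p" "c p < a" "p \<noteq> t" "p \<noteq> r"
        | (2) "l < t" "b < c t" "c t < a" | (3) "b < c r" "c r < a"
        | (4) q where "i < q" "q \<le> n" "b < c q \<and> c q < a \<or> b < - c q \<and> - c q < a"
        unfolding blocked_def by blast
      then have "blocked n l i b a ?c"
      proof cases
        case 1 then show ?thesis unfolding blocked_def by (intro disjI1 exI[of _ p]) simp
      next
        case 2
        then have "b < - c r" using k ne(1)[of r] r ok(1) by auto
        moreover have "- c r < a" using ok(1) 2 by simp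
        ultimately show ?thesis unfolding blocked_def using 2 A r by (intro disjI1 exI[of _ t]) auto
      next
        case 3
        then have "b < - c t" using k ne(1)[of t] r ok(1) A by auto
        moreover have "- c t < a" using ok(1) 3 by simp
        ultimately show ?thesis unfolding blocked_def using 3 A r by (intro disjI1 exI[of _ r]) auto
      next
        case 4 then show ?thesis unfolding blocked_def using A r by (intro disjI2 exI[of _ q]) auto
      qed
      then show ?thesis unfolding e using ci' by blast
    next
      case (B q)
      let ?c = "c(r := - c q, q := - c r)"
      have e: "cact c \<beta> = ?c" using B by simp
      have qi: "i < q" "r < q" "r \<noteq> q" using B r by auto
      have ok: "- c q < c r" "\<not> (- c q < - b \<and> - b < c r)"
        using ok B r qi ci by auto
      have ci': "?c i = - b" using ci B r by auto
      from \<open>blocked n l i b a c\<close> consider (1) p where "l < p" "p < i" "b < c p" "c p < a" "p \<noteq> r"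
        | (2) "b < c r" "c r < a"
        | (3) q' where "i < q'" "q' \<le> n" "q' \<noteq> q" "b < c q' \<and> c q' < a \<or> b < - c q' \<and> - c q' < a"
        | (4) "b < - c q" "- c q < a" | (5) "b < c q" "c q < a"
        unfolding blocked_def by blast
      then have "blocked n l i b a ?c"
      proof cases
        case 1 then show ?thesis unfolding blocked_def using qi by (intro disjI1 exI[of _ p]) simp
      next
        case 2 then show ?thesis unfolding blocked_def using qi B by (intro disjI2 exI[of _ q]) simp
      next
        case 3 then show ?thesis unfolding blocked_def using qi r by (intro disjI2 exI[of _ q']) auto
      next
        case 4 then show ?thesis unfolding blocked_def using qi r by (intro disjI1 exI[of _ r]) simp
      next
        case 5
        then have "b < - c r" using ok ne(1)[of r] ne(2)[of r] r by auto
        moreover have "- c r < a" using ok(1) 5 by simp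
        ultimately show ?thesis unfolding blocked_def using qi B by (intro disjI2 exI[of _ q]) simp
      qed
      then show ?thesis unfolding e using ci' by blast
    next
      case C
      let ?c = "c(r := - c r)"
      have e: "cact c \<beta> = ?c" using C by simp
      have ok: "0 < c r \<and> c r < \<bar>b\<bar> \<or> c r < 0 \<and> \<bar>b\<bar> < - c r"
      proof -
        have "\<bar>c i\<bar> = \<bar>b\<bar>" using ci by simp
        then show ?thesis using ok C r by auto
      qed
      \<comment> \<open>Whether the sign change at \<open>r\<close> goes up or down fixes how the
        absolute values of \<open>c r\<close> and \<open>b\<close> compare. As \<open>a\<close> and
        \<open>b\<close> have the same sign, the value at \<open>r\<close> was not the
        obstruction.\<close>
      have "\<not> (b < c r \<and> c r < a)" using ok ab b0 by (auto simp: abs_if split: if_splits)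
      then have "blocked n l i b a ?c"
        using B r unfolding blocked_def by (metis fun_upd_other less_asym order_less_trans)
      moreover have "?c i = - b" using ci r by auto
      ultimately show ?thesis unfolding e by blast
    next
      case (D q)
      let ?c = "c(r := c q, q := c r)"
      have e: "cact c \<beta> = ?c" using D by simp
      have qi: "i < q" "r < q" "r \<noteq> q" using D r by auto
      have ok: "c q < c r \<and> \<not> (c q < - b \<and> - b < c r) \<or> c r < - b \<and> - b < c q"
        using ok D r qi ci by auto
      have ci': "?c i = - b" using ci D r by auto
      from B consider (1) p where "l < p" "p < i" "b < c p" "c p < a" "p \<noteq> r"
        | (2) "b < c r" "c r < a"
        | (3) q' where "i < q'" "q' \<le> n" "q' \<noteq> q" "b < c q' \<and> c q' < a \<or> b < - c q' \<and> - c q' < a"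
        | (4) "b < c q" "c q < a" | (5) "b < - c q" "- c q < a"
        unfolding blocked_def by blast
      then have "blocked n l i b a ?c"
      proof cases
        case 1 then show ?thesis unfolding blocked_def using qi by (intro disjI1 exI[of _ p]) simp
      next
        case 2 then show ?thesis unfolding blocked_def using qi D by (intro disjI2 exI[of _ q]) simp
      next
        case 3 then show ?thesis unfolding blocked_def using qi r by (intro disjI2 exI[of _ q']) auto
      next
        case 4 then show ?thesis unfolding blocked_def using qi r by (intro disjI1 exI[of _ r]) simp
      next
        \<comment> \<open>Here \<open>c q < - b\<close>, whereas a step up would need
          \<open>- b < c q\<close>. So the step goes down, and \<open>- c r\<close> takes over as
          the obstruction at \<open>q\<close>.\<close>
        case 5
        then have "c q < c r \<and> c r < - b" using ok ne(1)[of r] r by auto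
        then show ?thesis unfolding blocked_def using qi D 5 by (intro disjI2 exI[of _ q]) simp
      qed
      then show ?thesis unfolding e using ci' by blast
    qed
  qed
  have "(\<lambda>_ c _. ?Q c) (length (Gamma_pair n k r)) c' U"
  proof (rule path_invariant[OF P s Gamma_pair_roots[OF i]])
    show "?Q c" using ci B by blast
  next
    fix t c1 assume "t < length (Gamma_pair n k r)" "signed_seq n c1" "?Q c1"
      "down_ok n c1 (Gamma_pair n k r ! t)"
    then show "?Q (cact c1 (Gamma_pair n k r ! t))" by (intro step nth_mem disjI1)
  next
    fix t c1 assume "t < length (Gamma_pair n k r)" "signed_seq n c1" "?Q c1"
      "up_ok n c1 (Gamma_pair n k r ! t)"
    then show "?Q (cact c1 (Gamma_pair n k r ! t))" by (intro step nth_mem disjI2)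
  qed
  then show ?thesis by blast
qed

section \<open>All stages of a segment in succession\<close>

definition stages :: "nat \<Rightarrow> nat \<Rightarrow> nat \<Rightarrow> root list" where
  "stages n k i = concat (map (Gamma_pair n k) [1..<Suc i])"

lemma stages_Suc: "stages n k (Suc i) = stages n k i @ Gamma_pair n k (Suc i)"
  by (simp add: stages_def)

lemma stages_0: "stages n k 0 = []"
  by (simp add: stages_def)

lemma stages_roots: "i \<le> k \<Longrightarrow> k \<le> n \<Longrightarrow> set (stages n k i) \<subseteq> positive_roots n"
  using Gamma_pair_roots[of _ k n] by (fastforce simp: stages_def)

lemma stages_fixes:
  assumes "path n (stages n k i) c U c'" "signed_seq n c" "i < p" "p \<le> k" "k \<le> n"
  shows "c' p = c p \<and> row_ups p U = 0"
  using assms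
proof (induction i arbitrary: U c')
  case 0
  then show ?case by (auto simp: stages_0 elim: path_NilE)
next
  case (Suc i)
  from Suc.prems(1) obtain c1 U1 U2 where P1: "path n (stages n k i) c U1 c1"
    and P2: "path n (Gamma_pair n k (Suc i)) c1 U2 c'" and U: "U = U1 @ U2"
    unfolding stages_Suc by (rule path_appendE)
  have s1: "signed_seq n c1"
    by (rule path_signed_seq[OF P1 Suc.prems(2) stages_roots]) (use Suc.prems in auto)
  have "c' p = c1 p" by (rule stage_fixes[OF P2 s1]) (use Suc.prems in auto)
  moreover have "row_ups p U2 = 0" by (rule stage_ups[OF P2]) (use Suc.prems in auto)
  ultimately show ?case using Suc.IH[OF P1] Suc.prems U by auto
qed

text \<open>Through stage \<open>l\<close> position \<open>m\<close> keeps its initial value and is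
  itself the obstruction; afterwards the obstruction may move, and \<open>stage_blocked\<close>
  takes over.\<close>

lemma stages_blocked:
  assumes "path n (stages n k j) c U c'" "signed_seq n c" "1 \<le> l" "l < m" "m < i" "j < i" "i \<le> k" "k \<le> n"
    and "0 < - c i \<longleftrightarrow> 0 < a" "a \<noteq> 0" "- c i < c m" "c m < a"
  shows "blocked n l i (- c i) a c'"
  using assms
proof (induction j arbitrary: U c')
  case 0
  then have "c' = c" by (auto simp: stages_0 elim: path_NilE)
  then show ?case using 0 by (auto simp: blocked_def)
next
  case (Suc j)
  from Suc.prems(1) obtain c1 U1 U2 where P1: "path n (stages n k j) c U1 c1"
    and P2: "path n (Gamma_pair n k (Suc j)) c1 U2 c'" and U: "U = U1 @ U2"
    unfolding stages_Suc by (rule path_appendE)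
  have s1: "signed_seq n c1"
    by (rule path_signed_seq[OF P1 Suc.prems(2) stages_roots]) (use Suc.prems in auto)
  show ?case
  proof (cases "Suc j \<le> l")
    case True
    then have "c' m = c m" using stages_fixes[OF Suc.prems(1,2), of m] Suc.prems by auto
    then show ?thesis unfolding blocked_def using Suc.prems by (intro disjI1 exI[of _ m]) auto
  next
    case False
    have "c1 i = - (- c i)" using stages_fixes[OF P1 Suc.prems(2), of i] Suc.prems by auto
    moreover have "blocked n l i (- c i) a c1" by (rule Suc.IH[OF P1]) (use Suc.prems in auto)
    ultimately show ?thesis
      using stage_blocked[OF P2 s1 Suc.prems(3), of i "- c i" a] Suc.prems False by auto
  qed
qed

text \<open>Row \<open>l\<close> is unchanged before stage \<open>l\<close>, stage \<open>l\<close>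
  establishes the property, and every later stage lowers the entry at most once, which
  \<open>greedy_skip\<close> permits.\<close>

lemma stages_greedy:
  assumes "path n (stages n k j) c U c'" "signed_seq n c" "1 \<le> l" "l \<le> j" "j \<le> k" "k \<le> n"
  shows "greedy (c l) (c' l) (c ` {l<..k}) (row_ups l U)"
  using assms
proof (induction j arbitrary: U c')
  case 0
  then show ?case by simp
next
  case (Suc j)
  from Suc.prems(1) obtain c1 U1 U2 where P1: "path n (stages n k j) c U1 c1"
    and P2: "path n (Gamma_pair n k (Suc j)) c1 U2 c'" and U: "U = U1 @ U2"
    unfolding stages_Suc by (rule path_appendE)
  have s: "signed_seq n c" by fact
  have s1: "signed_seq n c1"
    by (rule path_signed_seq[OF P1 Suc.prems(2) stages_roots]) (use Suc.prems in auto)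
  have fx: "c1 p = c p" "row_ups p U1 = 0" if "j < p" "p \<le> k" for p
    using stages_fixes[OF P1 s that] Suc.prems by auto
  show ?case
  proof (cases "l = Suc j")
    case True
    have "greedy (c1 l) (c' l) (c1 ` {l<..k}) (row_ups l U2)"
      by (rule stage_own_row[OF _ s1]) (use P2 True Suc.prems in auto)
    moreover have "c1 ` {l<..k} = c ` {l<..k}" by (rule image_cong) (use fx True in auto)
    ultimately show ?thesis using fx[of l] True U Suc.prems by simp
  next
    case False
    let ?i = "Suc j"
    have l: "1 \<le> l" "l \<le> j" "l < ?i" "?i \<le> k" "k \<le> n" using Suc.prems False by auto
    have IH: "greedy (c l) (c1 l) (c ` {l<..k}) (row_ups l U)"
      using Suc.IH[OF P1 s] stage_ups[OF P2, of l] l U by simp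
    have ci: "c1 ?i = c ?i" by (rule fx) (use l in auto)
    from stage_later_row[OF P2 s1 l(1,3,4,5)] show ?thesis
    proof (elim disjE conjE)
      assume "c' l = c1 l"
      then show ?thesis using IH by simp
    next
      assume x: "- c1 ?i \<le> c' l" "c' l < c1 l" and sg: "c1 l < 0 \<longleftrightarrow> 0 < c1 ?i" "0 < c' l \<longleftrightarrow> 0 < c1 l"
        and nb: "\<not> blocked n l ?i (- c1 ?i) (c1 l) c1"
      have ne: "c1 l \<noteq> 0" "c ?i \<noteq> 0" using signed_seq_ne_0[OF s1] signed_seq_ne_0[OF s] l by auto
      \<comment> \<open>The late step passes no initial entry below row \<open>l\<close>: that of
        row \<open>i\<close> is excluded by its sign, those beyond \<open>i\<close> are still in
        place, and those between \<open>l\<close> and \<open>i\<close> may have moved but still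
        obstruct by \<open>stages_blocked\<close>.\<close>
      have gap: "\<not> (c' l \<le> c m \<and> c m \<le> c1 l)" if m: "l < m" "m \<le> k" for m
      proof
        assume h: "c' l \<le> c m \<and> c m \<le> c1 l"
        have "c m \<in> c ` {l<..k}" using m by auto
        then have "c m \<noteq> c1 l" using IH unfolding greedy_def by force
        then have less: "c m < c1 l" using h by simp
        consider "m = ?i" | "?i < m" | "m < ?i" by linarith
        then show False
        proof cases
          case 1
          then show False using h sg ci ne by auto
        next
          case 2
          then have "c m \<noteq> - c ?i" using signed_seq_ne(2)[OF s, of m ?i] m l by auto
          then have "- c1 ?i < c1 m" "c1 m < c1 l" using h x less ci fx[of m] 2 m by auto
          then have "blocked n l ?i (- c1 ?i) (c1 l) c1"
            unfolding blocked_def using 2 m l by (intro disjI2 exI[of _ m]) auto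
          then show False using nb by blast
        next
          case 3
          then have "c m \<noteq> - c ?i" using signed_seq_ne(2)[OF s, of m ?i] m l by auto
          then have "- c ?i < c m" using h x ci by auto
          then have "blocked n l ?i (- c ?i) (c1 l) c1"
            by (intro stages_blocked[OF P1 s l(1) m(1) 3 _ l(4,5)]) (use sg ne ci less in auto)
          then show False using nb ci by simp
        qed
      qed
      have D: "c ?i \<in> c ` {l<..k}" using l by auto
      have g: "\<forall>y\<in>c ` {l<..k}. \<not> (c' l \<le> y \<and> y \<le> c1 l)" using gap by auto
      from greedy_skip[OF IH D x(2) g] show ?thesis .
    qed
  qed
qed

lemma Gamma_l_greedy:
  assumes "path n (Gamma_l n k) c U c'" "signed_seq n c" "1 \<le> l" "l \<le> k" "k \<le> n"
  shows "greedy (c l) (c' l) (c ` {l<..k}) (row_ups l U)"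
  using stages_greedy[of n k k c U c' l] assms by (simp add: stages_def Gamma_l_def)

lemma path_Gamma_single_pair:
  assumes "path n (concat (map Gamma_single xs)) c U c'"
  shows "path n (concat (map (Gamma_pair n k) xs)) c U c'"
  using assms
proof (induction xs arbitrary: c U)
  case (Cons i xs)
  then obtain c1 U1 U2 where P1: "path n (Gamma_single i) c U1 c1"
    and P2: "path n (concat (map Gamma_single xs)) c1 U2 c'" and U: "U = U1 @ U2"
    by (auto elim: path_appendE)
  have "path n (Gamma_pair n k i) c (U1 @ []) c1"
    unfolding Gamma_pair_def by (rule path_appendI[OF _ path_refl]) (use P1 in \<open>simp add: Gamma_single_def\<close>)
  from path_appendI[OF this Cons.IH[OF P2]] show ?case using U by simp
qed simp

text \<open>Skipping roots is always possible, \<open>Gamma_single i\<close> is the first block of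
  \<open>Gamma_pair n k i\<close>, and for \<open>i = 1\<close> this block is empty.\<close>

lemma path_Gamma_r_l:
  assumes "path n (Gamma_r k) c U c'"
  shows "path n (Gamma_l n k) c U c'"
proof (cases "k = 0")
  case True
  then show ?thesis using assms by (simp add: Gamma_r_def Gamma_l_def)
next
  case False
  then have "[1..<Suc k] = 1 # [2..<Suc k]" by (simp add: upt_conv_Cons numeral_2_eq_2 del: upt_Suc)
  then have "Gamma_l n k = Gamma_pair n k 1 @ concat (map (Gamma_pair n k) [2..<Suc k])"
    unfolding Gamma_l_def by simp
  then show ?thesis
    using path_appendI[OF path_refl path_Gamma_single_pair[OF assms[unfolded Gamma_r_def]]] by simp
qed

lemma Gamma_r_no_ups:
  assumes "path n (Gamma_r k) c U c'"
  shows "U = []"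
proof (rule ccontr)
  assume "U \<noteq> []"
  then have "hd U \<in> set U" by simp
  from path_ups[OF assms this] show False
    by (auto simp: Gamma_r_def Gamma_single_def)
qed

lemma Gamma_r_greedy:
  assumes "path n (Gamma_r k) c U c'" "signed_seq n c" "1 \<le> l" "l \<le> k" "k \<le> n"
  shows "greedy (c l) (c' l) (c ` {l<..k}) 0"
  using Gamma_l_greedy[OF path_Gamma_r_l[OF assms(1)] assms(2-5)] Gamma_r_no_ups[OF assms(1)] by simp

subsection \<open>The charge of a word read off rows\<close>

definition descending :: "('a::linorder) set \<Rightarrow> 'a list" where
  "descending S = rev (sorted_list_of_set S)"

text \<open>The index of \<beta> in \<open>descending S\<close>, expressed by counting so that
  comparing positions means comparing elements.\<close>

definition pos_in :: "('a::linorder) set \<Rightarrow> 'a \<Rightarrow> nat" where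
  "pos_in S \<beta> = card {b\<in>S. \<beta> < b}"

lemma set_descending: "finite S \<Longrightarrow> set (descending S) = S"
  and distinct_descending: "distinct (descending S)"
  by (simp_all add: descending_def)

lemma descending_pos:
  assumes "finite S" "\<beta> \<in> S"
  shows "pos_in S \<beta> < length (descending S)" "descending S ! pos_in S \<beta> = \<beta>"
proof -
  let ?xs = "descending S"
  obtain i where i: "i < length ?xs" "?xs ! i = \<beta>"
    using assms set_descending by (metis in_set_conv_nth)
  have sw: "sorted_wrt (\<lambda>x y. y < x) ?xs"
    by (simp add: descending_def sorted_wrt_rev strict_sorted_list_of_set)
  have "{b\<in>S. \<beta> < b} = (!) ?xs ` {..<i}"
  proof (intro equalityI subsetI)
    fix b assume b: "b \<in> {b\<in>S. \<beta> < b}"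
    then obtain j where j: "j < length ?xs" "?xs ! j = b"
      using set_descending[OF assms(1)] by (metis (no_types, lifting) in_set_conv_nth mem_Collect_eq)
    have "\<not> i < j" using sorted_wrt_nth_less[OF sw, of i j] i j b by auto
    moreover have "i \<noteq> j" using i j b by auto
    ultimately show "b \<in> (!) ?xs ` {..<i}" using j by force
  next
    fix b assume "b \<in> (!) ?xs ` {..<i}"
    then obtain j where "j < i" "b = ?xs ! j" by auto
    then show "b \<in> {b\<in>S. \<beta> < b}"
      using sorted_wrt_nth_less[OF sw, of j i] i set_descending[OF assms(1)] nth_mem[of j ?xs] by auto
  qed
  moreover have "inj_on ((!) ?xs) {..<i}"
    by (rule inj_on_nth[OF distinct_descending]) (use i in auto)
  ultimately have "pos_in S \<beta> = i" by (simp add: pos_in_def card_image)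
  then show "pos_in S \<beta> < length ?xs" "?xs ! pos_in S \<beta> = \<beta>" using i by auto
qed

lemma pos_in_nth:
  assumes "finite S" "q < length (descending S)"
  shows "descending S ! q \<in> S" "pos_in S (descending S ! q) = q"
proof -
  show 1: "descending S ! q \<in> S" using assms set_descending nth_mem by blast
  show "pos_in S (descending S ! q) = q"
    using descending_pos[OF assms(1) 1] assms(2) distinct_descending nth_eq_iff_index_eq by blast
qed

lemma pos_in_less_iff:
  assumes "finite S" "\<beta> \<in> S" "\<gamma> \<in> S"
  shows "pos_in S \<beta> < pos_in S \<gamma> \<longleftrightarrow> \<gamma> < \<beta>"
proof
  assume "\<gamma> < \<beta>"
  then have "{b\<in>S. \<beta> < b} \<subset> {b\<in>S. \<gamma> < b}" using assms by force
  then show "pos_in S \<beta> < pos_in S \<gamma>"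
    unfolding pos_in_def by (rule psubset_card_mono[rotated]) (use assms in simp)
next
  assume l: "pos_in S \<beta> < pos_in S \<gamma>"
  show "\<gamma> < \<beta>"
  proof (rule ccontr)
    assume "\<not> \<gamma> < \<beta>"
    then have "{b\<in>S. \<gamma> < b} \<subseteq> {b\<in>S. \<beta> < b}" by auto
    then have "pos_in S \<gamma> \<le> pos_in S \<beta>"
      unfolding pos_in_def by (rule card_mono[rotated]) (use assms in simp)
    with l show False by simp
  qed
qed

section \<open>Selection of one row by the charge procedure\<close>

definition label_word :: "('a::linorder \<times> nat) set \<Rightarrow> nat list" where
  "label_word S = map snd (descending S)"

lemma label_word_positions:
  assumes "finite S"
  shows "{q. q < length (label_word S) \<and> label_word S ! q = a} = pos_in S ` {\<beta>\<in>S. snd \<beta> = a}"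
proof (intro equalityI subsetI)
  fix q assume "q \<in> {q. q < length (label_word S) \<and> label_word S ! q = a}"
  then have "q < length (descending S)" "snd (descending S ! q) = a" by (auto simp: label_word_def)
  then show "q \<in> pos_in S ` {\<beta>\<in>S. snd \<beta> = a}"
    using pos_in_nth[OF assms] by (metis (mono_tags, lifting) image_eqI mem_Collect_eq)
next
  fix q assume "q \<in> pos_in S ` {\<beta>\<in>S. snd \<beta> = a}"
  then show "q \<in> {q. q < length (label_word S) \<and> label_word S ! q = a}"
    using descending_pos[OF assms] by (auto simp: label_word_def)
qed

text \<open>Positions fall as biletters grow, so the copy nearest to \<open>p\<close> on its left is
  the one with the smallest entry among those to the left.\<close>

lemma next_position_near:
  assumes S: "finite S" "(z, a) \<in> S" and p: "pos_in S (z, a) < p"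
    and min: "\<And>z'. (z', a) \<in> S \<Longrightarrow> pos_in S (z', a) < p \<Longrightarrow> z \<le> z'"
  shows "next_position (label_word S) p a = pos_in S (z, a)"
proof -
  note P = label_word_positions[OF S(1), of a]
  have e: "{q. q < p \<and> q < length (label_word S) \<and> label_word S ! q = a}
      = {q \<in> pos_in S ` {\<beta>\<in>S. snd \<beta> = a}. q < p}"
    unfolding P[symmetric] by auto
  have "Max {q. q < p \<and> q < length (label_word S) \<and> label_word S ! q = a} = pos_in S (z, a)"
    unfolding e
  proof (rule Max_eqI)
    fix q assume "q \<in> {q \<in> pos_in S ` {\<beta>\<in>S. snd \<beta> = a}. q < p}"
    then obtain z' where z': "(z', a) \<in> S" "q = pos_in S (z', a)" "q < p" by auto
    then have "(z, a) \<le> (z', a)" using min by (auto simp: less_eq_prod_def less_le)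
    then show "q \<le> pos_in S (z, a)"
      using pos_in_less_iff[OF S(1) S(2) z'(1)] z'(2) by (meson leD not_le)
  qed (use S p in auto)
  moreover have "pos_in S (z, a) < length (label_word S)" "label_word S ! pos_in S (z, a) = a"
    using descending_pos[OF S] by (simp_all add: label_word_def)
  ultimately show ?thesis using p unfolding next_position_def by (metis (mono_tags, lifting))
qed

lemma next_position_far:
  assumes S: "finite S" "(z, a) \<in> S"
    and p: "\<And>z'. (z', a) \<in> S \<Longrightarrow> \<not> pos_in S (z', a) < p"
    and min: "\<And>z'. (z', a) \<in> S \<Longrightarrow> z \<le> z'"
  shows "next_position (label_word S) p a = pos_in S (z, a)"
proof -
  note P = label_word_positions[OF S(1), of a]
  have "Max {q. q < length (label_word S) \<and> label_word S ! q = a} = pos_in S (z, a)"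
    unfolding P
  proof (rule Max_eqI)
    fix q assume "q \<in> pos_in S ` {\<beta>\<in>S. snd \<beta> = a}"
    then obtain z' where z': "(z', a) \<in> S" "q = pos_in S (z', a)" by auto
    then have "(z, a) \<le> (z', a)" using min by (auto simp: less_eq_prod_def less_le)
    then show "q \<le> pos_in S (z, a)"
      using pos_in_less_iff[OF S(1) S(2) z'(1)] z'(2) by (meson leD not_le)
  qed (use S in auto)
  moreover have "\<not> (\<exists>q<p. q < length (label_word S) \<and> label_word S ! q = a)"
  proof
    assume "\<exists>q<p. q < length (label_word S) \<and> label_word S ! q = a"
    then obtain q where q: "q < p" "q \<in> {q. q < length (label_word S) \<and> label_word S ! q = a}" by auto
    then obtain z' where "(z', a) \<in> S" "q = pos_in S (z', a)" unfolding P by auto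
    with q(1) p show False by blast
  qed
  ultimately show ?thesis unfolding next_position_def by (simp only: if_False)
qed

text \<open>The cyclic selection rule in terms of entries: going up from \<open>y a\<close> to
  \<open>y (Suc a)\<close>, possibly wrapping around once, no other entry labeled
  \<open>Suc a\<close> is met. The row starts at the smallest entry labeled
  \<open>1\<close>.\<close>

definition selectable_row :: "('a::linorder \<times> nat) set \<Rightarrow> (nat \<Rightarrow> 'a) \<Rightarrow> nat \<Rightarrow> bool" where
  "selectable_row S y r \<longleftrightarrow> (\<forall>a\<in>{1..r}. (y a, a) \<in> S) \<and> (\<forall>z. (z, 1) \<in> S \<longrightarrow> y 1 \<le> z) \<and>
     (\<forall>a z. 1 \<le> a \<and> a < r \<and> (z, Suc a) \<in> S \<longrightarrow> z = y (Suc a) \<or>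
        (if y a \<le> y (Suc a) then z < y a \<or> y (Suc a) < z else y (Suc a) < z \<and> z < y a))"

lemma selected_position_row:
  assumes S: "finite S" and row: "selectable_row S y r" and "1 \<le> a" "a \<le> r"
  shows "selected_position (label_word S) a = pos_in S (y a, a)"
  using assms(3,4)
proof (induction a rule: nat_induct_at_least)
  case base
  have m: "(y 1, 1) \<in> S" using row base by (auto simp: selectable_row_def)
  have "pos_in S (y 1, 1) < length (label_word S)"
    using descending_pos(1)[OF S m] by (simp add: label_word_def)
  then show ?case
    using next_position_near[OF S m] row by (auto simp: selectable_row_def)
next
  case (Suc a)
  then have m: "(y a, a) \<in> S" "(y (Suc a), Suc a) \<in> S" using row by (auto simp: selectable_row_def)
  have step: "z = y (Suc a) \<or>
        (if y a \<le> y (Suc a) then z < y a \<or> y (Suc a) < z else y (Suc a) < z \<and> z < y a)" if "(z, Suc a) \<in> S" for z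
    using row Suc that by (auto simp: selectable_row_def)
  \<comment> \<open>Ties count as lying to the left: among equal entries the larger label comes
    first in the word.\<close>
  have less: "pos_in S (z, Suc a) < pos_in S (y a, a) \<longleftrightarrow> y a \<le> z" if "(z, Suc a) \<in> S" for z
    using pos_in_less_iff[OF S that m(1)] by (auto simp: less_prod_def)
  have "next_position (label_word S) (pos_in S (y a, a)) (Suc a) = pos_in S (y (Suc a), Suc a)"
  proof (cases "y a \<le> y (Suc a)")
    case True
    show ?thesis
    proof (rule next_position_near[OF S m(2)])
      show "pos_in S (y (Suc a), Suc a) < pos_in S (y a, a)" using less[OF m(2)] True by simp
      show "y (Suc a) \<le> z" if "(z, Suc a) \<in> S" "pos_in S (z, Suc a) < pos_in S (y a, a)" for z
        using step[OF that(1)] less[OF that(1)] that(2) True by auto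
    qed
  next
    case False
    show ?thesis
    proof (rule next_position_far[OF S m(2)])
      show "\<not> pos_in S (z, Suc a) < pos_in S (y a, a)" if "(z, Suc a) \<in> S" for z
        using step[OF that] less[OF that] False by auto
      show "y (Suc a) \<le> z" if "(z, Suc a) \<in> S" for z
        using step[OF that] False by auto
    qed
  qed
  then show ?case using Suc by simp
qed

lemma last_letter_label_word:
  assumes S: "finite S" and "snd ` S = {1..r}"
  shows "last_letter (label_word S) = r"
proof -
  have "set (label_word S) = {1..r}"
    using assms by (simp add: label_word_def set_descending)
  then show ?thesis unfolding last_letter_def
    by (intro Least_equality) auto
qed

lemma nths_cong_index:
  assumes "\<And>i. i < length xs \<Longrightarrow> i \<in> A \<longleftrightarrow> i \<in> B"
  shows "nths xs A = nths xs B"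
proof -
  have "filter (\<lambda>p. snd p \<in> A) (zip xs [0..<length xs]) = filter (\<lambda>p. snd p \<in> B) (zip xs [0..<length xs])"
    using assms by (intro filter_cong refl) (auto simp: set_zip)
  then show ?thesis by (simp add: nths_def)
qed

lemma remove_row:
  assumes S: "finite S" and "snd ` S = {1..r}" and row: "selectable_row S y r"
  shows "remove_selected (label_word S) = label_word (S - (\<lambda>a. (y a, a)) ` {1..r})"
proof -
  let ?R = "(\<lambda>a. (y a, a)) ` {1..r}"
  have R: "?R \<subseteq> S" using row by (auto simp: selectable_row_def)
  have "selected_positions (label_word S) = (\<lambda>a. pos_in S (y a, a)) ` {1..r}"
    unfolding selected_positions_def last_letter_label_word[OF assms(1,2)]
    by (rule image_cong) (use selected_position_row[OF S row] in auto)
  then have sel: "selected_positions (label_word S) = pos_in S ` ?R"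
    by (simp add: image_image)
  have "remove_selected (label_word S) = map snd (nths (descending S) (- pos_in S ` ?R))"
    unfolding remove_selected_def sel by (simp only: label_word_def nths_map)
  also have "nths (descending S) (- pos_in S ` ?R) = filter (\<lambda>\<beta>. \<beta> \<notin> ?R) (descending S)"
  proof -
    have "i \<in> - pos_in S ` ?R \<longleftrightarrow> descending S ! i \<notin> ?R" if i: "i < length (descending S)" for i
    proof -
      have "i \<in> pos_in S ` ?R \<longleftrightarrow> descending S ! i \<in> ?R"
      proof
        assume "i \<in> pos_in S ` ?R"
        then obtain \<beta> where \<beta>: "\<beta> \<in> ?R" "i = pos_in S \<beta>" by blast
        then have "descending S ! i = \<beta>" using descending_pos(2)[OF S] R by blast
        then show "descending S ! i \<in> ?R" using \<beta>(1) by simp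
      next
        assume "descending S ! i \<in> ?R"
        then have "pos_in S (descending S ! i) \<in> pos_in S ` ?R" by (rule imageI)
        then show "i \<in> pos_in S ` ?R" using pos_in_nth(2)[OF S i] by simp
      qed
      then show ?thesis by simp
    qed
    then show ?thesis unfolding filter_eq_nths by (intro nths_cong_index) auto
  qed
  also have "\<dots> = descending (S - ?R)"
  proof -
    have "filter (\<lambda>\<beta>. \<beta> \<notin> ?R) (sorted_list_of_set S) = sorted_list_of_set (S - ?R)"
      using S by (intro sorted_distinct_set_unique) (auto intro: sorted_wrt_filter)
    then show ?thesis by (simp add: descending_def rev_filter[symmetric])
  qed
  finally show ?thesis by (simp add: label_word_def)
qed

text \<open>The positions of the labels \<open>2 * j\<close> and \<open>Suc (2 * j)\<close> are
  ordered like their biletters. For equal entries the larger label stands to the left, so equality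
  contributes nothing.\<close>

lemma contribution_row:
  assumes S: "finite S" and "snd ` S = {1..r}" and row: "selectable_row S y r"
  shows "charge_contribution (label_word S) =
    (\<Sum>j | 1 \<le> j \<and> j < r div 2 \<and> y (Suc (2 * j)) < y (2 * j). r div 2 - j)"
proof -
  have "selected_position (label_word S) (primed j) < selected_position (label_word S) (unprimed (j + 1))
      \<longleftrightarrow> y (Suc (2 * j)) < y (2 * j)" if j: "1 \<le> j" "j < r div 2" for j
  proof -
    have le: "1 \<le> 2 * j" "2 * j \<le> r" "1 \<le> Suc (2 * j)" "Suc (2 * j) \<le> r" using j by linarith+
    have m: "(y (2 * j), 2 * j) \<in> S" "(y (Suc (2 * j)), Suc (2 * j)) \<in> S"
      using row le unfolding selectable_row_def by force+
    have "selected_position (label_word S) (primed j) < selected_position (label_word S) (unprimed (j + 1))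
       \<longleftrightarrow> pos_in S (y (2 * j), 2 * j) < pos_in S (y (Suc (2 * j)), Suc (2 * j))"
      unfolding primed_def unprimed_def
      using selected_position_row[OF S row le(1,2)] selected_position_row[OF S row le(3,4)] by simp
    also have "\<dots> \<longleftrightarrow> y (Suc (2 * j)) < y (2 * j)"
      using pos_in_less_iff[OF S m] by (auto simp: less_prod_def)
    finally show ?thesis .
  qed
  then show ?thesis
    unfolding charge_contribution_def last_letter_label_word[OF S assms(2)] Let_def
    by (intro sum.cong) auto
qed

section \<open>Removing the rows one after the other\<close>

definition row_set :: "(nat \<Rightarrow> nat \<Rightarrow> 'a) \<Rightarrow> (nat \<Rightarrow> nat) \<Rightarrow> nat set \<Rightarrow> ('a \<times> nat) set" where
  "row_set x r A = (\<Union>l\<in>A. (\<lambda>a. (x l a, a)) ` {1..r l})"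

text \<open>Row \<open>k\<close> is the longest one left, so it carries all labels of the word and
  the selection ends exactly with its last entry. What remains is the word of the rows
  below.\<close>

lemma charge_row_set:
  fixes x :: "nat \<Rightarrow> nat \<Rightarrow> 'a::linorder"
  assumes r: "\<And>l m. 1 \<le> l \<Longrightarrow> l \<le> m \<Longrightarrow> m \<le> L \<Longrightarrow> r m \<le> r l"
    and first: "\<And>l m. 1 \<le> l \<Longrightarrow> l < m \<Longrightarrow> m \<le> L \<Longrightarrow> 1 \<le> r m \<Longrightarrow> x l 1 < x m 1"
    and step: "\<And>l m a. 1 \<le> l \<Longrightarrow> l < m \<Longrightarrow> m \<le> L \<Longrightarrow> 1 \<le> a \<Longrightarrow> a < r m \<Longrightarrow>
      (if x l a \<le> x l (Suc a) then x m (Suc a) < x l a \<or> x l (Suc a) < x m (Suc a)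
       else x l (Suc a) < x m (Suc a) \<and> x m (Suc a) < x l a)"
    and "1 \<le> k" "k \<le> Suc L"
  shows "charge (label_word (row_set x r {k..L})) =
    (\<Sum>l\<in>{k..L}. \<Sum>j | 1 \<le> j \<and> j < r l div 2 \<and> x l (Suc (2 * j)) < x l (2 * j). r l div 2 - j)"
  using assms(4,5)
proof (induction "Suc L - k" arbitrary: k)
  case 0
  then have "{k..L} = {}" by simp
  then show ?case by (simp add: row_set_def label_word_def descending_def charge.simps[of "[]"])
next
  case (Suc d)
  then have k: "1 \<le> k" "k \<le> L" by auto
  have kL: "{k..L} = insert k {Suc k..L}" using k by auto
  let ?S = "row_set x r {k..L}" and ?S' = "row_set x r {Suc k..L}"
  let ?R = "(\<lambda>a. (x k a, a)) ` {1..r k}"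
  let ?f = "\<lambda>l. \<Sum>j | 1 \<le> j \<and> j < r l div 2 \<and> x l (Suc (2 * j)) < x l (2 * j). r l div 2 - j"
  have fin: "finite ?S" by (simp add: row_set_def)
  have IH: "charge (label_word ?S') = (\<Sum>l\<in>{Suc k..L}. ?f l)"
    by (rule Suc.hyps(1)) (use Suc.hyps(2) k in auto)
  have mem: "(x k a, a) \<in> ?S" if "a \<in> {1..r k}" for a
    unfolding row_set_def by (rule UN_I[of k]) (use k that in auto)
  have lab: "snd ` ?S = {1..r k}"
  proof
    show "snd ` ?S \<subseteq> {1..r k}"
    proof
      fix a assume "a \<in> snd ` ?S"
      then obtain l where "l \<in> {k..L}" "1 \<le> a" "a \<le> r l" by (auto simp: row_set_def)
      then show "a \<in> {1..r k}" using r[of k l] k by simp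
    qed
    show "{1..r k} \<subseteq> snd ` ?S"
    proof
      fix a assume "a \<in> {1..r k}"
      from imageI[OF mem[OF this], of snd] show "a \<in> snd ` ?S" by simp
    qed
  qed
  have sum: "(\<Sum>l\<in>{k..L}. ?f l) = ?f k + (\<Sum>l\<in>{Suc k..L}. ?f l)"
    unfolding kL by simp
  show ?case
  proof (cases "r k = 0")
    case True
    then have "?S = {}" using lab by simp
    moreover have "?f l = 0" if "l \<in> {k..L}" for l using r[of k l] that k True by simp
    ultimately show ?thesis
      by (simp add: label_word_def descending_def charge.simps[of "[]"])
  next
    case False
    have row: "selectable_row ?S (x k) (r k)"
      unfolding selectable_row_def
    proof (intro conjI ballI allI impI)
      show "(x k a, a) \<in> ?S" if "a \<in> {1..r k}" for a using that by (rule mem)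
      show "x k 1 \<le> z" if zS: "(z, 1) \<in> ?S" for z
      proof -
        obtain l where "l \<in> {k..L}" "1 \<le> r l" "z = x l 1" using zS by (auto simp: row_set_def)
        then show ?thesis using first[of k l] k by (cases "l = k") auto
      qed
      fix a z assume az: "1 \<le> a \<and> a < r k \<and> (z, Suc a) \<in> ?S"
      then obtain l where "l \<in> {k..L}" "Suc a \<le> r l" "z = x l (Suc a)" by (auto simp: row_set_def)
      then show "z = x k (Suc a) \<or> (if x k a \<le> x k (Suc a) then z < x k a \<or> x k (Suc a) < z
        else x k (Suc a) < z \<and> z < x k a)"
        using step[of k l a] az k by (cases "l = k") auto
    qed
    \<comment> \<open>The strict inequalities in \<open>first\<close> and \<open>step\<close> keep
      the biletters of row \<open>k\<close> apart from all others, so removing them as a set takes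
      nothing from the lower rows.\<close>
    have disj: "?R \<inter> ?S' = {}"
    proof (rule ccontr)
      assume "?R \<inter> ?S' \<noteq> {}"
      then obtain a l where a: "1 \<le> a" "a \<le> r k" and l: "Suc k \<le> l" "l \<le> L" "a \<le> r l" and e: "x k a = x l a"
        by (auto simp: row_set_def)
      show False
      proof (cases "a = 1")
        case True then show False using first[of k l] l k e by auto
      next
        case False
        then obtain b where "a = Suc b" "1 \<le> b" using a by (cases a) auto
        then show False using step[of k l b] l k e by (auto split: if_splits)
      qed
    qed
    have "?S = ?R \<union> ?S'" unfolding kL by (simp add: row_set_def)
    then have "?S - ?R = ?S'" using disj by blast
    then have rem: "remove_selected (label_word ?S) = label_word ?S'"
      using remove_row[OF fin lab row] by simp
    have "1 \<in> set (label_word ?S)"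
      using lab False fin by (simp add: label_word_def set_descending)
    then have "charge (label_word ?S) = charge_contribution (label_word ?S) + charge (label_word ?S')"
      using charge.simps[of "label_word ?S"] rem by simp
    then show ?thesis
      unfolding sum IH contribution_row[OF fin lab row] .
  qed
qed

subsection \<open>Level, arms and charge of a folding pair\<close>

lemma conj_part_antimono: "i \<le> j \<Longrightarrow> conj_part \<mu> j \<le> conj_part \<mu> i"
  unfolding conj_part_def by (induction \<mu>) auto

lemma conj_part_le_length: "conj_part \<mu> j \<le> length \<mu>"
  by (simp add: conj_part_def)

lemma Gamma_above_last: "hd \<mu> \<le> j \<Longrightarrow> Gamma_above n \<mu> j = []"
  by (simp add: Gamma_above_def)

lemma Gamma_above_step:
  assumes "1 \<le> j" "j \<le> hd \<mu>"
  shows "Gamma_above n \<mu> (j - 1) = Gamma_above n \<mu> j @ Gamma_r (conj_part \<mu> j) @ Gamma_l n (conj_part \<mu> j)"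
proof -
  have "[Suc (j - 1)..<Suc (hd \<mu>)] = j # [Suc j..<Suc (hd \<mu>)]"
    using assms by (simp add: upt_conv_Cons del: upt_Suc)
  then show ?thesis by (simp add: Gamma_above_def del: upt_Suc)
qed

lemma Gamma_l_roots: "k \<le> n \<Longrightarrow> set (Gamma_l n k) \<subseteq> positive_roots n"
  using Gamma_pair_roots[of _ k n] by (fastforce simp: Gamma_l_def)

lemma Gamma_r_roots: "k \<le> n \<Longrightarrow> set (Gamma_r k) \<subseteq> positive_roots n"
  by (fastforce simp: Gamma_r_def Gamma_single_def positive_roots_def)

lemma count_list_concat: "count_list (concat xss) y = (\<Sum>xs\<leftarrow>xss. count_list xs y)"
  by (induction xss) auto

lemma count_list_distinct: "distinct xs \<Longrightarrow> count_list xs y = of_bool (y \<in> set xs)"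
  by (induction xs) auto

lemma distinct_Gamma_pair:
  assumes "i \<le> k"
  shows "distinct (Gamma_pair n k i)"
  using assms by (auto simp: Gamma_pair_def distinct_map inj_on_def)

text \<open>A root that can go up is \<open>(Plain l, Barred l)\<close> or
  \<open>(Plain l, Plain q)\<close> with \<open>q > k\<close>. For a column of height
  \<open>k' \<le> k\<close> it can occur only in stage \<open>l\<close>, and occurs there once if
  that stage exists; \<open>Gamma_r\<close> has no root of this kind.\<close>

lemma count_Gamma_l:
  assumes "\<beta> \<in> set (Gamma_l n k)" "up_ok n c \<beta>" "k' \<le> k"
  obtains l where "fst \<beta> = Plain l" "1 \<le> l" "l \<le> k" "count_list (Gamma_l n k') \<beta> = of_bool (l \<le> k')"
    "count_list (Gamma_r k'') \<beta> = 0"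
proof -
  from assms(1,2) obtain l where l: "1 \<le> l" "l \<le> k" and
    b: "\<beta> = (Plain l, Barred l) \<or> (\<exists>q. \<beta> = (Plain l, Plain q) \<and> k < q \<and> q \<le> n)"
    unfolding Gamma_l_def Gamma_pair_def by auto
  have f: "fst \<beta> = Plain l" using b by auto
  have "\<beta> \<in> set (Gamma_pair n k' i) \<longleftrightarrow> i = l" if "1 \<le> i" "i \<le> k'" for i
    using b that assms(3) by (auto simp: Gamma_pair_def)
  then have "count_list (Gamma_pair n k' i) \<beta> = of_bool (i = l)" if "1 \<le> i" "i \<le> k'" for i
    using count_list_distinct[OF distinct_Gamma_pair[OF that(2)]] that by simp
  then have "count_list (Gamma_l n k') \<beta> = (\<Sum>i\<leftarrow>[1..<Suc k']. of_bool (i = l))"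
    unfolding Gamma_l_def count_list_concat map_map
    by (intro arg_cong[of _ _ sum_list] map_cong refl) (auto simp del: upt_Suc)
  also have "\<dots> = (\<Sum>i\<in>{1..k'}. of_bool (i = l))"
    unfolding sum_list_distinct_conv_sum_set[OF distinct_upt] by (rule sum.cong) auto
  also have "\<dots> = of_bool (l \<le> k')" using l by (simp add: of_bool_def)
  finally have 1: "count_list (Gamma_l n k') \<beta> = of_bool (l \<le> k')" .
  have "\<beta> \<notin> set (Gamma_r k'')" using b by (auto simp: Gamma_r_def Gamma_single_def)
  then have "count_list (Gamma_r k'') \<beta> = 0" by simp
  from that[OF f l 1 this] show thesis .
qed

lemma affine_level_count:
  assumes "p < length G"
  shows "affine_level G p = count_list (take (Suc p) G) (G ! p)"
proof -
  have "count_list (take (Suc p) G) (G ! p) = card {i. i < Suc p \<and> G ! i = G ! p}"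
    using assms unfolding count_list_eq_length_filter length_filter_conv_card
    by (intro arg_cong[of _ _ card]) auto
  then show ?thesis by (simp add: affine_level_def less_Suc_eq_le)
qed

lemma val_Suc_le: "Plain l < x \<Longrightarrow> Plain (Suc l) \<le> x"
  by (cases x) (auto simp: less_letter_def)

text \<open>Merges the two families of columns into one, indexed by label codes: \<open>j'\<close>
  is \<open>2 * j\<close> and \<open>j\<close> is \<open>2 * j - 1\<close>.\<close>

lemma concat_pairs:
  "concat (map (\<lambda>j. [f j, g j]) (rev [1..<Suc M]))
     = map (\<lambda>a. if even a then f (Suc a div 2) else g (Suc a div 2)) (rev [1..<Suc (2 * M)])"
  by (induction M) auto

lemma distinct_concat_map:
  assumes "distinct xs" "\<And>x. x \<in> set xs \<Longrightarrow> distinct (f x)"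
    "\<And>x y. x \<in> set xs \<Longrightarrow> y \<in> set xs \<Longrightarrow> x \<noteq> y \<Longrightarrow> set (f x) \<inter> set (f y) = {}"
  shows "distinct (concat (map f xs))"
  using assms
proof (induction xs)
  case (Cons x xs)
  have "set (f x) \<inter> set (f y) = {}" if "y \<in> set xs" for y
    by (rule Cons.prems(3)) (use that Cons.prems(1) in auto)
  then show ?case using Cons by auto
qed simp

lemma sum_list_rows:
  fixes F :: "nat \<Rightarrow> nat"
  assumes "\<And>\<beta>. \<beta> \<in> set U \<Longrightarrow> \<exists>l. fst \<beta> = Plain l \<and> 1 \<le> l \<and> l \<le> n"
  shows "(\<Sum>\<beta>\<leftarrow>U. F (absval (fst \<beta>))) = (\<Sum>l\<in>{1..n}. row_ups l U * F l)"
  using assms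
proof (induction U)
  case (Cons \<beta> U)
  obtain m where m: "fst \<beta> = Plain m" "1 \<le> m" "m \<le> n" using Cons.prems[of \<beta>] by auto
  have "row_ups l (\<beta> # U) * F l = (if l = m then F l else 0) + row_ups l U * F l" for l
    using m by (simp add: row_ups_def)
  then show ?case using m Cons by (simp add: sum.distrib)
qed simp

section \<open>Columns, segments and rows of a fixed folding pair\<close>

locale extremal_pair =
  fixes n :: nat and \<mu> :: "nat list" and w :: "letter \<Rightarrow> letter" and J :: "nat set"
  assumes len_mu: "length \<mu> = n" and extremal: "(w, J) \<in> folding_pairs_bar n \<mu>"
begin

abbreviation "M \<equiv> hd \<mu>"
abbreviation "h \<equiv> conj_part \<mu>"
abbreviation "chain \<equiv> Gamma_chain n \<mu>"
abbreviation "negs \<equiv> negative_foldings n chain w J"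

definition prod_at :: "nat \<Rightarrow> letter \<Rightarrow> letter" where
  "prod_at p = act w (nths (take p chain) J)"

definition seq_at :: "nat \<Rightarrow> nat \<Rightarrow> real" where
  "seq_at p = win (prod_at p)"

text \<open>The columns are numbered by their labels, that is, from right to left starting with \<open>1\<close>;
  \<open>0\<close> stands for the end of the chain.\<close>

definition height :: "nat \<Rightarrow> nat" where
  "height a = h (Suc a div 2)"

text \<open>The roots applied before column \<open>a\<close> is recorded. A column with odd code is
  recorded after the \<Gamma>_r of its pair; \<open>a = 0\<close> yields the whole chain.\<close>

definition chain_before :: "nat \<Rightarrow> root list" where
  "chain_before a = Gamma_above n \<mu> (Suc a div 2) @ (if even a then [] else Gamma_r (height a))"

text \<open>The roots between column \<open>a\<close> and its right neighbour
  \<open>a - 1\<close>.\<close>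

definition segment :: "nat \<Rightarrow> root list" where
  "segment a = (if even a then Gamma_r (height a) else Gamma_l n (height a))"

definition start :: "nat \<Rightarrow> nat" where
  "start a = length (chain_before a)"

definition ups :: "nat \<Rightarrow> nat \<Rightarrow> root list" where
  "ups s t = map ((!) chain) (filter (\<lambda>p. p \<in> negs) [s..<t])"

definition entry :: "nat \<Rightarrow> nat \<Rightarrow> letter" where
  "entry l a = prod_at (start a) (Plain l)"

text \<open>Half the length of row \<open>l\<close> of the filling, computed from the column
  heights; for a partition and \<open>1 \<le> l \<le> n\<close> it is the \<open>l\<close>-th
  part.\<close>

definition row_length :: "nat \<Rightarrow> nat" where
  "row_length l = card {j\<in>{1..M}. l \<le> h j}"

lemma h_le: "h j \<le> n"
  using conj_part_le_length[of \<mu> j] len_mu by simp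

lemma height_le: "height a \<le> n"
  by (simp add: height_def h_le)

lemma height_antimono: "a \<le> b \<Longrightarrow> height b \<le> height a"
  unfolding height_def by (intro conj_part_antimono div_le_mono) simp

lemma row_length_iff:
  assumes "1 \<le> j" "j \<le> M"
  shows "l \<le> h j \<longleftrightarrow> j \<le> row_length l"
proof -
  let ?S = "{j\<in>{1..M}. l \<le> h j}"
  show ?thesis
  proof
    assume "l \<le> h j"
    then have "{1..j} \<subseteq> ?S" using assms conj_part_antimono[of _ j \<mu>] by fastforce
    from card_mono[OF _ this] show "j \<le> row_length l" by (simp add: row_length_def)
  next
    assume j: "j \<le> row_length l"
    show "l \<le> h j"
    proof (rule ccontr)
      assume "\<not> l \<le> h j"
      then have "?S \<subseteq> {1..<j}" using conj_part_antimono[of j _ \<mu>] by (force simp: not_le)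
      from card_mono[OF _ this] have "row_length l \<le> j - 1" by (simp add: row_length_def)
      then show False using j assms by simp
    qed
  qed
qed

lemma row_length_le: "row_length l \<le> M"
proof -
  have "card {j\<in>{1..M}. l \<le> h j} \<le> card {1..M}" by (rule card_mono) auto
  then show ?thesis by (simp add: row_length_def)
qed

lemma le_height_iff:
  assumes "1 \<le> a" "a \<le> 2 * M"
  shows "l \<le> height a \<longleftrightarrow> a \<le> 2 * row_length l"
proof -
  have "1 \<le> Suc a div 2" "Suc a div 2 \<le> M" using assms by auto
  from row_length_iff[OF this, of l] show ?thesis unfolding height_def by auto
qed

lemma chain_before_0: "chain_before 0 = chain"
  by (simp add: chain_before_def Gamma_chain_def)

lemma chain_before_last: "chain_before (2 * M) = []"
  by (simp add: chain_before_def Gamma_above_last)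

lemma chain_before_step:
  assumes "1 \<le> a" "a \<le> 2 * M"
  shows "chain_before (a - 1) = chain_before a @ segment a"
proof (cases "even a")
  case True
  then obtain j where a: "a = 2 * j" by blast
  then have "1 \<le> j" using assms by simp
  then have "Suc (a - 1) div 2 = j" "Suc a div 2 = j" "odd (a - 1)" using a assms by auto
  then show ?thesis using True assms by (simp add: chain_before_def segment_def height_def)
next
  case False
  then obtain j where a: "a = 2 * j + 1" using oddE by blast
  then have "Suc (a - 1) div 2 = j" "Suc a div 2 = Suc j" "even (a - 1)" by auto
  moreover have "Gamma_above n \<mu> j = Gamma_above n \<mu> (Suc j) @ Gamma_r (h (Suc j)) @ Gamma_l n (h (Suc j))"
    using Gamma_above_step[of "Suc j" \<mu> n] a assms by simp
  ultimately show ?thesis using False by (simp add: chain_before_def segment_def height_def)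
qed

lemma segment_roots: "set (segment a) \<subseteq> positive_roots n"
  using Gamma_l_roots[OF height_le] Gamma_r_roots[OF height_le] by (simp add: segment_def)

lemma chain_before_prefix:
  assumes "a \<le> 2 * M"
  shows "\<exists>B. chain = chain_before a @ B"
  using assms
proof (induction a)
  case 0
  then show ?case by (simp add: chain_before_0)
next
  case (Suc a)
  then show ?case using chain_before_step[of "Suc a"] by auto
qed

lemma take_start: "a \<le> 2 * M \<Longrightarrow> take (start a) chain = chain_before a"
  using chain_before_prefix[of a] by (auto simp: start_def)

lemma start_step: "1 \<le> a \<Longrightarrow> a \<le> 2 * M \<Longrightarrow> start (a - 1) = start a + length (segment a)"
  using chain_before_step[of a] by (simp add: start_def)

lemma take_drop_segment:
  assumes "1 \<le> a" "a \<le> 2 * M"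
  shows "take (start (a - 1) - start a) (drop (start a) chain) = segment a"
proof -
  have "a - 1 \<le> 2 * M" using assms by simp
  then obtain B where "chain = chain_before (a - 1) @ B" using chain_before_prefix by blast
  then have "chain = chain_before a @ segment a @ B" using chain_before_step[OF assms] by simp
  then show ?thesis using start_step[OF assms] by (simp add: start_def)
qed

lemma chain_roots: "set chain \<subseteq> positive_roots n"
proof -
  have "set (chain_before (2 * M - d)) \<subseteq> positive_roots n" if "d \<le> 2 * M" for d
    using that
  proof (induction d)
    case 0
    then show ?case by (simp add: chain_before_last)
  next
    case (Suc d)
    have "chain_before (2 * M - Suc d) = chain_before (2 * M - d) @ segment (2 * M - d)"
      using chain_before_step[of "2 * M - d"] Suc.prems by simp
    then show ?case using Suc segment_roots by simp
  qed
  from this[of "2 * M"] show ?thesis by (simp add: chain_before_0)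
qed

lemma w_signed: "w \<in> signed_perms n" and J_subset: "J \<subseteq> {..<length chain}"
  using extremal by (auto simp: folding_pairs_bar_def folding_pairs_def)

lemma end_length: "len n (win (fold_end chain w J)) = 0"
  and step_ok: "p \<in> J \<Longrightarrow> p \<in> negs \<and> up_ok n (seq_at p) (chain ! p) \<or> p \<notin> negs \<and> down_ok n (seq_at p) (chain ! p)"
  using extremal_folding[OF w_signed chain_roots J_subset] extremal
  by (auto simp: folding_pairs_bar_def seq_at_def prod_at_def)

lemma prod_at_signed: "prod_at p \<in> signed_perms n"
  unfolding prod_at_def
  by (rule signed_perms_act[OF w_signed]) (meson chain_roots order_trans set_nths_subset set_take_subset)

lemma signed_seq_at: "signed_seq n (seq_at p)"
  unfolding seq_at_def by (rule signed_seq_win[OF prod_at_signed])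

lemma seq_at_Suc:
  assumes "p < length chain"
  shows "seq_at (Suc p) = (if p \<in> J then cact (seq_at p) (chain ! p) else seq_at p)"
proof -
  have "prod_at (Suc p) = (if p \<in> J then prod_at p \<circ> reflection (chain ! p) else prod_at p)"
    unfolding prod_at_def nths_take_Suc[OF assms] by (simp add: act_append) (simp add: act_def)
  moreover have "win (prod_at p \<circ> reflection (chain ! p)) = cact (win (prod_at p)) (chain ! p)"
  proof (rule win_reflection)
    show "prod_at p (bar x) = bar (prod_at p x)" for x by (rule signed_perms_bar[OF prod_at_signed])
    show "chain ! p \<in> positive_roots n" using chain_roots assms by auto
  qed
  ultimately show ?thesis by (simp add: seq_at_def)
qed

lemma negs_subset: "negs \<subseteq> J"
  by (auto simp: negative_foldings_def)

section \<open>Segments as extremal paths between neighbouring columns\<close>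

lemma path_ups_between:
  assumes "s \<le> t" "t \<le> length chain"
  shows "path n (take (t - s) (drop s chain)) (seq_at s) (ups s t) (seq_at t)"
  using assms
proof (induction t rule: dec_induct)
  case base
  then show ?case by (simp add: ups_def path.Nil)
next
  case (step t)
  have t: "t < length chain" using step by simp
  have "take (Suc t - s) (drop s chain) = take (t - s) (drop s chain) @ [chain ! t]"
    using step t by (simp add: Suc_diff_le take_Suc_conv_app_nth)
  moreover have "ups s (Suc t) = ups s t @ (if t \<in> negs then [chain ! t] else [])"
    using step by (simp add: ups_def)
  moreover have "path n [chain ! t] (seq_at t) (if t \<in> negs then [chain ! t] else []) (seq_at (Suc t))"
    using step_ok[of t] negs_subset
    by (auto simp: seq_at_Suc[OF t] intro: path.intros)
  ultimately show ?case using path_appendI[OF step.IH] t by simp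
qed

abbreviation "segment_ups a \<equiv> ups (start a) (start (a - 1))"

lemma start_le: "a \<le> 2 * M \<Longrightarrow> start a \<le> length chain"
  using chain_before_prefix[of a] by (auto simp: start_def)

lemma segment_path:
  assumes "1 \<le> a" "a \<le> 2 * M"
  shows "path n (segment a) (seq_at (start a)) (segment_ups a) (seq_at (start (a - 1)))"
proof -
  have "a - 1 \<le> 2 * M" using assms by simp
  from path_ups_between[OF _ start_le[OF this], of "start a"] show ?thesis
    unfolding take_drop_segment[OF assms] using start_step[OF assms] by simp
qed

lemma segment_greedy:
  assumes "1 \<le> a" "a \<le> 2 * M" "1 \<le> l" "l \<le> height a"
  shows "greedy (seq_at (start a) l) (seq_at (start (a - 1)) l) (seq_at (start a) ` {l<..height a})
    (row_ups l (segment_ups a))"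
proof (cases "even a")
  case True
  then have P: "path n (Gamma_r (height a)) (seq_at (start a)) (segment_ups a) (seq_at (start (a - 1)))"
    using segment_path[OF assms(1,2)] by (simp add: segment_def)
  show ?thesis
    using Gamma_r_greedy[OF P signed_seq_at assms(3,4) height_le] Gamma_r_no_ups[OF P] by simp
next
  case False
  then have P: "path n (Gamma_l n (height a)) (seq_at (start a)) (segment_ups a) (seq_at (start (a - 1)))"
    using segment_path[OF assms(1,2)] by (simp add: segment_def)
  show ?thesis
    by (rule Gamma_l_greedy[OF P signed_seq_at assms(3,4) height_le])
qed

lemma segment_ups_even:
  assumes "1 \<le> a" "a \<le> 2 * M" "even a"
  shows "segment_ups a = []"
proof (rule Gamma_r_no_ups)
  show "path n (Gamma_r (height a)) (seq_at (start a)) (segment_ups a) (seq_at (start (a - 1)))"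
    using segment_path[OF assms(1,2)] assms(3) by (simp add: segment_def)
qed

lemma entry_less_iff: "entry l a < entry m b \<longleftrightarrow> seq_at (start a) l < seq_at (start b) m"
  and entry_le_iff: "entry l a \<le> entry m b \<longleftrightarrow> seq_at (start a) l \<le> seq_at (start b) m"
  by (simp_all add: entry_def seq_at_def win_def val_less_iff val_le_iff)

lemma row_ups_descent:
  assumes "1 \<le> a" "Suc a \<le> 2 * M" "1 \<le> l" "l \<le> height (Suc a)"
  shows "row_ups l (segment_ups (Suc a)) = of_bool (entry l (Suc a) < entry l a)"
  using segment_greedy[of "Suc a" l] assms by (auto simp: greedy_def entry_less_iff)

text \<open>Segment \<open>Suc a\<close> starts at column \<open>Suc a\<close>, so its greedy
  property is the rule for selecting label \<open>Suc a\<close> after label \<open>a\<close>: the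
  candidates are the entries from row \<open>l\<close> on, those of the rows above having been
  removed.\<close>

lemma entry_step:
  assumes "1 \<le> a" "Suc a \<le> 2 * M" "1 \<le> l" "l < m" "m \<le> height (Suc a)"
  shows "if entry l a \<le> entry l (Suc a) then entry m (Suc a) < entry l a \<or> entry l (Suc a) < entry m (Suc a)
       else entry l (Suc a) < entry m (Suc a) \<and> entry m (Suc a) < entry l a"
proof -
  have m: "seq_at (start (Suc a)) m \<in> seq_at (start (Suc a)) ` {l<..height (Suc a)}" using assms by simp
  show ?thesis
    using segment_greedy[of "Suc a" l] assms bspec[OF _ m]
    unfolding greedy_def entry_less_iff entry_le_iff by (auto simp: not_le)
qed

lemma end_entry:
  assumes "1 \<le> l" "l \<le> n"
  shows "seq_at (start 0) l = val (Plain l)"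
proof -
  have "prod_at (start 0) = fold_end chain w J"
    by (simp add: prod_at_def start_def chain_before_0 fold_end_def)
  then show ?thesis
    using len_0_identity[OF prod_at_signed[of "start 0"] _ assms] end_length by (simp add: seq_at_def)
qed

text \<open>The last segment ends at the identity, which forces the rightmost column to increase.\<close>

lemma first_column_aux:
  assumes M: "1 \<le> M" and "1 \<le> l" "l \<le> height 1"
  shows "\<forall>m. l \<le> m \<and> m \<le> height 1 \<longrightarrow> Plain l \<le> entry m 1"
    and "row_ups l (segment_ups 1) = 0" and "\<forall>m. l < m \<and> m \<le> height 1 \<longrightarrow> entry l 1 < entry m 1"
proof -
  have n: "height 1 \<le> n" by (rule height_le)
  \<comment> \<open>Row \<open>l\<close> ends at \<open>Plain l\<close>, and no entry from row
    \<open>l\<close> on is smaller. So the way up from \<open>Plain l\<close> to the entry of row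
    \<open>l\<close> does not wrap, and since it meets no entry of a lower row, all of these are
    larger.\<close>
  have rest: "row_ups l (segment_ups 1) = 0 \<and> Plain l \<le> entry l 1 \<and> (\<forall>m. l < m \<and> m \<le> height 1 \<longrightarrow> entry l 1 < entry m 1)"
    if l: "1 \<le> l" "l \<le> height 1" and ge: "\<forall>m. l \<le> m \<and> m \<le> height 1 \<longrightarrow> Plain l \<le> entry m 1" for l
  proof -
    let ?c = "seq_at (start 1)"
    have c: "?c m = val (entry m 1)" for m by (simp add: entry_def seq_at_def win_def)
    have g: "greedy (?c l) (val (Plain l)) (?c ` {l<..height 1}) (row_ups l (segment_ups 1))"
      using segment_greedy[of 1 l] M l n end_entry[of l] by simp
    have le: "val (Plain l) \<le> ?c m" if "l \<le> m" "m \<le> height 1" for m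
      unfolding c val_le_iff using ge that by blast
    have "\<not> ?c l < val (Plain l)" using le[of l] l by simp
    then have e: "row_ups l (segment_ups 1) = 0" and gap: "\<And>y. y \<in> ?c ` {l<..height 1} \<Longrightarrow> \<not> (val (Plain l) \<le> y \<and> y \<le> ?c l)"
      using g by (auto simp: greedy_def)
    have "entry l 1 < entry m 1" if m: "l < m" "m \<le> height 1" for m
      using gap[of "?c m"] le[of m] m unfolding entry_less_iff by auto
    then show ?thesis using e ge l by auto
  qed
  have "\<forall>m. l \<le> m \<and> m \<le> height 1 \<longrightarrow> Plain l \<le> entry m 1"
    using assms(2,3)
  proof (induction l rule: nat_induct_at_least)
    case base
    have "Plain 1 \<le> entry m 1" if "1 \<le> m" "m \<le> height 1" for m
    proof -
      have "entry m 1 \<in> letters n"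
        unfolding entry_def by (rule signed_perms_letters[OF prod_at_signed]) (use that n in \<open>simp add: letters_def\<close>)
      then show ?thesis by (auto simp: letters_def)
    qed
    then show ?case by blast
  next
    case (Suc l)
    then have IH: "\<forall>m. l \<le> m \<and> m \<le> height 1 \<longrightarrow> Plain l \<le> entry m 1" by simp
    have l: "1 \<le> l" "l \<le> height 1" using Suc by auto
    show ?case using rest[OF l IH] by (meson Suc_le_eq val_Suc_le order_le_less_trans)
  qed
  then show "\<forall>m. l \<le> m \<and> m \<le> height 1 \<longrightarrow> Plain l \<le> entry m 1"
    and "row_ups l (segment_ups 1) = 0" and "\<forall>m. l < m \<and> m \<le> height 1 \<longrightarrow> entry l 1 < entry m 1"
    using rest[OF assms(2,3)] by auto
qed

section \<open>Affine levels of the negative foldings\<close>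

lemma count_before:
  assumes \<beta>: "\<beta> \<in> set (Gamma_l n (height a))" "up_ok n c \<beta>" and a: "1 \<le> a" "a \<le> 2 * M" "odd a"
  obtains l where "fst \<beta> = Plain l" "1 \<le> l" "l \<le> height a"
    "count_list (chain_before a) \<beta> = row_length l - Suc a div 2" "count_list (segment a) \<beta> = 1"
proof -
  let ?j = "Suc a div 2"
  have j: "1 \<le> ?j" "?j \<le> M" using a by (auto elim!: oddE)
  obtain l where l: "fst \<beta> = Plain l" "1 \<le> l" "l \<le> height a" "count_list (Gamma_l n (height a)) \<beta> = of_bool (l \<le> height a)"
      "count_list (Gamma_r (height a)) \<beta> = 0"
    by (rule count_Gamma_l[OF \<beta> order_refl])
  \<comment> \<open>Columns further left are no higher, so each earlier pair contains \<beta> once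
    or not at all, according to whether it reaches row \<open>l\<close>.\<close>
  have c: "count_list (Gamma_r (h i) @ Gamma_l n (h i)) \<beta> = of_bool (l \<le> h i)" if "?j \<le> i" for i
  proof -
    have "h i \<le> height a" unfolding height_def by (rule conj_part_antimono[OF that])
    then obtain l' where "fst \<beta> = Plain l'" "count_list (Gamma_l n (h i)) \<beta> = of_bool (l' \<le> h i)"
      "count_list (Gamma_r (h i)) \<beta> = 0"
      by (rule count_Gamma_l[OF \<beta>])
    then show ?thesis using l(1) by simp
  qed
  have "count_list (Gamma_above n \<mu> ?j) \<beta>
      = (\<Sum>i\<leftarrow>rev [Suc ?j..<Suc M]. count_list (Gamma_r (h i) @ Gamma_l n (h i)) \<beta>)"
    unfolding Gamma_above_def count_list_concat map_map comp_def ..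
  also have "\<dots> = (\<Sum>i\<leftarrow>rev [Suc ?j..<Suc M]. of_bool (l \<le> h i))"
    by (intro arg_cong[of _ _ sum_list] map_cong refl c) (simp del: upt_Suc)
  also have "\<dots> = (\<Sum>i\<in>{Suc ?j..M}. of_bool (l \<le> h i))"
  proof -
    have "distinct (rev [Suc ?j..<Suc M])" "set (rev [Suc ?j..<Suc M]) = {Suc ?j..M}" by auto
    then show ?thesis by (simp only: sum_list_distinct_conv_sum_set)
  qed
  also have "\<dots> = (\<Sum>i\<in>{Suc ?j..M}. of_bool (i \<le> row_length l))"
    by (intro sum.cong refl) (use row_length_iff[of _ l] j in auto)
  also have "\<dots> = card ({Suc ?j..M} \<inter> {i. i \<le> row_length l})"
    by (simp add: of_bool_def sum.If_cases)
  also have "{Suc ?j..M} \<inter> {i. i \<le> row_length l} = {Suc ?j..row_length l}"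
    using row_length_le[of l] by auto
  finally have "count_list (Gamma_above n \<mu> ?j) \<beta> = row_length l - ?j" by simp
  then have "count_list (chain_before a) \<beta> = row_length l - ?j"
    using a(3) l(5) by (simp add: chain_before_def)
  moreover have "count_list (segment a) \<beta> = 1" using a(3) l(3,4) by (simp add: segment_def)
  ultimately show thesis using that l(1-3) by blast
qed

text \<open>The root occurs once for every earlier pair that reaches row \<open>l\<close>, and once
  in its own segment; the latter is the summand \<open>1\<close>.\<close>

lemma affine_level_neg:
  assumes a: "1 \<le> a" "a \<le> 2 * M" and p: "p \<in> negs" "start a \<le> p" "p < start (a - 1)"
  obtains l where "fst (chain ! p) = Plain l" "1 \<le> l" "l \<le> height a" "odd a"
    "affine_level chain p = row_length l + 1 - Suc a div 2"
proof -
  have mem: "chain ! p \<in> set (segment_ups a)" using p by (auto simp: ups_def)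
  then have odd: "odd a" using segment_ups_even[OF a] by auto
  from path_ups[OF segment_path[OF a] mem] obtain c where
    \<beta>: "chain ! p \<in> set (Gamma_l n (height a))" "up_ok n c (chain ! p)"
    using odd by (auto simp: segment_def)
  obtain l where l: "fst (chain ! p) = Plain l" "1 \<le> l" "l \<le> height a"
    "count_list (chain_before a) (chain ! p) = row_length l - Suc a div 2" "count_list (segment a) (chain ! p) = 1"
    by (rule count_before[OF \<beta> a odd])
  have le: "a - 1 \<le> 2 * M" using a by simp
  have plen: "p < length chain" using p(3) start_le[OF le] by simp
  obtain B where "chain = chain_before (a - 1) @ B" using chain_before_prefix[OF le] by blast
  then have ch: "chain = chain_before a @ segment a @ B" using chain_before_step[OF a] by simp
  define q where "q = p - start a"
  have q: "q < length (segment a)" "p = start a + q" using p start_step[OF a] by (auto simp: q_def)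
  have nth: "chain ! p = segment a ! q" using q by (subst ch) (simp add: start_def nth_append)
  have "take (Suc p) chain = chain_before a @ take (Suc q) (segment a)"
    using q by (subst ch) (simp add: start_def)
  then have "affine_level chain p = row_length l - Suc a div 2 + count_list (take (Suc q) (segment a)) (chain ! p)"
    unfolding affine_level_count[OF plen] using l(4) by simp
  moreover have "count_list (take (Suc q) (segment a)) (chain ! p) = 1"
  proof -
    have "chain ! p \<in> set (take (Suc q) (segment a))"
      unfolding nth using q by (simp add: take_Suc_conv_app_nth)
    then have "count_list (take (Suc q) (segment a)) (chain ! p) \<noteq> 0" by (simp add: count_list_0_iff)
    moreover have "count_list (take (Suc q) (segment a)) (chain ! p) + count_list (drop (Suc q) (segment a)) (chain ! p) = 1"
      using l(5) by (metis append_take_drop_id count_list_append)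
    ultimately show ?thesis by simp
  qed
  moreover have "Suc a div 2 \<le> row_length l" using le_height_iff[OF a, of l] l(3) by simp
  ultimately have "affine_level chain p = row_length l + 1 - Suc a div 2" by simp
  with that l(1-3) odd show thesis by blast
qed

lemma segment_ups_row:
  assumes "1 \<le> a" "a \<le> 2 * M" "\<beta> \<in> set (segment_ups a)"
  shows "\<exists>l. fst \<beta> = Plain l \<and> 1 \<le> l \<and> l \<le> height a"
proof -
  from assms(3) obtain p where "\<beta> = chain ! p" "p \<in> negs" "start a \<le> p" "p < start (a - 1)"
    by (auto simp: ups_def)
  then show ?thesis using affine_level_neg[OF assms(1,2)] by metis
qed

lemma segment_level:
  assumes "1 \<le> a" "a \<le> 2 * M"
  shows "(\<Sum>p\<in>negs \<inter> {start a..<start (a - 1)}. affine_level chain p)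
    = (\<Sum>l\<in>{1..n}. row_ups l (segment_ups a) * (row_length l + 1 - Suc a div 2))"
proof -
  let ?F = "\<lambda>l. row_length l + 1 - Suc a div 2"
  have "(\<Sum>p\<in>negs \<inter> {start a..<start (a - 1)}. affine_level chain p)
      = (\<Sum>p\<in>negs \<inter> {start a..<start (a - 1)}. ?F (absval (fst (chain ! p))))"
  proof (rule sum.cong[OF refl])
    fix p assume "p \<in> negs \<inter> {start a..<start (a - 1)}"
    then have "p \<in> negs" "start a \<le> p" "p < start (a - 1)" by auto
    from affine_level_neg[OF assms this]
    show "affine_level chain p = ?F (absval (fst (chain ! p)))" by (metis absval.simps(1))
  qed
  also have "\<dots> = (\<Sum>p\<leftarrow>filter (\<lambda>p. p \<in> negs) [start a..<start (a - 1)]. ?F (absval (fst (chain ! p))))"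
    by (subst sum_list_distinct_conv_sum_set) (auto intro!: sum.cong)
  also have "\<dots> = (\<Sum>\<beta>\<leftarrow>segment_ups a. ?F (absval (fst \<beta>)))"
    by (simp add: ups_def comp_def)
  also have "\<dots> = (\<Sum>l\<in>{1..n}. row_ups l (segment_ups a) * ?F l)"
  proof (rule sum_list_rows)
    fix \<beta> assume "\<beta> \<in> set (segment_ups a)"
    then show "\<exists>l. fst \<beta> = Plain l \<and> 1 \<le> l \<and> l \<le> n"
      using segment_ups_row[OF assms] height_le[of a] by (meson order_trans)
  qed
  finally show ?thesis .
qed

lemma level_segments: "level n \<mu> w J = (\<Sum>a\<in>{1..2 * M}. \<Sum>p\<in>negs \<inter> {start a..<start (a - 1)}. affine_level chain p)"
proof -
  have "(\<Sum>p\<in>negs \<inter> {..<start (2 * M - d)}. affine_level chain p)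
      = (\<Sum>a\<in>{2 * M - d<..2 * M}. \<Sum>p\<in>negs \<inter> {start a..<start (a - 1)}. affine_level chain p)"
    if "d \<le> 2 * M" for d
    using that
  proof (induction d)
    case 0
    then show ?case by (simp add: start_def chain_before_last)
  next
    case (Suc d)
    define a where "a = 2 * M - d"
    have a: "1 \<le> a" "a \<le> 2 * M" "2 * M - Suc d = a - 1" using Suc.prems by (auto simp: a_def)
    have un: "negs \<inter> {..<start (a - 1)} = (negs \<inter> {..<start a}) \<union> (negs \<inter> {start a..<start (a - 1)})"
      using start_step[OF a(1,2)] by auto
    have fin: "finite (negs \<inter> {..<start a})" "finite (negs \<inter> {start a..<start (a - 1)})" by simp_all
    have disj: "(negs \<inter> {..<start a}) \<inter> (negs \<inter> {start a..<start (a - 1)}) = {}" by auto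
    have "(\<Sum>p\<in>negs \<inter> {..<start (a - 1)}. affine_level chain p) =
      (\<Sum>p\<in>negs \<inter> {..<start a}. affine_level chain p) + (\<Sum>p\<in>negs \<inter> {start a..<start (a - 1)}. affine_level chain p)"
      unfolding un by (rule sum.union_disjoint[OF fin disj])
    moreover have "{a - 1<..2 * M} = insert a {a<..2 * M}" using a by auto
    ultimately show ?case using Suc a unfolding a_def[symmetric] by simp
  qed
  from this[of "2 * M"] have "(\<Sum>p\<in>negs \<inter> {..<start 0}. affine_level chain p)
      = (\<Sum>a\<in>{0<..2 * M}. \<Sum>p\<in>negs \<inter> {start a..<start (a - 1)}. affine_level chain p)" by simp
  moreover have "negs \<inter> {..<start 0} = negs"
    using negs_subset J_subset by (auto simp: start_def chain_before_0)
  moreover have "{0<..2 * M} = {1..2 * M}" by auto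
  ultimately show ?thesis by (simp add: level_def)
qed

text \<open>Records descents from label \<open>j + 1\<close> to label \<open>j'\<close>, with codes
  \<open>Suc (2 * j)\<close> and \<open>2 * j\<close>; by \<open>descent_even\<close> there are none
  inside a pair.\<close>

definition row_descents :: "nat \<Rightarrow> nat set" where
  "row_descents l = {j. 1 \<le> j \<and> j < row_length l \<and> entry l (Suc (2 * j)) < entry l (2 * j)}"

lemma finite_row_descents [simp]: "finite (row_descents l)"
  by (rule finite_subset[of _ "{..<row_length l}"]) (auto simp: row_descents_def)

text \<open>Segment \<open>1\<close> does not go up because it ends at the identity, and even
  segments are of type \<Gamma>_r. In the others, row \<open>l\<close> goes up exactly at a
  descent.\<close>

lemma row_ups_segment:
  assumes "1 \<le> a" "a \<le> 2 * M" "1 \<le> l"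
  shows "row_ups l (segment_ups a) = of_bool (a \<in> (\<lambda>j. Suc (2 * j)) ` row_descents l)"
proof (cases "l \<le> height a")
  case False
  have "fst \<beta> \<noteq> Plain l" if "\<beta> \<in> set (segment_ups a)" for \<beta>
    using segment_ups_row[OF assms(1,2) that] False by auto
  then have "row_ups l (segment_ups a) = 0" by (rule row_ups_0)
  moreover have "a \<notin> (\<lambda>j. Suc (2 * j)) ` row_descents l"
    using False le_height_iff[OF assms(1,2)] by (auto simp: row_descents_def)
  ultimately show ?thesis by simp
next
  case True
  then have al: "a \<le> 2 * row_length l" using le_height_iff[OF assms(1,2)] by simp
  consider "a = 1" | "even a" | j where "a = Suc (2 * j)" "1 \<le> j"
    using assms(1) by (metis One_nat_def Suc_eq_plus1 add_0 less_one not_less oddE mult_0_right)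
  then show ?thesis
  proof cases
    case 1
    then have "row_ups l (segment_ups a) = 0"
      using first_column_aux(2)[of l] True assms by auto
    then show ?thesis using 1 by (auto simp: row_descents_def)
  next
    case 2
    then have "segment_ups a = []" using segment_ups_even assms by blast
    then show ?thesis using 2 by auto
  next
    case (3 j)
    have "row_ups l (segment_ups a) = of_bool (entry l (Suc (2 * j)) < entry l (2 * j))"
      unfolding 3(1) by (rule row_ups_descent) (use 3 True assms in auto)
    moreover have "a \<in> (\<lambda>j. Suc (2 * j)) ` row_descents l \<longleftrightarrow> entry l (Suc (2 * j)) < entry l (2 * j)"
      using 3 al by (auto simp: row_descents_def)
    ultimately show ?thesis by simp
  qed
qed

lemma level_row_descents:
  "level n \<mu> w J = (\<Sum>l\<in>{1..n}. \<Sum>j\<in>row_descents l. row_length l - j)"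
proof -
  have "level n \<mu> w J = (\<Sum>a\<in>{1..2 * M}. \<Sum>l\<in>{1..n}.
      of_bool (a \<in> (\<lambda>j. Suc (2 * j)) ` row_descents l) * (row_length l + 1 - Suc a div 2))"
    unfolding level_segments
  proof (rule sum.cong[OF refl])
    fix a assume "a \<in> {1..2 * M}"
    then have a: "1 \<le> a" "a \<le> 2 * M" by auto
    show "(\<Sum>p\<in>negs \<inter> {start a..<start (a - 1)}. affine_level chain p) = (\<Sum>l\<in>{1..n}.
      of_bool (a \<in> (\<lambda>j. Suc (2 * j)) ` row_descents l) * (row_length l + 1 - Suc a div 2))"
      unfolding segment_level[OF a] by (rule sum.cong[OF refl]) (simp only: row_ups_segment[OF a] atLeastAtMost_iff)
  qed
  also have "\<dots> = (\<Sum>l\<in>{1..n}. \<Sum>a\<in>{1..2 * M}.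
      of_bool (a \<in> (\<lambda>j. Suc (2 * j)) ` row_descents l) * (row_length l + 1 - Suc a div 2))"
    by (rule sum.swap)
  also have "\<dots> = (\<Sum>l\<in>{1..n}. \<Sum>j\<in>row_descents l. row_length l - j)"
  proof (rule sum.cong[OF refl])
    fix l
    let ?I = "(\<lambda>j. Suc (2 * j)) ` row_descents l"
    have sub: "?I \<subseteq> {1..2 * M}" using row_length_le[of l] by (auto simp: row_descents_def)
    have "(\<Sum>a\<in>{1..2 * M}. of_bool (a \<in> ?I) * (row_length l + 1 - Suc a div 2))
        = (\<Sum>a\<in>?I. row_length l + 1 - Suc a div 2)"
      by (rule sum.mono_neutral_cong_right) (use sub in auto)
    \<comment> \<open>For \<open>a = Suc (2 * j)\<close> the pair number \<open>Suc a div 2\<close>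
      is \<open>j + 1\<close>, so the summand \<open>1\<close> cancels.\<close>
    also have "\<dots> = (\<Sum>j\<in>row_descents l. row_length l + 1 - Suc (Suc (2 * j)) div 2)"
      by (rule sum.reindex_cong[of "\<lambda>j. Suc (2 * j)"]) (auto simp: inj_on_def)
    finally show "(\<Sum>a\<in>{1..2 * M}. of_bool (a \<in> ?I) * (row_length l + 1 - Suc a div 2))
        = (\<Sum>j\<in>row_descents l. row_length l - j)" by simp
  qed
  finally show ?thesis .
qed

section \<open>Descents and arms of the filling\<close>

abbreviation "\<sigma> \<equiv> filling_map n \<mu> w J"

definition column :: "nat \<Rightarrow> letter list" where
  "column a = map (\<lambda>i. entry i a) [1..<Suc (height a)]"

lemma filling_columns: "\<sigma> = map column (rev [1..<Suc (2 * M)])"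
proof -
  have "\<sigma> = map (\<lambda>a. if even a then column_r n \<mu> w J (Suc a div 2) else column_l n \<mu> w J (Suc a div 2))
      (rev [1..<Suc (2 * M)])"
    unfolding filling_map_def by (rule concat_pairs)
  also have "\<dots> = map column (rev [1..<Suc (2 * M)])"
  proof (rule map_cong[OF refl])
    fix a assume "a \<in> set (rev [1..<Suc (2 * M)])"
    then have a: "1 \<le> a" "a \<le> 2 * M" by auto
    have "column a = word_prefix (act w (nths (chain_before a) J)) (height a)"
      unfolding column_def word_prefix_def entry_def prod_at_def take_start[OF a(2)] ..
    then show "(if even a then column_r n \<mu> w J (Suc a div 2) else column_l n \<mu> w J (Suc a div 2)) = column a"
      by (simp add: column_r_def column_l_def chain_before_def height_def)
  qed
  finally show ?thesis .
qed

lemma length_filling: "length \<sigma> = 2 * M"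
  by (simp add: filling_columns del: upt_Suc)

lemma filling_nth: "c < 2 * M \<Longrightarrow> \<sigma> ! c = column (2 * M - c)"
  by (simp add: filling_columns rev_nth Suc_diff_Suc del: upt_Suc)

lemma length_column: "length (column a) = height a"
  by (simp add: column_def del: upt_Suc)

lemma column_nth: "i < height a \<Longrightarrow> column a ! i = entry (Suc i) a"
  by (simp add: column_def del: upt_Suc)

text \<open>Row \<open>Suc i\<close> consists of the codes \<open>1\<close> to
  \<open>2 * row_length (Suc i)\<close>, and those greater than \<open>a\<close> lie to the left.
  Rows count from \<open>0\<close> in the filling and from \<open>1\<close> in
  \<open>entry\<close>.\<close>

lemma arm_column:
  assumes "1 \<le> a" "a \<le> 2 * M"
  shows "arm \<sigma> (i, 2 * M - a) = 2 * row_length (Suc i) - a"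
proof -
  have "{d. d < 2 * M - a \<and> i < length (\<sigma> ! d)} = {2 * M - 2 * row_length (Suc i)..<2 * M - a}"
  proof (intro equalityI subsetI)
    fix d assume "d \<in> {d. d < 2 * M - a \<and> i < length (\<sigma> ! d)}"
    then have d: "d < 2 * M - a" "Suc i \<le> height (2 * M - d)" by (auto simp: filling_nth length_column)
    then have "2 * M - d \<le> 2 * row_length (Suc i)" using le_height_iff[of "2 * M - d" "Suc i"] by simp
    then show "d \<in> {2 * M - 2 * row_length (Suc i)..<2 * M - a}" using d by auto
  next
    fix d assume d: "d \<in> {2 * M - 2 * row_length (Suc i)..<2 * M - a}"
    then have "2 * M - d \<le> 2 * row_length (Suc i)" by auto
    then have "Suc i \<le> height (2 * M - d)" using le_height_iff[of "2 * M - d" "Suc i"] d by auto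
    then show "d \<in> {d. d < 2 * M - a \<and> i < length (\<sigma> ! d)}" using d by (auto simp: filling_nth length_column)
  qed
  then show ?thesis using row_length_le[of "Suc i"] by (simp add: arm_def)
qed

lemma Des_columns:
  "(i, c) \<in> Des \<sigma> \<longleftrightarrow> 0 < c \<and> c < 2 * M \<and> Suc i \<le> height (Suc (2 * M - c)) \<and>
     entry (Suc i) (Suc (2 * M - c)) < entry (Suc i) (2 * M - c)"
proof (cases "0 < c \<and> c < 2 * M")
  case True
  then have "2 * M - (c - 1) = Suc (2 * M - c)" "c - 1 < 2 * M" by auto
  then have "\<sigma> ! c = column (2 * M - c)" "\<sigma> ! (c - 1) = column (Suc (2 * M - c))"
    using True filling_nth[of c] filling_nth[of "c - 1"] by simp_all
  moreover have "height (Suc (2 * M - c)) \<le> height (2 * M - c)" by (rule height_antimono) simp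
  ultimately show ?thesis
    using True by (auto simp: Des_def length_filling length_column column_nth)
qed (auto simp: Des_def length_filling)

lemma descent_even:
  assumes "1 \<le> a" "Suc a \<le> 2 * M" "1 \<le> l" "l \<le> height (Suc a)" "entry l (Suc a) < entry l a"
  shows "even a"
proof (rule ccontr)
  assume "odd a"
  then have "segment_ups (Suc a) = []" using segment_ups_even[of "Suc a"] assms by simp
  then show False using row_ups_descent[OF assms(1-4)] assms(5) by simp
qed

text \<open>A translation of coordinates: code \<open>2 * j\<close> is column
  \<open>2 * M - 2 * j\<close> from the left. Odd codes are excluded by
  \<open>descent_even\<close>.\<close>

lemma Des_row_descents:
  "Des \<sigma> = (\<lambda>(l, j). (l - 1, 2 * M - 2 * j)) ` (SIGMA l:{1..n}. row_descents l)"
proof (intro equalityI subsetI)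
  fix x assume "x \<in> Des \<sigma>"
  then obtain i c where x: "x = (i, c)" and D: "0 < c" "c < 2 * M" "Suc i \<le> height (Suc (2 * M - c))"
     "entry (Suc i) (Suc (2 * M - c)) < entry (Suc i) (2 * M - c)"
    by (cases x) (auto simp: Des_columns)
  define a where "a = 2 * M - c"
  have a: "1 \<le> a" "Suc a \<le> 2 * M" "c = 2 * M - a" using D by (auto simp: a_def)
  note D' = D(3,4)[folded a_def]
  have "even a" by (rule descent_even[OF a(1,2) _ D']) simp
  then obtain j where j: "a = 2 * j" by blast
  have "Suc a \<le> 2 * row_length (Suc i)"
    using le_height_iff[of "Suc a" "Suc i"] D'(1) a(2) by simp
  then have "j \<in> row_descents (Suc i)" using a(1) D'(2) unfolding j row_descents_def by auto
  moreover have "Suc i \<in> {1..n}" using D'(1) height_le[of "Suc a"] by auto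
  ultimately show "x \<in> (\<lambda>(l, j). (l - 1, 2 * M - 2 * j)) ` (SIGMA l:{1..n}. row_descents l)"
    using x a(3) j by (intro image_eqI[of _ _ "(Suc i, j)"]) auto
next
  fix x assume "x \<in> (\<lambda>(l, j). (l - 1, 2 * M - 2 * j)) ` (SIGMA l:{1..n}. row_descents l)"
  then obtain l j where l: "1 \<le> l" "l \<le> n" and j: "j \<in> row_descents l" and x: "x = (l - 1, 2 * M - 2 * j)" by auto
  have j': "1 \<le> j" "j < row_length l" "entry l (Suc (2 * j)) < entry l (2 * j)" using j by (auto simp: row_descents_def)
  have jM: "j < M" using j'(2) row_length_le[of l] by simp
  have "l \<le> height (Suc (2 * j))" using le_height_iff[of "Suc (2 * j)" l] j' jM by simp
  moreover have "2 * M - (2 * M - 2 * j) = 2 * j" using jM by simp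
  ultimately show "x \<in> Des \<sigma>" unfolding x Des_columns using l j' jM by simp
qed

lemma Des_sum_row_descents:
  "(\<Sum>c\<in>Des \<sigma>. arm \<sigma> c) = 2 * (\<Sum>l\<in>{1..n}. \<Sum>j\<in>row_descents l. row_length l - j)"
proof -
  have "inj_on (\<lambda>(l, j). (l - 1, 2 * M - 2 * j)) (SIGMA l:{1..n}. row_descents l)"
  proof (rule inj_onI, clarsimp)
    fix l j l' j' assume "Suc 0 \<le> l" "Suc 0 \<le> l'" "l - Suc 0 = l' - Suc 0" "j \<in> row_descents l" "j' \<in> row_descents l'"
      and e: "2 * M - 2 * j = 2 * M - 2 * j'"
    then have "l = l'" "j < M" "j' < M" using row_length_le[of l] row_length_le[of l'] by (auto simp: row_descents_def)
    then show "l = l' \<and> j = j'" using e by simp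
  qed
  then have "(\<Sum>c\<in>Des \<sigma>. arm \<sigma> c) = (\<Sum>(l, j)\<in>(SIGMA l:{1..n}. row_descents l). arm \<sigma> (l - 1, 2 * M - 2 * j))"
    unfolding Des_row_descents by (subst sum.reindex) (auto simp: case_prod_unfold)
  also have "\<dots> = (\<Sum>(l, j)\<in>(SIGMA l:{1..n}. row_descents l). 2 * (row_length l - j))"
  proof (intro sum.cong refl, clarsimp)
    fix l j assume "Suc 0 \<le> l" "j \<in> row_descents l"
    then have "1 \<le> j" "j < M" "l = Suc (l - 1)" using row_length_le[of l] by (auto simp: row_descents_def)
    then show "arm \<sigma> (l - Suc 0, 2 * M - 2 * j) = 2 * (row_length l - j)"
      using arm_column[of "2 * j" "l - 1"] by simp
  qed
  also have "\<dots> = (\<Sum>l\<in>{1..n}. \<Sum>j\<in>row_descents l. 2 * (row_length l - j))"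
    by (subst sum.Sigma) auto
  finally show ?thesis by (simp add: sum_distrib_left)
qed

section \<open>The charge word of the filling\<close>

lemma distinct_column: "distinct (column a)"
proof -
  have "inj (prod_at (start a))"
    using prod_at_signed[of "start a"] unfolding signed_perms_def by (blast intro: permutes_inj)
  then show ?thesis by (auto simp: column_def distinct_map entry_def simp del: upt_Suc intro!: inj_onI dest: injD)
qed

text \<open>The biletters are distinct, so the word depends only on their set, which sorting the
  columns does not change. They can therefore be grouped by the rows of the unsorted filling, which
  are the rows that charge selects.\<close>

lemma charge_word_rows:
  "charge_word2 (ord_filling \<sigma>) = label_word (row_set entry (\<lambda>l. 2 * row_length l) {1..n})"
proof -
  let ?\<tau> = "ord_filling \<sigma>"
  let ?f = "\<lambda>c. map (\<lambda>k. (k, column_label ?\<tau> c)) (?\<tau> ! c)"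
  let ?L = "concat (map ?f [0..<length ?\<tau>])"
  have len: "length ?\<tau> = 2 * M" by (simp add: ord_filling_def length_filling)
  have nth: "?\<tau> ! c = sort (column (2 * M - c))" "column_label ?\<tau> c = 2 * M - c" if "c < 2 * M" for c
    using that len by (simp_all add: ord_filling_def length_filling filling_nth column_label_def)
  have "distinct ?L"
  proof (rule distinct_concat_map)
    fix c assume "c \<in> set [0..<length ?\<tau>]"
    then show "distinct (?f c)" using len nth[of c] distinct_column by (simp add: distinct_map inj_on_def)
  next
    fix c d assume "c \<in> set [0..<length ?\<tau>]" "d \<in> set [0..<length ?\<tau>]" "c \<noteq> d"
    then have "column_label ?\<tau> c \<noteq> column_label ?\<tau> d" using len nth(2) by auto
    then show "set (?f c) \<inter> set (?f d) = {}" by auto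
  qed simp
  then have "sort ?L = sorted_list_of_set (set ?L)"
    unfolding sorted_list_of_set_sort_remdups by (simp add: distinct_remdups_id)
  moreover have "set ?L = row_set entry (\<lambda>l. 2 * row_length l) {1..n}"
  proof (intro equalityI subsetI)
    fix x assume "x \<in> set ?L"
    then obtain c k where c: "c < 2 * M" "k \<in> set (?\<tau> ! c)" "x = (k, column_label ?\<tau> c)"
      using len by auto
    define a where "a = 2 * M - c"
    have a: "1 \<le> a" "a \<le> 2 * M" using c(1) by (auto simp: a_def)
    obtain l where l: "1 \<le> l" "l \<le> height a" "x = (entry l a, a)"
      using c nth[OF c(1)] by (auto simp: column_def a_def)
    moreover have "l \<le> n" using l(2) height_le[of a] by simp
    ultimately show "x \<in> row_set entry (\<lambda>l. 2 * row_length l) {1..n}"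
      unfolding row_set_def l(3) using le_height_iff[OF a, of l] a l(1,2)
      by (intro UN_I[of l] image_eqI[of _ _ a]) auto
  next
    fix x assume "x \<in> row_set entry (\<lambda>l. 2 * row_length l) {1..n}"
    then obtain l a where l: "1 \<le> l" "1 \<le> a" "a \<le> 2 * row_length l" "x = (entry l a, a)"
      by (auto simp: row_set_def)
    have a: "a \<le> 2 * M" using l(3) row_length_le[of l] by simp
    have lh: "l \<le> height a" using le_height_iff[OF l(2) a] l(3) by simp
    define c where "c = 2 * M - a"
    have c: "c < 2 * M" "2 * M - c = a" using a l(2) by (auto simp: c_def)
    have "entry l a \<in> set (?\<tau> ! c)"
      unfolding nth(1)[OF c(1)] c(2) column_def using l(1) lh by (simp del: upt_Suc)
    then have "x \<in> set (?f c)" unfolding l(4) using nth(2)[OF c(1)] c(2) by simp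
    then show "x \<in> set ?L" using c(1) len by auto
  qed
  ultimately show ?thesis
    unfolding charge_word2_def charge_word_def label_word_def descending_def by simp
qed

lemma charge_row_descents:
  "charge (charge_word2 (ord_filling \<sigma>)) = (\<Sum>l\<in>{1..n}. \<Sum>j\<in>row_descents l. row_length l - j)"
proof -
  let ?r = "\<lambda>l. 2 * row_length l"
  have "charge (label_word (row_set entry ?r {1..n})) =
    (\<Sum>l\<in>{1..n}. \<Sum>j | 1 \<le> j \<and> j < ?r l div 2 \<and> entry l (Suc (2 * j)) < entry l (2 * j). ?r l div 2 - j)"
  proof (rule charge_row_set)
    fix l m :: nat assume "l \<le> m"
    then have "{j\<in>{1..M}. m \<le> h j} \<subseteq> {j\<in>{1..M}. l \<le> h j}" by auto
    then show "?r m \<le> ?r l" unfolding row_length_def by (intro mult_left_mono card_mono) auto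
  next
    fix l m assume l: "1 \<le> l" "l < m" "m \<le> n" "1 \<le> ?r m"
    have M: "1 \<le> M" using l(4) row_length_le[of m] by simp
    have "m \<le> height 1" using le_height_iff[of 1 m] l(4) M by simp
    then show "entry l 1 < entry m 1" using first_column_aux(3)[OF M l(1)] l(2) by simp
  next
    fix l m a assume l: "1 \<le> l" "l < m" "m \<le> n" "1 \<le> a" "a < ?r m"
    have a: "Suc a \<le> 2 * M" using l(5) row_length_le[of m] by simp
    have "m \<le> height (Suc a)" using le_height_iff[of "Suc a" m] a l(5) by simp
    then show "if entry l a \<le> entry l (Suc a) then entry m (Suc a) < entry l a \<or> entry l (Suc a) < entry m (Suc a)
       else entry l (Suc a) < entry m (Suc a) \<and> entry m (Suc a) < entry l a"
      by (rule entry_step[OF l(4) a l(1,2)])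
  qed auto
  then show ?thesis unfolding charge_word_rows row_descents_def by simp
qed

end

theorem theorem6p9:
  fixes n :: nat and \<mu> :: "nat list" and w :: "letter \<Rightarrow> letter" and J :: "nat set"
    and \<sigma> \<tau> :: filling
  assumes "n \<ge> 1"
    and "length \<mu> = n" and "sorted_wrt (\<ge>) \<mu>"
    and "(w, J) \<in> folding_pairs_bar n \<mu>"
    and "\<sigma> = filling_map n \<mu> w J"
    and "\<tau> = ord_filling \<sigma>"
  shows "real (level n \<mu> w J) = 1 / 2 * (\<Sum>c\<in>Des \<sigma>. real (arm \<sigma> c))
       \<and> 1 / 2 * (\<Sum>c\<in>Des \<sigma>. real (arm \<sigma> c)) = real (charge (charge_word2 \<tau>))"
proof -
  interpret extremal_pair n \<mu> w J
    by standard (use assms in auto)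
  have "(\<Sum>c\<in>Des \<sigma>. real (arm \<sigma> c)) = real (\<Sum>c\<in>Des \<sigma>. arm \<sigma> c)" by simp
  also have "\<dots> = 2 * real (\<Sum>l\<in>{1..n}. \<Sum>j\<in>row_descents l. row_length l - j)"
    unfolding assms(5) Des_sum_row_descents by simp
  finally show ?thesis
    unfolding assms(5,6) level_row_descents charge_row_descents by simp
qed

end
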